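(* For every $r\ge 2$, Subset-Test-$r$-Cover$(m-k)$ admits a kernel with $|V|\le (k-1)k^5r^{16}+1$ and $|\mathcal{E}|\le (k-1)k^5r^{16}+k$. Consequently, Test-$r$-Cover$(m-k)$ admits a kernel with $|V|\le 5(k-1)k^5r^{16}+4k+1$ and $|\mathcal{E}|\le 3(k-1)k^5r^{16}+3k$.
   Context: An edge $e$ of a hypergraph $(V,\mathcal{E})$ separates vertices $x,y$ if $|\{x,y\}\cap e|=1$; $\mathcal{T}\subseteq\mathcal{E}$ is a test cover if every pair of distinct vertices is separated by an edge of $\mathcal{T}$. Test-$r$-Cover$(m-k)$: given a hypergraph $(V,\mathcal{E})$ with $|\mathcal{E}|=m$, every edge of size at most $r$, $\mathcal{E}$ a test cover, and an integer parameter $k$, decide whether there is a test cover $\mathcal{T}\subseteq\mathcal{E}$ with $|\mathcal{T}|\le m-k$. Subset-Test-$r$-Cover$(m-k)$: the same, except that additionally a subset $\mathcal{B}\subseteq\mathcal{E}$ is given and the test cover must satisfy $\mathcal{B}\subseteq\mathcal{T}$. A kernelization is a polynomial-time algorithm mapping an instance with parameter $k$ to an equivalent instance (yes iff yes) with parameter $k'$, whose size (here: number of vertices and edges) is bounded by a function of $k$ only; the output is called a kernel. *)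

theory Defs
  imports "HOL-Computational_Algebra.Polynomial"
begin

section \<open>Test covers\<close>

definition separates :: "'a set \<Rightarrow> 'a \<Rightarrow> 'a \<Rightarrow> bool" where
  "separates e x y \<longleftrightarrow> card ({x, y} \<inter> e) = 1"

definition test_cover :: "'a set \<Rightarrow> 'a set set \<Rightarrow> bool" where
  "test_cover V T \<longleftrightarrow> (\<forall>x\<in>V. \<forall>y\<in>V. x \<noteq> y \<longrightarrow> (\<exists>e\<in>T. separates e x y))"

text \<open>
  Instances are tuples \<open>(V, E, k)\<close>, respectively \<open>(V, E, B, k)\<close>. As \<open>m - k\<close> can be negative,
  the size condition on a solution is stated over the integers.
\<close>

fun test_r_cover_instance :: "nat \<Rightarrow> 'a set \<times> 'a set set \<times> int \<Rightarrow> bool" where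
  "test_r_cover_instance r (V, E, k) \<longleftrightarrow>
     finite V \<and> E \<subseteq> Pow V \<and> (\<forall>e\<in>E. card e \<le> r) \<and> test_cover V E"

fun test_r_cover_yes :: "'a set \<times> 'a set set \<times> int \<Rightarrow> bool" where
  "test_r_cover_yes (V, E, k) \<longleftrightarrow>
     (\<exists>T\<subseteq>E. test_cover V T \<and> int (card T) \<le> int (card E) - k)"

fun subset_test_r_cover_instance ::
    "nat \<Rightarrow> 'a set \<times> 'a set set \<times> 'a set set \<times> int \<Rightarrow> bool" where
  "subset_test_r_cover_instance r (V, E, B, k) \<longleftrightarrow> test_r_cover_instance r (V, E, k) \<and> B \<subseteq> E"

fun subset_test_r_cover_yes :: "'a set \<times> 'a set set \<times> 'a set set \<times> int \<Rightarrow> bool" where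
  "subset_test_r_cover_yes (V, E, B, k) \<longleftrightarrow>
     (\<exists>T\<subseteq>E. B \<subseteq> T \<and> test_cover V T \<and> int (card T) \<le> int (card E) - k)"


section \<open>Polynomial-time computation\<close>

text \<open>
  The machine model is a while language over binary trees (S-expressions), in the style of
  Jones. A program uses finitely many registers, each holding a tree. A register assignment
  costs one plus the size of the tree that is stored, and a test costs one. Hence the total
  size of all trees present during a run is bounded in terms of the running time and the size
  of the input, and polynomial time in this model is polynomial time on Turing machines, also
  for computing functions (with unit costs, repeated doubling of a tree would be too cheap).
\<close>

datatype tree = Leaf | Node tree tree

type_synonym reg = nat
type_synonym state = "reg \<Rightarrow> tree"

datatype expr = Const_Leaf | Copy reg | Pair reg reg | Left reg | Right reg | Equal reg reg

fun left :: "tree \<Rightarrow> tree" where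
  "left Leaf = Leaf"
| "left (Node a b) = a"

fun right :: "tree \<Rightarrow> tree" where
  "right Leaf = Leaf"
| "right (Node a b) = b"

fun eval_expr :: "expr \<Rightarrow> state \<Rightarrow> tree" where
  "eval_expr Const_Leaf s = Leaf"
| "eval_expr (Copy x) s = s x"
| "eval_expr (Pair x y) s = Node (s x) (s y)"
| "eval_expr (Left x) s = left (s x)"
| "eval_expr (Right x) s = right (s x)"
| "eval_expr (Equal x y) s = (if s x = s y then Node Leaf Leaf else Leaf)"

datatype com =
    Skip
  | Assign reg expr
  | Seq com com
  | If reg com com
  | While reg com

text \<open>
  \<open>exec c s t s'\<close>: started in \<open>s\<close>, the program \<open>c\<close> halts in \<open>s'\<close> after time \<open>t\<close>. A register is
  considered true iff it does not hold \<^const>\<open>Leaf\<close>; \<^const>\<open>size\<close> counts inner nodes.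
\<close>

inductive exec :: "com \<Rightarrow> state \<Rightarrow> nat \<Rightarrow> state \<Rightarrow> bool" where
  Skip: "exec Skip s 1 s"
| Assign: "exec (Assign x e) s (1 + size (eval_expr e s)) (s(x := eval_expr e s))"
| Seq: "exec c1 s t1 s1 \<Longrightarrow> exec c2 s1 t2 s2 \<Longrightarrow> exec (Seq c1 c2) s (t1 + t2) s2"
| If_true: "s x \<noteq> Leaf \<Longrightarrow> exec c1 s t s' \<Longrightarrow> exec (If x c1 c2) s (1 + t) s'"
| If_false: "s x = Leaf \<Longrightarrow> exec c2 s t s' \<Longrightarrow> exec (If x c1 c2) s (1 + t) s'"
| While_true: "s x \<noteq> Leaf \<Longrightarrow> exec c s t1 s1 \<Longrightarrow> exec (While x c) s1 t2 s2 \<Longrightarrow>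
    exec (While x c) s (1 + t1 + t2) s2"
| While_false: "s x = Leaf \<Longrightarrow> exec (While x c) s 1 s"

lemma exec_deterministic:
  "exec c s t s' \<Longrightarrow> exec c s u s'' \<Longrightarrow> t = u \<and> s' = s''"
proof (induction arbitrary: u s'' rule: exec.induct)
  case (Seq c1 s t1 s1 c2 t2 s2)
  from Seq.prems show ?case by (cases rule: exec.cases) (use Seq.IH in blast)+
next
  case (If_true s x c1 t s' c2)
  from If_true.prems show ?case
    by (cases rule: exec.cases) (use If_true.IH If_true.hyps in blast)+
next
  case (If_false s x c2 t s' c1)
  from If_false.prems show ?case
    by (cases rule: exec.cases) (use If_false.IH If_false.hyps in blast)+
next
  case (While_true s x c t1 s1 t2 s2)
  from While_true.prems show ?case
    by (cases rule: exec.cases) (use While_true.IH While_true.hyps in blast)+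
qed (auto elim: exec.cases)

text \<open>Register 0 is used for input and output; all other registers initially hold \<^const>\<open>Leaf\<close>.\<close>

definition computes_in :: "com \<Rightarrow> tree \<Rightarrow> nat \<Rightarrow> tree \<Rightarrow> bool" where
  "computes_in c w t w' \<longleftrightarrow> (\<exists>s'. exec c ((\<lambda>_. Leaf)(0 := w)) t s' \<and> s' 0 = w')"


section \<open>Encoding of instances\<close>

fun tree_of_list :: "tree list \<Rightarrow> tree" where
  "tree_of_list [] = Leaf"
| "tree_of_list (t # ts) = Node t (tree_of_list ts)"

text \<open>
  Vertices are named by arbitrary trees. A finite set is represented by a repetition-free list
  of its elements, in any order, so that an instance has several encodings.
  \<open>codes_set R t X\<close> lifts the representation \<open>R\<close> of elements to sets.
\<close>

definition codes_set :: "(tree \<Rightarrow> 'b \<Rightarrow> bool) \<Rightarrow> tree \<Rightarrow> 'b set \<Rightarrow> bool" where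
  "codes_set R t X \<longleftrightarrow>
     (\<exists>ts xs. t = tree_of_list ts \<and> list_all2 R ts xs \<and> distinct xs \<and> set xs = X)"

definition codes_vertices :: "tree \<Rightarrow> tree set \<Rightarrow> bool" where
  "codes_vertices = codes_set (=)"

definition codes_edges :: "tree \<Rightarrow> tree set set \<Rightarrow> bool" where
  "codes_edges = codes_set (codes_set (=))"

text \<open>
  The parameter is written as a sign followed by its absolute value in unary, in accordance with
  the convention that the size of \<open>(x, k)\<close> is \<open>|x| + k\<close>.
\<close>

definition code_int :: "int \<Rightarrow> tree" where
  "code_int k = Node (if k < 0 then Node Leaf Leaf else Leaf)
                     (tree_of_list (replicate (nat \<bar>k\<bar>) Leaf))"

fun codes_test_r_cover :: "tree \<Rightarrow> tree set \<times> tree set set \<times> int \<Rightarrow> bool" where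
  "codes_test_r_cover w (V, E, k) \<longleftrightarrow>
     (\<exists>v e. w = Node v (Node e (code_int k)) \<and> codes_vertices v V \<and> codes_edges e E)"

fun codes_subset_test_r_cover ::
    "tree \<Rightarrow> tree set \<times> tree set set \<times> tree set set \<times> int \<Rightarrow> bool" where
  "codes_subset_test_r_cover w (V, E, B, k) \<longleftrightarrow>
     (\<exists>v e b. w = Node v (Node e (Node b (code_int k))) \<and>
        codes_vertices v V \<and> codes_edges e E \<and> codes_edges b B)"


section \<open>Kernelization\<close>

record 'i parameterized_problem =
  is_instance :: "'i \<Rightarrow> bool"
  is_yes :: "'i \<Rightarrow> bool"
  parameter :: "'i \<Rightarrow> int"
  num_vertices :: "'i \<Rightarrow> nat"
  num_edges :: "'i \<Rightarrow> nat"
  codes :: "tree \<Rightarrow> 'i \<Rightarrow> bool"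

definition Test_r_Cover ::
    "nat \<Rightarrow> (tree set \<times> tree set set \<times> int) parameterized_problem" where
  "Test_r_Cover r = \<lparr>
     is_instance = test_r_cover_instance r,
     is_yes = test_r_cover_yes,
     parameter = (\<lambda>(V, E, k). k),
     num_vertices = (\<lambda>(V, E, k). card V),
     num_edges = (\<lambda>(V, E, k). card E),
     codes = codes_test_r_cover\<rparr>"

definition Subset_Test_r_Cover ::
    "nat \<Rightarrow> (tree set \<times> tree set set \<times> tree set set \<times> int) parameterized_problem" where
  "Subset_Test_r_Cover r = \<lparr>
     is_instance = subset_test_r_cover_instance r,
     is_yes = subset_test_r_cover_yes,
     parameter = (\<lambda>(V, E, B, k). k),
     num_vertices = (\<lambda>(V, E, B, k). card V),
     num_edges = (\<lambda>(V, E, B, k). card E),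
     codes = codes_subset_test_r_cover\<rparr>"

text \<open>
  A polynomial-time program maps every encoded instance to an encoding of an equivalent instance
  of the same problem whose numbers of vertices and edges are bounded by \<open>f k\<close> and \<open>g k\<close>, where
  \<open>k\<close> is the parameter of the input instance.
\<close>

definition admits_kernel :: "'i parameterized_problem \<Rightarrow> (int \<Rightarrow> int) \<Rightarrow> (int \<Rightarrow> int) \<Rightarrow> bool" where
  "admits_kernel P f g \<longleftrightarrow>
     (\<exists>(c :: com) (p :: nat poly). \<forall>w I. is_instance P I \<and> codes P w I \<longrightarrow>
        (\<exists>t w' I'. computes_in c w t w' \<and> t \<le> poly p (size w) \<and>
           is_instance P I' \<and> codes P w' I' \<and>
           (is_yes P I' \<longleftrightarrow> is_yes P I) \<and>
           int (num_vertices P I') \<le> f (parameter P I) \<and>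
           int (num_edges P I') \<le> g (parameter P I)))"

end

theory Submission
  imports Defs
begin

text \<open>
  Call a non-forced edge a candidate if \<open>E\<close> remains a test cover without it. Discard edges greedily
  until a minimal test cover \<open>E - R\<close> is reached. If \<open>|R| \<ge> k\<close>, the answer is yes. Otherwise every
  candidate \<open>c\<close> without private vertex is in \<open>R\<close> or, together with \<open>R\<close>, contains all edges that
  separate some pair \<open>x, y\<close>; then \<open>x\<close> or \<open>y\<close> lies in \<open>\<Union>R\<close> and the pair is separated by \<open>c\<close> only
  in \<open>E - R\<close>, which leaves \<open>2 r + 1\<close> possibilities for \<open>c\<close> per vertex of \<open>\<Union>R\<close>. So there are
  \<open>O(k r\<^sup>2)\<close> such candidates. Of the candidates with a private vertex at most one can be discarded.
  By the same count only \<open>O(k r\<^sup>4)\<close> of them interfere with the candidates of the first kind; if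
  there is another one, it can be discarded right away, with \<open>k\<close> decreasing by one.

  All other edges are kept anyway and only matter through the partition of \<open>V\<close> into classes of
  vertices they do not separate. Singleton classes other than the class of the vertices in no such
  edge can be dropped, and a class of two vertices already contains a vertex of a candidate, so that
  \<open>O(k r\<^sup>5)\<close> vertices remain. The kept edges are replaced by one edge per class, equipped with a
  gadget that makes this edge critical, so that it need not be declared as forced.
\<close>

section \<open>Blocked edges\<close>

text \<open>The two kinds of candidates are kept apart because the counting argument fails for edges
  with a private vertex. Let \<open>y\<close> be covered only by edges of \<open>R\<close>. Then
  every edge \<open>c\<close> of \<open>E - R\<close> with a private vertex \<open>x\<close> is the
  only edge of \<open>E - R\<close> to separate \<open>x\<close> from \<open>y\<close>, and there
  may be arbitrarily many such \<open>c\<close>. The same edges are harmless for another reason: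
  discarding one of them leaves its private vertex in no remaining edge, and a test cover tolerates
  a single vertex of this sort.

  The factor (2 r + 1) r + 1 enters twice, once for each kind of candidate, and a further factor r
  comes from the vertices of the candidates. This yields at most 95 (k - 1) r^5 vertices and edges.
  The exponents in the stated bounds leave room for the constant, as k and r are at least 2 whenever
  a nontrivial instance is output.

  One program serves both problems: without forced edges it is started with the empty set, and the
  forced edges of its output are forgotten. This is sound because the gadgets make them
  unavoidable.\<close>

lemma separates_iff: "x \<noteq> y \<Longrightarrow> separates e x y \<longleftrightarrow> (x \<in> e) \<noteq> (y \<in> e)"
  by (auto simp: separates_def card_1_singleton_iff Int_insert_left)

lemma test_cover_iff:
  "test_cover V T \<longleftrightarrow> (\<forall>x\<in>V. \<forall>y\<in>V. (\<forall>e\<in>T. x \<in> e \<longleftrightarrow> y \<in> e) \<longrightarrow> x = y)"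
  unfolding test_cover_def using separates_iff by metis

lemma test_coverD:
  "test_cover V T \<Longrightarrow> x \<in> V \<Longrightarrow> y \<in> V \<Longrightarrow> (\<And>e. e \<in> T \<Longrightarrow> x \<in> e \<longleftrightarrow> y \<in> e) \<Longrightarrow> x = y"
  unfolding test_cover_iff by blast

lemma test_cover_mono: "test_cover V T \<Longrightarrow> T \<subseteq> T' \<Longrightarrow> test_cover V T'"
  unfolding test_cover_def by blast

text \<open>The candidates of the overview; \<open>B\<close> is the set of forced edges.\<close>

definition redundant :: "'a set \<Rightarrow> 'a set set \<Rightarrow> 'a set set \<Rightarrow> 'a set set" where
  "redundant V E B = {c \<in> E - B. test_cover V (E - {c})}"

definition has_private :: "'a set set \<Rightarrow> 'a set \<Rightarrow> bool" where
  "has_private E c \<longleftrightarrow> (\<exists>x\<in>c. \<forall>e\<in>E. x \<in> e \<longrightarrow> e = c)"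

text \<open>Discarding \<open>c\<close> along with all of \<open>X\<close> would leave
  \<open>x\<close> and \<open>y\<close> unseparated. The clause on a second edge through
  \<open>x\<close> rules out pairs in which \<open>x\<close> is private to \<open>c\<close> and
  \<open>y\<close> lies in edges of \<open>X\<close> only; such pairs may exist for unboundedly many
  \<open>c\<close>.\<close>

definition blocked :: "'a set \<Rightarrow> 'a set set \<Rightarrow> 'a set set \<Rightarrow> 'a set \<Rightarrow> bool" where
  "blocked V E X c \<longleftrightarrow> (\<exists>x\<in>c. \<exists>y\<in>V. y \<notin> c \<and> (\<exists>e\<in>E. e \<noteq> c \<and> x \<in> e) \<and>
     (\<forall>e\<in>E. (x \<in> e) \<noteq> (y \<in> e) \<longrightarrow> e = c \<or> e \<in> X))"

text \<open>
  If \<open>v\<close> differs from \<open>u\<close> in a single member \<open>c\<close> of \<open>T\<close>, then \<open>v\<close> lies in each of two given members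
  containing \<open>u\<close> except possibly one; hence there are at most \<open>2 r\<close> choices for \<open>v\<close>, and \<open>v\<close>
  determines \<open>c\<close>. The exception is a vertex \<open>u\<close> with a single member.
\<close>

lemma card_flips:
  assumes T: "\<And>t. t \<in> T \<Longrightarrow> finite t \<and> card t \<le> r" and t1: "t1 \<in> T" "u \<in> t1"
  defines "S \<equiv> {c \<in> T. \<exists>v. \<forall>t\<in>T. (u \<in> t) \<noteq> (v \<in> t) \<longleftrightarrow> t = c}"
  shows "finite S \<and> card S \<le> 2 * r + 1"
proof -
  define \<delta> where "\<delta> v = (THE c. c \<in> T \<and> (\<forall>t\<in>T. (u \<in> t) \<noteq> (v \<in> t) \<longleftrightarrow> t = c))" for v
  have \<delta>: "\<delta> v = c" if "c \<in> T" "\<forall>t\<in>T. (u \<in> t) \<noteq> (v \<in> t) \<longleftrightarrow> t = c" for v c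
    unfolding \<delta>_def by (rule the_equality) (use that in blast)+
  obtain A where A: "finite A" "card A \<le> 2 * r" "S \<subseteq> insert t1 (\<delta> ` A)"
  proof (cases "\<exists>t2\<in>T. u \<in> t2 \<and> t2 \<noteq> t1")
    case True
    then obtain t2 where t2: "t2 \<in> T" "u \<in> t2" "t2 \<noteq> t1"
      by blast
    have "card (t1 \<union> t2) \<le> 2 * r"
      using card_Un_le[of t1 t2] T[OF t1(1)] T[OF t2(1)] by linarith
    moreover have "S \<subseteq> \<delta> ` (t1 \<union> t2)"
    proof
      fix c assume "c \<in> S"
      then obtain v where v: "c \<in> T" "\<forall>t\<in>T. (u \<in> t) \<noteq> (v \<in> t) \<longleftrightarrow> t = c"
        unfolding S_def by blast
      then have "v \<in> t1 \<union> t2"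
        using v(2)[rule_format, OF t1(1)] v(2)[rule_format, OF t2(1)] t1 t2 by auto
      then show "c \<in> \<delta> ` (t1 \<union> t2)"
        using \<delta>[OF v] by blast
    qed
    ultimately show ?thesis
      using that[of "t1 \<union> t2"] T[OF t1(1)] T[OF t2(1)] by blast
  next
    case False
    have "S \<subseteq> insert t1 (\<delta> ` t1)"
    proof
      fix c assume "c \<in> S"
      then obtain v where v: "c \<in> T" "\<forall>t\<in>T. (u \<in> t) \<noteq> (v \<in> t) \<longleftrightarrow> t = c"
        unfolding S_def by blast
      then have "c = t1 \<or> v \<in> t1"
        using v(2)[rule_format, OF t1(1)] t1 by auto
      then show "c \<in> insert t1 (\<delta> ` t1)"
        using \<delta>[OF v] by blast
    qed
    then show ?thesis
      using that[of t1] T[OF t1(1)] by simp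
  qed
  have "card S \<le> card (insert t1 (\<delta> ` A))"
    using A by (intro card_mono) auto
  also have "\<dots> \<le> Suc (card (\<delta> ` A))"
    by (rule card_insert_le_m1) auto
  also have "\<dots> \<le> 2 * r + 1"
    using card_image_le[OF A(1), of \<delta>] A(2) by simp
  finally show ?thesis
    using A finite_subset by fastforce
qed

lemma card_Union_le:
  assumes "finite X" "\<And>e. e \<in> X \<Longrightarrow> card e \<le> r"
  shows "card (\<Union>X) \<le> r * card X"
proof -
  have "card (\<Union>X) \<le> (\<Sum>e\<in>X. card e)"
    using card_UN_le[OF assms(1), of "\<lambda>e. e"] by simp
  also have "\<dots> \<le> card X * r"
    using sum_bounded_above[of X card r] assms(2) by simp
  finally show ?thesis
    by (simp add: mult.commute)
qed

lemma card_blocked: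
  assumes V: "finite V" and E: "E \<subseteq> Pow V" "\<And>e. e \<in> E \<Longrightarrow> card e \<le> r" and X: "X \<subseteq> E"
  shows "card {c \<in> E - X. test_cover V (E - {c}) \<and> blocked V E X c} \<le> (2 * r + 1) * r * card X"
    (is "card ?K \<le> _")
proof -
  have finE: "finite E" and finX: "finite X"
    using V E X by (auto intro: finite_subset)
  have T: "finite t \<and> card t \<le> r" if "t \<in> E - X" for t
    using that E V finite_subset by blast
  \<comment> \<open>Only vertices that also lie in an edge of \<open>E - X\<close> are collected,
    since \<open>card_flips\<close> needs a member containing its base vertex.\<close>
  define W where "W = {u \<in> \<Union>X. \<exists>t\<in>E - X. u \<in> t}"
  define S where "S u = {c \<in> E - X. \<exists>v. \<forall>t\<in>E - X. (u \<in> t) \<noteq> (v \<in> t) \<longleftrightarrow> t = c}" for u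
  have XV: "\<Union>X \<subseteq> V"
    using E(1) X by blast
  have finW: "finite W"
    using finite_subset[OF _ V, of W] XV by (auto simp: W_def)
  have "?K \<subseteq> (\<Union>u\<in>W. S u)"
  proof
    fix c assume "c \<in> ?K"
    then have c: "c \<in> E" "c \<notin> X" "test_cover V (E - {c})" "blocked V E X c"
      by auto
    from c(4)[unfolded blocked_def] obtain x y e where
      x: "x \<in> c" "y \<in> V" "y \<notin> c" "e \<in> E" "e \<noteq> c" "x \<in> e"
      and xy: "\<forall>e\<in>E. (x \<in> e) \<noteq> (y \<in> e) \<longrightarrow> e = c \<or> e \<in> X"
      by blast
    have "x \<in> V"
      using c(1) x(1) E(1) by blast
    then obtain e' where e': "e' \<in> E" "e' \<noteq> c" "(x \<in> e') \<noteq> (y \<in> e')"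
      using test_coverD[OF c(3), of x y] x(1-3) by blast
    then have "e' \<in> X"
      using xy[rule_format, OF e'(1,3)] by blast
    have "(x \<in> t) \<noteq> (y \<in> t) \<longleftrightarrow> t = c" if "t \<in> E - X" for t
      using xy[rule_format, of t] that x(1,3) by blast
    moreover from this have "(y \<in> t) \<noteq> (x \<in> t) \<longleftrightarrow> t = c" if "t \<in> E - X" for t
      using that by blast
    ultimately have flip: "c \<in> S x" "c \<in> S y"
      using c(1,2) unfolding S_def by blast+
    show "c \<in> (\<Union>u\<in>W. S u)"
    proof (cases "x \<in> \<Union>X")
      case True
      then show ?thesis
        using flip(1) c(1,2) x(1) unfolding W_def by blast
    next
      case False
      \<comment> \<open>The second edge \<open>e\<close> through \<open>x\<close> is outside
        \<open>X\<close>, so it may not separate the pair and contains \<open>y\<close> as well.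
        This puts \<open>y\<close> into \<open>W\<close>.\<close>
      then have "y \<in> \<Union>X" "y \<in> e"
        using e' \<open>e' \<in> X\<close> xy[rule_format, of e] x by auto
      then show ?thesis
        using False flip(2) x unfolding W_def by blast
    qed
  qed
  moreover have fin: "finite (S u) \<and> card (S u) \<le> 2 * r + 1" if "u \<in> W" for u
  proof -
    from that obtain t where t: "t \<in> E - X" "u \<in> t"
      unfolding W_def by blast
    show ?thesis
      unfolding S_def by (rule card_flips[OF T t])
  qed
  ultimately have "card ?K \<le> card (\<Union>u\<in>W. S u)"
    using finW by (intro card_mono) auto
  also have "\<dots> \<le> (\<Sum>u\<in>W. card (S u))"
    by (rule card_UN_le[OF finW])
  also have "\<dots> \<le> card W * (2 * r + 1)"
    using sum_bounded_above[of W "\<lambda>u. card (S u)" "2 * r + 1"] fin by simp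
  also have "\<dots> \<le> (r * card X) * (2 * r + 1)"
  proof (rule mult_right_mono)
    have "card W \<le> card (\<Union>X)"
      using finite_subset[OF XV V] by (intro card_mono) (auto simp: W_def)
    also have "\<dots> \<le> r * card X"
      using finX X E(2) by (intro card_Union_le) auto
    finally show "card W \<le> r * card X" .
  qed simp
  finally show ?thesis
    by (simp only: mult_ac)
qed

text \<open>By maximality of \<open>R\<close>, a candidate outside \<open>R\<close> leaves some pair
  unseparated when removed. Without a private vertex, the clause on a second edge in
  \<open>blocked\<close> holds for whichever end of the pair lies in the candidate.\<close>

lemma card_redundant_not_private:
  assumes V: "finite V" and E: "E \<subseteq> Pow V" "\<And>e. e \<in> E \<Longrightarrow> card e \<le> r"
    and R: "R \<subseteq> E - B" and tc: "test_cover V (E - R)" and max: "\<And>c. c \<in> E - B - R \<Longrightarrow> \<not> test_cover V (E - R - {c})"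
  shows "card {c \<in> redundant V E B. \<not> has_private E c} \<le> ((2 * r + 1) * r + 1) * card R"
    (is "card ?C \<le> _")
proof -
  let ?K = "{c \<in> E - R. test_cover V (E - {c}) \<and> blocked V E R c}"
  have finE: "finite E"
    using V E by (auto intro: finite_subset)
  then have finR: "finite R"
    using R finite_subset by blast
  have "?C \<subseteq> R \<union> ?K"
  proof
    fix c assume c: "c \<in> ?C"
    then have cE: "c \<in> E" "c \<notin> B" "test_cover V (E - {c})" "\<not> has_private E c"
      by (auto simp: redundant_def)
    have "blocked V E R c" if "c \<notin> R"
    proof -
      have "\<not> test_cover V (E - R - {c})"
        using max cE that by blast
      then obtain x y where xy: "x \<in> V" "y \<in> V" "x \<noteq> y"
        "\<forall>e\<in>E - R - {c}. x \<in> e \<longleftrightarrow> y \<in> e"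
        unfolding test_cover_iff by blast
      with tc have "(x \<in> c) \<noteq> (y \<in> c)"
        using test_coverD[OF tc, of x y] by blast
      moreover have "blocked V E R c" if "u \<in> c" "v \<notin> c" "v \<in> V"
        "\<forall>e\<in>E - R - {c}. u \<in> e \<longleftrightarrow> v \<in> e" for u v
      proof -
        have "\<exists>e\<in>E. e \<noteq> c \<and> u \<in> e"
          using cE(4) that(1) unfolding has_private_def by blast
        moreover have "\<forall>e\<in>E. (u \<in> e) \<noteq> (v \<in> e) \<longrightarrow> e = c \<or> e \<in> R"
          using that(4) by blast
        ultimately show ?thesis
          unfolding blocked_def using that(1-3) by blast
      qed
      from this[of x y] this[of y x] have "x \<in> c \<Longrightarrow> y \<notin> c \<Longrightarrow> ?thesis"
        "y \<in> c \<Longrightarrow> x \<notin> c \<Longrightarrow> ?thesis"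
        using xy by simp_all
      ultimately show ?thesis
        by blast
    qed
    with cE show "c \<in> R \<union> ?K"
      by blast
  qed
  then have "card ?C \<le> card (R \<union> ?K)"
    using finE finR by (intro card_mono) auto
  also have "\<dots> \<le> card R + card ?K"
    by (rule card_Un_le)
  also have "card ?K \<le> (2 * r + 1) * r * card R"
    using card_blocked[OF V E] R by blast
  finally show ?thesis
    by (simp add: algebra_simps)
qed

text \<open>
  An unblocked edge \<open>d\<close> with a private vertex \<open>z\<close> may be assumed to be discarded. Indeed, if
  \<open>E - R\<close> is a test cover, one edge of \<open>R\<close> can be put back in such a way that all vertices
  are covered; then \<open>d\<close> can be discarded in exchange, \<open>z\<close> being the only uncovered vertex.
\<close>

lemma discard_unblocked:
  assumes E: "\<Union>E \<subseteq> V"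
    and d: "d \<in> redundant V E B" "has_private E d"
    and unblocked: "\<not> blocked V E {c \<in> redundant V E B. \<not> has_private E c} d"
    and R: "R \<subseteq> E - B" "test_cover V (E - R)" "R \<noteq> {}"
  obtains R' where "R' \<subseteq> E - {d} - B" "test_cover V (E - {d} - R')" "card R' + 1 = card R \<or> infinite R"
proof (cases "d \<in> R")
  case True
  have "E - {d} - (R - {d}) = E - R"
    using True by blast
  then show ?thesis
    using that[of "R - {d}"] R True card_Suc_Diff1[of R d] by auto
next
  case False
  let ?unc = "\<lambda>R x. x \<in> V \<and> (\<forall>e\<in>E - R. x \<notin> e)"
  have dE: "d \<in> E" "test_cover V (E - {d})"
    using d(1) by (auto simp: redundant_def)
  obtain z where z: "z \<in> d" "\<And>e. e \<in> E \<Longrightarrow> z \<in> e \<Longrightarrow> e = d"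
    using d(2) unfolding has_private_def by blast
  have zV: "z \<in> V"
    using z(1) dE(1) E by blast
  have unique: "x = y" if "?unc R x" "?unc R y" for x y
    using test_coverD[OF R(2), of x y] that by blast
  \<comment> \<open>A vertex in no edge at all could not be told from \<open>z\<close> once
    \<open>d\<close> is gone.\<close>
  have covered: "\<exists>e\<in>E. x \<in> e" if "x \<in> V" for x
  proof (rule ccontr)
    assume "\<not> (\<exists>e\<in>E. x \<in> e)"
    then show False
      using test_coverD[OF dE(2) that zV] z dE(1) by blast
  qed
  obtain e where e: "e \<in> R" "\<And>x. \<not> ?unc (R - {e}) x"
  proof (cases "\<exists>x. ?unc R x")
    case True
    then obtain x where x: "?unc R x"
      by blast
    then obtain e where "e \<in> E" "x \<in> e"
      using covered by blast
    moreover from this x have "e \<in> R"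
      by blast
    ultimately show ?thesis
      using that[of e] unique[OF x] by blast
  next
    case False
    then show ?thesis
      using that R(3) by blast
  qed
  define R' where "R' = R - {e}"
  have tc: "test_cover V (E - R')"
    using R(2) by (rule test_cover_mono) (auto simp: R'_def)
  \<comment> \<open>An edge of \<open>R'\<close> with a private vertex would leave that vertex
    uncovered. So \<open>R'\<close> consists of candidates without private vertex, which is the set
    that \<open>d\<close> is not blocked by.\<close>
  have R'C: "c \<in> redundant V E B \<and> \<not> has_private E c" if c: "c \<in> R'" for c
  proof
    have cE: "c \<in> E" "c \<notin> B"
      using c R(1) by (auto simp: R'_def)
    have "test_cover V (E - {c})"
      using tc by (rule test_cover_mono) (use c in auto)
    then show "c \<in> redundant V E B"
      using cE by (simp add: redundant_def)
    show "\<not> has_private E c"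
    proof
      assume "has_private E c"
      then obtain x where "x \<in> c" "\<And>e. e \<in> E \<Longrightarrow> x \<in> e \<Longrightarrow> e = c"
        unfolding has_private_def by blast
      then have "?unc R' x"
        using c cE E by blast
      then show False
        using e(2) unfolding R'_def by blast
    qed
  qed
  have "test_cover V (E - {d} - R')"
    unfolding test_cover_iff
  proof (intro ballI impI, rule ccontr)
    have *: False if xy: "x \<in> V" "y \<in> V" "\<forall>e\<in>E - {d} - R'. x \<in> e \<longleftrightarrow> y \<in> e" "x \<in> d" "y \<notin> d" for x y
    proof -
      have "\<not> (\<exists>e\<in>E. e \<noteq> d \<and> x \<in> e)"
        using unblocked xy R'C unfolding blocked_def by blast
      then have "?unc R' y"
        using xy by blast
      then show False
        using e(2) unfolding R'_def by blast
    qed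
    fix x y assume xy: "x \<in> V" "y \<in> V" "\<forall>e\<in>E - {d} - R'. x \<in> e \<longleftrightarrow> y \<in> e" "x \<noteq> y"
    then have "(x \<in> d) \<noteq> (y \<in> d)"
      using test_coverD[OF tc, of x y] by blast
    then show False
      using *[of x y] *[of y x] xy by blast
  qed
  moreover have "R' \<subseteq> E - {d} - B" "card R' + 1 = card R \<or> infinite R"
    using R(1) False e(1) card_Suc_Diff1[of R e] by (auto simp: R'_def)
  ultimately show ?thesis
    using that by blast
qed

text \<open>The role of the discarded set in \<open>card_blocked\<close> is now played by all
  candidates without private vertex. Their number already contains the factor
  \<open>(2 * r + 1) * r + 1\<close>, so the total is of order r^4.\<close>

lemma card_redundant_unblocked:
  assumes V: "finite V" and E: "E \<subseteq> Pow V" "\<And>e. e \<in> E \<Longrightarrow> card e \<le> r"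
    and blocked: "\<And>c. c \<in> redundant V E B \<Longrightarrow> has_private E c \<Longrightarrow>
      blocked V E {c \<in> redundant V E B. \<not> has_private E c} c"
    and card: "card {c \<in> redundant V E B. \<not> has_private E c} \<le> M"
  shows "card (redundant V E B) \<le> ((2 * r + 1) * r + 1) * M"
proof -
  let ?X = "{c \<in> redundant V E B. \<not> has_private E c}"
  let ?K = "{c \<in> E - ?X. test_cover V (E - {c}) \<and> blocked V E ?X c}"
  have X: "?X \<subseteq> E"
    by (auto simp: redundant_def)
  have fin: "finite E"
    using V E by (auto intro: finite_subset)
  then have "card (redundant V E B) \<le> card (?X \<union> ?K)"
    using X blocked by (intro card_mono) (auto simp: redundant_def)
  also have "\<dots> \<le> card ?X + card ?K"
    by (rule card_Un_le)
  also have "\<dots> \<le> card ?X + (2 * r + 1) * r * card ?X"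
    using card_blocked[OF V E X] by (rule add_left_mono)
  also have "\<dots> = ((2 * r + 1) * r + 1) * card ?X"
    by (simp add: algebra_simps)
  also have "\<dots> \<le> ((2 * r + 1) * r + 1) * M"
    using card by (rule mult_le_mono2)
  finally show ?thesis .
qed

text \<open>After \<open>d\<close> has been discarded, no other private vertex can become uncovered.\<close>

lemma redundant_discard:
  assumes E: "\<Union>E \<subseteq> V" and d: "d \<in> E" "has_private E d"
  shows "redundant V (E - {d}) B \<subseteq> {c \<in> redundant V E B. \<not> has_private E c}"
proof
  fix c assume c: "c \<in> redundant V (E - {d}) B"
  then have tc: "test_cover V (E - {d} - {c})" and cE: "c \<in> E" "c \<noteq> d" "c \<notin> B"
    by (auto simp: redundant_def)
  have "\<not> has_private E c"
  proof
    assume "has_private E c"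
    then obtain x where x: "x \<in> c" "\<And>e. e \<in> E \<Longrightarrow> x \<in> e \<Longrightarrow> e = c"
      unfolding has_private_def by blast
    obtain z where z: "z \<in> d" "\<And>e. e \<in> E \<Longrightarrow> z \<in> e \<Longrightarrow> e = d"
      using d(2) unfolding has_private_def by blast
    have "x \<in> V" "z \<in> V"
      using x(1) z(1) E cE(1) d(1) by blast+
    moreover have "x \<notin> e" "z \<notin> e" if "e \<in> E - {d} - {c}" for e
      using x(2)[of e] z(2)[of e] that by auto
    ultimately have "x = z"
      using test_coverD[OF tc, of x z] by simp
    then show False
      using x(1) z(2)[of c] cE by simp
  qed
  moreover have "test_cover V (E - {c})"
    using tc by (rule test_cover_mono) blast
  ultimately show "c \<in> {c \<in> redundant V E B. \<not> has_private E c}"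
    using cE by (simp add: redundant_def)
qed

section \<open>Compression of the required edges\<close>

text \<open>Describing a solution by the edges it omits makes the number of edges disappear from the
  size condition; exchange arguments are carried out on this form.\<close>

lemma subset_yes_iff_discard:
  assumes "finite E" "B \<subseteq> E"
  shows "subset_test_r_cover_yes (V, E, B, k) \<longleftrightarrow>
    (\<exists>R\<subseteq>E - B. test_cover V (E - R) \<and> k \<le> int (card R))"
proof -
  have card: "int (card (E - R)) = int (card E) - int (card R)" if "R \<subseteq> E" for R
    using that assms(1) by (simp add: card_Diff_subset card_mono finite_subset of_nat_diff)
  show ?thesis
  proof
    assume "subset_test_r_cover_yes (V, E, B, k)"
    then obtain T where T: "T \<subseteq> E" "B \<subseteq> T" "test_cover V T" "int (card T) \<le> int (card E) - k"
      by auto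
    then have "E - (E - T) = T"
      by blast
    then show "\<exists>R\<subseteq>E - B. test_cover V (E - R) \<and> k \<le> int (card R)"
      using T card[of "E - T"] by (intro exI[of _ "E - T"]) auto
  next
    assume "\<exists>R\<subseteq>E - B. test_cover V (E - R) \<and> k \<le> int (card R)"
    then obtain R where R: "R \<subseteq> E - B" "test_cover V (E - R)" "k \<le> int (card R)"
      by blast
    moreover have "R \<subseteq> E"
      using R(1) by blast
    ultimately show "subset_test_r_cover_yes (V, E, B, k)"
      using card[of R] assms(2) unfolding subset_test_r_cover_yes.simps
      by (intro exI[of _ "E - R"]) auto
  qed
qed

text \<open>Every edge that some solution omits is a candidate, by monotonicity. Hence the edges
  outside \<open>C\<close> matter only through the pairs that they separate, and the forced edges
  are just some of them. This is the form that compression preserves.\<close>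

lemma subset_yes_iff_keep:
  assumes E: "finite E" "B \<subseteq> E" and C: "C = redundant V E B"
  shows "subset_test_r_cover_yes (V, E, B, int k) \<longleftrightarrow>
    (\<exists>K\<subseteq>C. test_cover V ((E - C) \<union> K) \<and> card K + k \<le> card C)"
proof -
  have CE: "C \<subseteq> E" and finC: "finite C"
    using E(1) C by (auto simp: redundant_def)
  have card: "card C = card K + card (C - K)" if "K \<subseteq> C" for K
    using card_Un_disjoint[of K "C - K"] that finC by (simp add: Un_absorb1 finite_subset)
  show ?thesis
    unfolding subset_yes_iff_discard[OF E]
  proof
    assume "\<exists>R\<subseteq>E - B. test_cover V (E - R) \<and> int k \<le> int (card R)"
    then obtain R where R: "R \<subseteq> E - B" "test_cover V (E - R)" "k \<le> card R"
      by auto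
    have RC: "R \<subseteq> C"
    proof
      fix c assume c: "c \<in> R"
      then have "test_cover V (E - {c})"
        using R(2) by (elim test_cover_mono) blast
      with c R(1) show "c \<in> C"
        unfolding C redundant_def by blast
    qed
    then have "(E - C) \<union> (C - R) = E - R" "C - (C - R) = R"
      using CE by blast+
    then show "\<exists>K\<subseteq>C. test_cover V ((E - C) \<union> K) \<and> card K + k \<le> card C"
      using R(2,3) card[of "C - R"] by (intro exI[of _ "C - R"]) auto
  next
    assume "\<exists>K\<subseteq>C. test_cover V ((E - C) \<union> K) \<and> card K + k \<le> card C"
    then obtain K where K: "K \<subseteq> C" "test_cover V ((E - C) \<union> K)" "card K + k \<le> card C"
      by blast
    have "E - (C - K) = (E - C) \<union> K" "C - K \<subseteq> E - B"
      using K(1) CE C by (auto simp: redundant_def)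
    then show "\<exists>R\<subseteq>E - B. test_cover V (E - R) \<and> int k \<le> int (card R)"
      using K card[OF K(1)] by (intro exI[of _ "C - K"]) auto
  qed
qed

text \<open>The reduction rule for unblocked edges: in one direction the exchange costs one
  discarded edge, in the other \<open>d\<close> is discarded in addition.\<close>

lemma subset_yes_discard_unblocked:
  assumes E: "\<Union>E \<subseteq> V" "finite E" "B \<subseteq> E"
    and d: "d \<in> redundant V E B" "has_private E d"
    and unblocked: "\<not> blocked V E {c \<in> redundant V E B. \<not> has_private E c} d"
  shows "subset_test_r_cover_yes (V, E, B, int (Suc k)) \<longleftrightarrow>
    subset_test_r_cover_yes (V, E - {d}, B, int k)"
proof -
  have d': "d \<in> E" "d \<notin> B"
    using d by (auto simp: redundant_def)
  then have B: "B \<subseteq> E - {d}" and fin: "finite (E - {d})"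
    using E by blast+
  show ?thesis
    unfolding subset_yes_iff_discard[OF E(2,3)] subset_yes_iff_discard[OF fin B]
  proof
    assume "\<exists>R\<subseteq>E - B. test_cover V (E - R) \<and> int (Suc k) \<le> int (card R)"
    then obtain R where R: "R \<subseteq> E - B" "test_cover V (E - R)" "Suc k \<le> card R"
      by auto
    then have "R \<noteq> {}"
      by auto
    then obtain R' where "R' \<subseteq> E - {d} - B" "test_cover V (E - {d} - R')"
      "card R' + 1 = card R \<or> infinite R"
      by (rule discard_unblocked[OF E(1) d unblocked R(1,2)]) blast
    moreover have "finite R"
      using R(1) E(2) by (auto intro: finite_subset)
    ultimately show "\<exists>R\<subseteq>E - {d} - B. test_cover V (E - {d} - R) \<and> int k \<le> int (card R)"
      using R(3) by (intro exI[of _ R']) auto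
  next
    assume "\<exists>R\<subseteq>E - {d} - B. test_cover V (E - {d} - R) \<and> int k \<le> int (card R)"
    then obtain R where R: "R \<subseteq> E - {d} - B" "test_cover V (E - {d} - R)" "k \<le> card R"
      by auto
    then have "finite R" "d \<notin> R" "E - insert d R = E - {d} - R"
      using fin by (auto intro: finite_subset)
    then show "\<exists>R\<subseteq>E - B. test_cover V (E - R) \<and> int (Suc k) \<le> int (card R)"
      using R d' by (intro exI[of _ "insert d R"]) auto
  qed
qed

text \<open>The number is put in front in unary, so that any tree can serve as a vertex name without
  clashes. Tag 0 is recognized by an empty left component, which the program exploits.\<close>

definition tag :: "nat \<Rightarrow> tree \<Rightarrow> tree" where
  "tag n x = Node (tree_of_list (replicate n Leaf)) x"

lemma tag_eq_iff [simp]: "tag m x = tag n y \<longleftrightarrow> m = n \<and> x = y"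
proof -
  have "size (tree_of_list (replicate n Leaf)) = n" for n
    by (induction n) auto
  then show ?thesis
    unfolding tag_def by (metis tree.inject)
qed

text \<open>
  \<open>X\<close> contains one representative of each class of vertices outside \<open>uncovered\<close>. A class of less
  than \<open>r\<close> vertices gets an edge with an additional vertex \<open>p\<close> and the edges \<open>{p, q, s}\<close> and
  \<open>{s, t}\<close>. Then each of these three edges is the only one to separate a certain pair: \<open>p, q\<close>
  for the first, \<open>s, t\<close> for the second and \<open>q, s\<close> for the third. A class of \<open>r\<close> vertices has no
  room for \<open>p\<close>, but then it is an edge of \<open>E - C\<close> and inherits a critical pair from there. The tags
  0 to 4 mark old vertices and \<open>p, q, s, t\<close>.
\<close>

locale compression =
  fixes r :: nat and V :: "tree set" and E C :: "tree set set" and X :: "tree set"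
  fixes same and uncovered and V2 and cls and small
  defines "same x y \<equiv> \<forall>b\<in>E - C. x \<in> b \<longleftrightarrow> y \<in> b"
    and "uncovered x \<equiv> \<forall>b\<in>E - C. x \<notin> b"
    and "V2 \<equiv> {x \<in> V. uncovered x \<or> (\<exists>y\<in>V. y \<noteq> x \<and> same x y)}"
    and "cls x \<equiv> {y \<in> V2. same x y}"
    and "small x \<equiv> card (cls x) < r"
  assumes V: "finite V" and E: "E \<subseteq> Pow V" "\<And>e. e \<in> E \<Longrightarrow> card e \<le> r"
    and tc: "test_cover V E" and C: "C \<subseteq> E"
    and X: "X \<subseteq> {x \<in> V2. \<not> uncovered x}"
    and X_same: "\<And>x y. x \<in> X \<Longrightarrow> y \<in> X \<Longrightarrow> same x y \<Longrightarrow> x = y"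
    and X_ex: "\<And>y. y \<in> V2 \<Longrightarrow> \<not> uncovered y \<Longrightarrow> \<exists>x\<in>X. same x y"
begin

definition f_edge :: "tree \<Rightarrow> tree set" where
  "f_edge x = tag 0 ` cls x \<union> (if small x then {tag 1 x} else {})"

definition g_edge :: "tree \<Rightarrow> tree set" where
  "g_edge x = {tag 1 x, tag 2 x, tag 3 x}"

definition h_edge :: "tree \<Rightarrow> tree set" where
  "h_edge x = {tag 3 x, tag 4 x}"

definition trace :: "tree set \<Rightarrow> tree set" where
  "trace c = tag 0 ` (c \<inter> V2)"

definition V3 :: "tree set" where
  "V3 = tag 0 ` V2 \<union> (\<Union>n\<in>{1..4}. tag n ` {x \<in> X. small x})"

definition B3 :: "tree set set" where
  "B3 = f_edge ` X \<union> g_edge ` {x \<in> X. small x} \<union> h_edge ` {x \<in> X. small x}"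

definition C3 :: "tree set set" where
  "C3 = trace ` C - B3"

section \<open>Classes of the kept edges and the number of retained vertices\<close>

lemma finE: "finite E" and finC: "finite C" and finV2: "finite V2" and finX: "finite X"
proof -
  show "finite E"
    using V E(1) by (auto intro: finite_subset)
  then show "finite C"
    using C by (rule rev_finite_subset)
  show "finite V2"
    using V by (simp add: V2_def)
  then show "finite X"
    using X by (auto intro: finite_subset)
qed

lemma same_sym: "same x y \<Longrightarrow> same y x" and same_trans: "same x y \<Longrightarrow> same y z \<Longrightarrow> same x z"
  by (auto simp: same_def)

lemma same_refl: "same x x"
  by (simp add: same_def)

lemma uncovered_same: "uncovered x \<Longrightarrow> uncovered y \<Longrightarrow> same x y"
  and same_uncovered: "same x y \<Longrightarrow> uncovered x \<Longrightarrow> uncovered y"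
  by (auto simp: same_def uncovered_def)

lemma V2_V: "x \<in> V2 \<Longrightarrow> x \<in> V"
  by (simp add: V2_def)

lemma V2_same: "x \<in> V2 \<Longrightarrow> y \<in> V \<Longrightarrow> same x y \<Longrightarrow> y \<in> V2"
  by (cases "y = x") (auto simp: V2_def intro: same_sym same_uncovered)

lemma separated_by_C:
  assumes "x \<in> V" "y \<in> V" "x \<noteq> y" "same x y"
  shows "\<exists>c\<in>C. (x \<in> c) \<noteq> (y \<in> c)"
proof (rule ccontr)
  assume "\<not> (\<exists>c\<in>C. (x \<in> c) \<noteq> (y \<in> c))"
  then have "x = y"
    using assms by (intro test_coverD[OF tc]) (auto simp: same_def)
  with assms(3) show False ..
qed

text \<open>Within a class only edges of \<open>C\<close> separate, so a class has at most one
  vertex outside \<open>N\<close>. Such a vertex is charged to an equivalent vertex of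
  \<open>N\<close>, if there is one; this is the factor 2. The summand 1 is an uncovered vertex
  without such a partner.\<close>

lemma card_V2: "card V2 \<le> 2 * r * card C + 1"
proof -
  define N where "N = \<Union>C"
  define Z where "Z = {x \<in> V2 - N. uncovered x \<and> \<not> (\<exists>y\<in>N. same x y)}"
  define W where "W = {x \<in> V2 - N. \<exists>y\<in>N. same x y}"
  have NV: "N \<subseteq> V"
    using C E(1) by (auto simp: N_def)
  then have finN: "finite N"
    using V finite_subset by blast
  have cardN: "card N \<le> r * card C"
    unfolding N_def using finC C E(2) by (intro card_Union_le) auto
  have outside: "x = y" if "x \<in> V2 - N" "y \<in> V2 - N" "same x y" for x y
    using separated_by_C[of x y] that by (auto simp: V2_def N_def)
  have "V2 \<subseteq> N \<union> W \<union> Z"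
  proof
    fix x assume x: "x \<in> V2"
    show "x \<in> N \<union> W \<union> Z"
    proof (cases "x \<in> N \<or> uncovered x")
      case True
      with x show ?thesis
        by (auto simp: W_def Z_def)
    next
      case False
      with x obtain y where y: "y \<in> V" "y \<noteq> x" "same x y"
        by (auto simp: V2_def)
      then have "y \<in> N"
        using outside[of x y] V2_same[of x y] x False by blast
      with x y False show ?thesis
        by (auto simp: W_def)
    qed
  qed
  moreover have "finite (N \<union> W \<union> Z)"
    using finN finV2 by (simp add: W_def Z_def)
  ultimately have "card V2 \<le> card (N \<union> W \<union> Z)"
    by (intro card_mono)
  also have "\<dots> \<le> card N + card W + card Z"
    by (meson card_Un_le add_right_mono order_trans)
  also have "card W \<le> card N"
  proof -
    define \<phi> where "\<phi> x = (SOME y. y \<in> N \<and> same x y)" for x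
    have \<phi>: "\<phi> x \<in> N \<and> same x (\<phi> x)" if "x \<in> W" for x
      using that someI_ex[of "\<lambda>y. y \<in> N \<and> same x y"] by (auto simp: W_def \<phi>_def)
    have "inj_on \<phi> W"
    proof (rule inj_onI)
      fix x y assume "x \<in> W" "y \<in> W" "\<phi> x = \<phi> y"
      with \<phi>[of x] \<phi>[of y] have "same x y"
        by (metis same_sym same_trans)
      then show "x = y"
        using outside \<open>x \<in> W\<close> \<open>y \<in> W\<close> by (auto simp: W_def)
    qed
    then show ?thesis
      using \<phi> finN by (intro card_inj_on_le[of \<phi>]) auto
  qed
  also have "card Z \<le> 1"
  proof -
    have "x = y" if "x \<in> Z" "y \<in> Z" for x y
      using outside[of x y] uncovered_same[of x y] that by (auto simp: Z_def)
    moreover have "finite Z"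
      using finV2 by (simp add: Z_def)
    ultimately show ?thesis
      using card_le_Suc0_iff_eq[of Z] by auto
  qed
  finally show ?thesis
    using cardN by simp
qed

text \<open>A class is contained in every kept edge that it meets. A class of \<open>r\<close>
  vertices therefore exhausts each such edge, so it meets only one kept edge and equals it.\<close>

lemma card_cls_le: "x \<in> X \<Longrightarrow> card (cls x) \<le> r"
  and full_edge: "x \<in> X \<Longrightarrow> \<not> small x \<Longrightarrow> b \<in> E - C \<Longrightarrow> x \<in> b \<Longrightarrow> cls x = b"
proof -
  have *: "cls x \<subseteq> b \<and> finite b \<and> card b \<le> r" if "b \<in> E - C" "x \<in> b" for x b
    using that E V by (auto simp: cls_def same_def intro: finite_subset)
  show "card (cls x) \<le> r" if x: "x \<in> X"
  proof -
    obtain b where "b \<in> E - C" "x \<in> b"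
      using x X by (auto simp: uncovered_def)
    from *[OF this] show ?thesis
      using card_mono order_trans by blast
  qed
  show "cls x = b" if "x \<in> X" "\<not> small x" "b \<in> E - C" "x \<in> b"
    using *[OF that(3,4)] that(2) card_seteq unfolding small_def by (metis le_trans not_less)
qed

text \<open>A covered vertex is retained only if it has a partner in its class. Consequently a small
  class forces \<open>r\<close> to be at least 3, which leaves room for the gadget edge with three
  vertices.\<close>

lemma card_cls_ge: "x \<in> X \<Longrightarrow> 2 \<le> card (cls x)"
proof -
  assume x: "x \<in> X"
  then obtain y where y: "y \<in> V" "y \<noteq> x" "same x y"
    using X by (auto simp: V2_def)
  then have "{x, y} \<subseteq> cls x"
    using x X V2_same[of x y] same_refl by (auto simp: cls_def)
  then have "card {x, y} \<le> card (cls x)"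
    using finV2 by (intro card_mono) (auto simp: cls_def)
  then show ?thesis
    using y(2) by simp
qed

section \<open>The compressed hypergraph and its equivalence to the given one\<close>

lemma tag_mem_trace [simp]: "tag n x \<in> trace c \<longleftrightarrow> n = 0 \<and> x \<in> c \<and> x \<in> V2"
  by (auto simp: trace_def)

lemma tag_mem_f [simp]:
  "tag n x \<in> f_edge y \<longleftrightarrow> n = 0 \<and> x \<in> V2 \<and> same y x \<or> n = 1 \<and> x = y \<and> small y"
  by (auto simp: f_edge_def cls_def)

lemma tag_mem_g [simp]: "tag n x \<in> g_edge y \<longleftrightarrow> x = y \<and> n \<in> {1, 2, 3}"
  and tag_mem_h [simp]: "tag n x \<in> h_edge y \<longleftrightarrow> x = y \<and> n \<in> {3, 4}"
  by (auto simp: g_edge_def h_edge_def)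

lemma tag_mem_V3 [simp]:
  "tag n x \<in> V3 \<longleftrightarrow> n = 0 \<and> x \<in> V2 \<or> n \<in> {1, 2, 3, 4} \<and> x \<in> X \<and> small x"
proof -
  have "{1..4} = {1, 2, 3, 4::nat}"
    by auto
  then have "V3 = tag 0 ` V2 \<union> (\<Union>n\<in>{1, 2, 3, 4}. tag n ` {x \<in> X. small x})"
    unfolding V3_def by (simp only:)
  then show ?thesis
    by (simp only:) auto
qed

lemma fin3: "finite V3" "finite B3" "finite C3"
  using finV2 finX finC by (auto simp: V3_def B3_def C3_def)

lemma edges3: "e \<in> C3 \<union> B3 \<Longrightarrow> e \<subseteq> V3 \<and> card e \<le> r"
proof -
  assume "e \<in> C3 \<union> B3"
  then consider c where "c \<in> C" "e = trace c" | x where "x \<in> X" "e = f_edge x"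
    | x where "x \<in> X" "small x" "e = g_edge x \<or> e = h_edge x"
    by (auto simp: C3_def B3_def)
  then show ?thesis
  proof cases
    case (1 c)
    have "finite c" "card c \<le> r"
      using 1 C E V by (auto intro: finite_subset)
    then have "card e \<le> r"
      using card_image_le[of "c \<inter> V2" "tag 0"] card_mono[of c "c \<inter> V2"] 1(2)
      by (simp add: trace_def)
    with 1 show ?thesis
      by (auto simp: trace_def)
  next
    case (2 x)
    have fin: "finite (cls x)"
      using finV2 by (simp add: cls_def)
    have "card e \<le> r"
    proof (cases "small x")
      case True
      have "card e \<le> Suc (card (tag 0 ` cls x))"
        using card_insert_le_m1[of "Suc (card (tag 0 ` cls x))" "tag 0 ` cls x" "tag 1 x"] True 2 fin
        by (simp add: f_edge_def)
      with True show ?thesis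
        using card_image_le[OF fin, of "tag 0"] by (simp add: small_def)
    next
      case False
      with 2 show ?thesis
        using card_image_le[OF fin, of "tag 0"] card_cls_le[of x] by (simp add: f_edge_def)
    qed
    with 2 show ?thesis
      by (auto simp: f_edge_def cls_def)
  next
    case (3 x)
    have "3 \<le> r"
      using card_cls_ge[OF 3(1)] 3(2) by (simp add: small_def)
    moreover have "card e \<le> 3"
      using 3(3) by (auto simp: g_edge_def h_edge_def)
    ultimately show ?thesis
      using 3 by (auto simp: g_edge_def h_edge_def)
  qed
qed

lemma V3_cases:
  assumes "v \<in> V3"
  obtains x where "v = tag 0 x" "x \<in> V2"
  | n x where "v = tag n x" "n \<in> {1, 2, 3, 4}" "x \<in> X" "small x"
proof -
  from assms obtain n x where "v = tag n x"
    unfolding V3_def by blast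
  with assms show thesis
    using that by auto
qed

text \<open>The new required edges restore the partition exactly. The uncovered vertices form one
  class without an edge of its own; it is identified by lying in none of the new edges.\<close>

lemma B3_same:
  assumes "x \<in> V2" "y \<in> V2"
  shows "(\<forall>b\<in>B3. tag 0 x \<in> b \<longleftrightarrow> tag 0 y \<in> b) \<longleftrightarrow> same x y"
proof
  assume B: "\<forall>b\<in>B3. tag 0 x \<in> b \<longleftrightarrow> tag 0 y \<in> b"
  have *: "same x y" if "x \<in> V2" "y \<in> V2" "\<not> uncovered x"
    "\<forall>b\<in>B3. tag 0 x \<in> b \<longleftrightarrow> tag 0 y \<in> b" for x y
  proof -
    obtain z where z: "z \<in> X" "same z x"
      using X_ex[OF \<open>x \<in> V2\<close> \<open>\<not> uncovered x\<close>] by blast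
    then have "f_edge z \<in> B3" "tag 0 x \<in> f_edge z"
      using \<open>x \<in> V2\<close> by (simp_all add: B3_def)
    then have "tag 0 y \<in> f_edge z"
      using \<open>\<forall>b\<in>B3. tag 0 x \<in> b \<longleftrightarrow> tag 0 y \<in> b\<close> by blast
    then have "same z y"
      by simp
    with z(2) show ?thesis
      using same_sym same_trans by blast
  qed
  show "same x y"
  proof (cases "uncovered x \<and> uncovered y")
    case True
    then show ?thesis
      by (simp add: uncovered_same)
  next
    case False
    then show ?thesis
      using *[of x y] *[of y x] same_sym[of y x] assms B by auto
  qed
next
  assume xy: "same x y"
  have "same z x \<longleftrightarrow> same z y" for z
    using xy same_sym same_trans by blast
  with assms show "\<forall>b\<in>B3. tag 0 x \<in> b \<longleftrightarrow> tag 0 y \<in> b"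
    by (auto simp: B3_def)
qed

text \<open>A gadget vertex is identified by its membership in the three edges of its
  representative: tag 1 lies in f and g, tag 2 in g, tag 3 in g and h, tag 4 in h, while old
  vertices lie in no g or h. The hypothesis is an inclusion because a trace that coincides with a
  required edge need not be kept separately.\<close>

lemma test_cover3:
  assumes "test_cover V ((E - C) \<union> K)" "trace ` K \<subseteq> K3 \<union> B3"
  shows "test_cover V3 (B3 \<union> K3)"
  unfolding test_cover_iff
proof (intro ballI impI)
  fix u v assume uv: "u \<in> V3" "v \<in> V3" and eq: "\<forall>e\<in>B3 \<union> K3. u \<in> e \<longleftrightarrow> v \<in> e"
  have *: "u = v" if "u = tag n x" "n \<in> {1, 2, 3, 4}" "x \<in> X" "small x" "v \<in> V3"
    "\<forall>e\<in>B3. u \<in> e \<longleftrightarrow> v \<in> e" for u v n x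
  proof -
    have B: "f_edge x \<in> B3" "g_edge x \<in> B3" "h_edge x \<in> B3"
      using that by (auto simp: B3_def)
    have "u \<in> f_edge x \<longleftrightarrow> v \<in> f_edge x" "u \<in> g_edge x \<longleftrightarrow> v \<in> g_edge x"
      "u \<in> h_edge x \<longleftrightarrow> v \<in> h_edge x"
      using B that(6) by blast+
    note eq = this[unfolded that(1)]
    show ?thesis
      using that(5)
    proof (cases rule: V3_cases)
      case (1 y)
      show ?thesis
        using that(2) by (elim insertE emptyE; use eq(2,3) 1 in simp)
    next
      case (2 m y)
      have "y = x"
        using that(2) by (elim insertE emptyE; use eq(2,3) 2(1) in simp)
      moreover have "n \<noteq> 0" "m \<noteq> 0"
        using that(2) 2(2) by auto
      ultimately have "n = 1 \<longleftrightarrow> m = 1" "n \<in> {1, 2, 3} \<longleftrightarrow> m \<in> {1, 2, 3}"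
        "n \<in> {3, 4} \<longleftrightarrow> m \<in> {3, 4}"
        using eq 2(1) that(4) by simp_all
      then have "n = m"
        using that(2) 2(2) by (elim insertE emptyE; simp)
      with \<open>y = x\<close> show ?thesis
        using 2(1) that(1) by simp
    qed
  qed
  show "u = v"
    using uv(1)
  proof (cases rule: V3_cases)
    case (2 n x)
    then show ?thesis
      using *[of u n x v] uv eq by blast
  next
    case u: (1 x)
    show ?thesis
      using uv(2)
    proof (cases rule: V3_cases)
      case (2 n y)
      then show ?thesis
        using *[of v n y u] uv eq by blast
    next
      case v: (1 y)
      have "same x y"
        using B3_same[of x y] u v eq by blast
      moreover have "x \<in> k \<longleftrightarrow> y \<in> k" if "k \<in> K" for k
      proof -
        have "trace k \<in> B3 \<union> K3"
          using assms(2) that by blast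
        then have "tag 0 x \<in> trace k \<longleftrightarrow> tag 0 y \<in> trace k"
          using eq u v by blast
        then show ?thesis
          using u v by simp
      qed
      ultimately have "\<forall>e\<in>(E - C) \<union> K. x \<in> e \<longleftrightarrow> y \<in> e"
        unfolding same_def by blast
      then have "x = y"
        using test_coverD[OF assms(1), of x y] u v V2_V by blast
      then show ?thesis
        using u v by simp
    qed
  qed
qed

text \<open>Dropped vertices cannot spoil the cover: a pair left unseparated in \<open>V\<close>
  lies in one class, so both vertices are retained and their copies are unseparated, too.\<close>

lemma test_cover3_conv:
  assumes "test_cover V3 (B3 \<union> trace ` K)"
  shows "test_cover V ((E - C) \<union> K)"
  unfolding test_cover_iff
proof (intro ballI impI, rule ccontr)
  fix x y assume xy: "x \<in> V" "y \<in> V" and eq: "\<forall>e\<in>(E - C) \<union> K. x \<in> e \<longleftrightarrow> y \<in> e" and ne: "x \<noteq> y"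
  have same: "same x y"
    using eq by (auto simp: same_def)
  then have V2: "x \<in> V2" "y \<in> V2"
    using xy ne same_sym by (auto simp: V2_def)
  then have "\<forall>b\<in>B3. tag 0 x \<in> b \<longleftrightarrow> tag 0 y \<in> b"
    using B3_same same by blast
  moreover have "tag 0 x \<in> trace k \<longleftrightarrow> tag 0 y \<in> trace k" if "k \<in> K" for k
    using eq that V2 by simp
  ultimately have "\<forall>e\<in>B3 \<union> trace ` K. tag 0 x \<in> e \<longleftrightarrow> tag 0 y \<in> e"
    by blast
  then have "tag 0 x = tag 0 y"
    using test_coverD[OF assms, of "tag 0 x" "tag 0 y"] V2 by auto
  with ne show False
    by simp
qed

lemma instance3: "test_r_cover_instance r (V3, C3 \<union> B3, k)"
proof -
  have "test_cover V ((E - C) \<union> C)"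
    using tc C by (simp add: Un_absorb1 sup_commute)
  then have "test_cover V3 (B3 \<union> C3)"
    by (rule test_cover3) (auto simp: C3_def)
  then show ?thesis
    using fin3 edges3 by (auto simp: Un_commute)
qed

text \<open>Candidates may have equal traces, or traces that equal required edges. Each collapse
  leaves one edge less to discard, so the parameter drops by \<open>card C - card C3\<close>.
  Truncation of the subtraction at 0 is harmless: then keeping one preimage of each edge in
  \<open>C3\<close> is already good enough in the original instance.\<close>

lemma yes3:
  "subset_test_r_cover_yes (V3, C3 \<union> B3, B3, int (k + card C3 - card C)) \<longleftrightarrow>
    (\<exists>K\<subseteq>C. test_cover V ((E - C) \<union> K) \<and> card K + k \<le> card C)"
proof -
  have disj: "C3 \<inter> B3 = {}"
    by (auto simp: C3_def)
  then have "(C3 \<union> B3) - B3 = C3" and cardE3: "card (C3 \<union> B3) = card C3 + card B3"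
    using fin3 by (auto intro: card_Un_disjoint)
  have le: "card C3 \<le> card C"
    using card_mono[of "trace ` C" C3] card_image_le[OF finC, of trace] finC by (force simp: C3_def)
  show ?thesis
  proof
    assume "subset_test_r_cover_yes (V3, C3 \<union> B3, B3, int (k + card C3 - card C))"
    then obtain T where T: "T \<subseteq> C3 \<union> B3" "B3 \<subseteq> T" "test_cover V3 T"
      "card T + (k + card C3 - card C) \<le> card C3 + card B3"
      using cardE3 by auto
    define K3 where "K3 = T - B3"
    have K3: "K3 \<subseteq> C3" "T = B3 \<union> K3"
      using T by (auto simp: K3_def)
    have "card T = card B3 + card K3"
      unfolding K3(2) using fin3 K3(1) disj by (intro card_Un_disjoint) (auto intro: finite_subset)
    with T(4) le have card: "card K3 + k \<le> card C"
      by linarith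
    have "K3 \<subseteq> trace ` C"
      using K3(1) by (auto simp: C3_def)
    then obtain K where K: "K \<subseteq> C" "inj_on trace K" "K3 = trace ` K"
      by (auto simp: subset_image_inj)
    have "card K = card K3"
      using K by (simp add: card_image)
    then show "\<exists>K\<subseteq>C. test_cover V ((E - C) \<union> K) \<and> card K + k \<le> card C"
      using test_cover3_conv[of K] T(3) K3(2) K card by (intro exI[of _ K]) auto
  next
    assume "\<exists>K\<subseteq>C. test_cover V ((E - C) \<union> K) \<and> card K + k \<le> card C"
    then obtain K where K: "K \<subseteq> C" "test_cover V ((E - C) \<union> K)" "card K + k \<le> card C"
      by blast
    define K3 where "K3 = trace ` K - B3"
    have finK: "finite K"
      using K(1) finC finite_subset by blast
    have K3: "K3 \<subseteq> C3"
      using K(1) by (auto simp: K3_def C3_def)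
    have cover: "test_cover V3 (B3 \<union> K3)"
      using K(2) by (rule test_cover3) (auto simp: K3_def)
    have "card K3 \<le> card K"
      using card_mono[of "trace ` K" K3] card_image_le[OF finK, of trace] finK
      by (force simp: K3_def)
    moreover have "card K3 \<le> card C3"
      using K3 fin3 by (intro card_mono)
    moreover have "card (B3 \<union> K3) \<le> card B3 + card K3"
      by (rule card_Un_le)
    ultimately have "card (B3 \<union> K3) + (k + card C3 - card C) \<le> card (C3 \<union> B3)"
      using K(3) cardE3 by linarith
    then have "int (card (B3 \<union> K3)) \<le> int (card (C3 \<union> B3)) - int (k + card C3 - card C)"
      by linarith
    then show "subset_test_r_cover_yes (V3, C3 \<union> B3, B3, int (k + card C3 - card C))"
      unfolding subset_test_r_cover_yes.simps using cover K3 by (intro exI[of _ "B3 \<union> K3"]) auto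
  qed
qed

text \<open>The reason why the forced edges of the output can be forgotten. The hypothesis holds if
  no edges were forced in the input, as every edge that is not a candidate is then critical; a
  forced edge might not be.\<close>

lemma required3:
  assumes critical: "\<And>b. b \<in> E - C \<Longrightarrow> \<not> test_cover V (E - {b})"
    and T: "T \<subseteq> C3 \<union> B3" "test_cover V3 T"
  shows "B3 \<subseteq> T"
proof
  fix b assume b: "b \<in> B3"
  have *: "b \<in> T" if "u \<in> V3" "v \<in> V3" "u \<noteq> v"
    "\<And>e. e \<in> C3 \<union> B3 \<Longrightarrow> (u \<in> e) \<noteq> (v \<in> e) \<Longrightarrow> e = b" for u v b
    using test_coverD[OF T(2) that(1,2)] that(3,4) T(1) by blast
  from b consider x where "x \<in> X" "small x" "b = f_edge x"
    | x where "x \<in> X" "small x" "b = g_edge x"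
    | x where "x \<in> X" "small x" "b = h_edge x"
    | x where "x \<in> X" "\<not> small x" "b = f_edge x"
    by (auto simp: B3_def)
  then show "b \<in> T"
  proof cases
    case (1 x)
    then show ?thesis
      by (intro *[of "tag 1 x" "tag 2 x"]) (auto simp: C3_def B3_def)
  next
    case (2 x)
    then show ?thesis
      by (intro *[of "tag 3 x" "tag 4 x"]) (auto simp: C3_def B3_def)
  next
    case (3 x)
    then show ?thesis
      by (intro *[of "tag 2 x" "tag 3 x"]) (auto simp: C3_def B3_def)
  next
    case (4 x)
    then obtain c where c: "c \<in> E - C" "x \<in> c"
      using X by (auto simp: uncovered_def)
    have cls: "cls x = b" if "b \<in> E - C" "x \<in> b" for b
      using full_edge 4 that by blast
    obtain u' v' where "u' \<in> V" "v' \<in> V" "u' \<noteq> v'" "\<forall>e\<in>E - {c}. u' \<in> e \<longleftrightarrow> v' \<in> e"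
      using critical[OF c(1)] unfolding test_cover_iff by blast
    moreover from this have "(u' \<in> c) \<noteq> (v' \<in> c)"
      using test_coverD[OF tc, of u' v'] by blast
    ultimately obtain u v where uv: "u \<in> V" "v \<in> V" "u \<in> c" "v \<notin> c"
      "\<forall>e\<in>E - {c}. u \<in> e \<longleftrightarrow> v \<in> e"
      by metis
    have u: "u \<in> V2" "same x u"
      using cls[OF c] uv(3) by (auto simp: cls_def)
    \<comment> \<open>A kept edge through \<open>v\<close> other than \<open>c\<close> would also
      contain \<open>u\<close>, hence \<open>x\<close>; but the class of \<open>x\<close> is full
      and equals every kept edge through \<open>x\<close>. So \<open>v\<close> is retained as an
      uncovered vertex, and the copies of \<open>u\<close> and \<open>v\<close> are a critical
      pair.\<close>
    have "uncovered v"
      unfolding uncovered_def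
    proof (intro ballI notI)
      fix e assume e: "e \<in> E - C" "v \<in> e"
      then have "e \<noteq> c" "u \<in> e"
        using uv by blast+
      then have "x \<in> e"
        using u(2) e(1) by (simp add: same_def)
      then show False
        using cls[OF c] cls[OF e(1)] \<open>e \<noteq> c\<close> by simp
    qed
    then have v: "v \<in> V2"
      using uv(2) by (simp add: V2_def)
    have v_same: "\<not> same y v" if "y \<in> X" for y
      using X that same_uncovered[OF same_sym \<open>uncovered v\<close>] by blast
    have C_eq: "u \<in> d \<longleftrightarrow> v \<in> d" if "d \<in> C" for d
      using uv(5) that C c(1) by blast
    show ?thesis
      unfolding 4(3)
    proof (rule *[of "tag 0 u" "tag 0 v"])
      show "tag 0 u \<in> V3" "tag 0 v \<in> V3"
        using u v by simp_all
      show "tag 0 u \<noteq> tag 0 v"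
        using uv(3,4) by auto
      fix e assume "e \<in> C3 \<union> B3" and ne: "(tag 0 u \<in> e) \<noteq> (tag 0 v \<in> e)"
      then consider d where "d \<in> C" "e = trace d" | y where "y \<in> X" "e = f_edge y"
        | y where "e = g_edge y \<or> e = h_edge y"
        unfolding C3_def B3_def by blast
      then show "e = f_edge x"
      proof cases
        case (1 d)
        with ne C_eq[of d] u v show ?thesis
          by simp
      next
        case (2 y)
        with ne v_same[of y] have "same y u"
          by simp
        then have "y = x"
          using X_same[OF 2(1) 4(1) same_trans[OF _ same_sym[OF u(2)]]] by blast
        with 2 show ?thesis
          by simp
      next
        case (3 y)
        with ne show ?thesis
          by auto
      qed
    qed
  qed
qed

text \<open>A retained vertex accounts for itself and, as a representative, for four gadget vertices
  and three required edges.\<close>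

lemma card3:
  "card V3 \<le> 5 * (2 * r * card C + 1)" "card (C3 \<union> B3) \<le> card C + 3 * (2 * r * card C + 1)"
proof -
  let ?S = "{x \<in> X. small x}"
  have X2: "card X \<le> card V2"
    using X finV2 by (intro card_mono) auto
  have S: "card ?S \<le> card V2" "finite ?S"
    using X finV2 finX by (auto intro: card_mono)
  have tag: "card (tag n ` ?S) \<le> card V2" for n
    using card_image_le[OF S(2), of "tag n"] S(1) by linarith
  have "card (\<Union>n\<in>{1..4::nat}. tag n ` ?S) \<le> (\<Sum>n\<in>{1..4::nat}. card (tag n ` ?S))"
    by (rule card_UN_le) simp
  also have "\<dots> \<le> (\<Sum>n\<in>{1..4::nat}. card V2)"
    by (intro sum_mono tag)
  finally have "card (\<Union>n\<in>{1..4::nat}. tag n ` ?S) \<le> 4 * card V2"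
    by simp
  moreover have "card V3 \<le> card (tag 0 ` V2) + card (\<Union>n\<in>{1..4::nat}. tag n ` ?S)"
    unfolding V3_def by (rule card_Un_le)
  ultimately have "card V3 \<le> 5 * card V2"
    using card_image_le[OF finV2, of "tag 0"] by linarith
  also have "\<dots> \<le> 5 * (2 * r * card C + 1)"
    by (intro mult_le_mono2 card_V2)
  finally show "card V3 \<le> 5 * (2 * r * card C + 1)" .
  have "card B3 \<le> card (f_edge ` X) + card (g_edge ` ?S) + card (h_edge ` ?S)"
    unfolding B3_def by (meson card_Un_le add_right_mono order_trans)
  moreover have "card C3 \<le> card C"
    using card_mono[of "trace ` C" C3] card_image_le[OF finC, of trace] finC by (force simp: C3_def)
  moreover have "card (C3 \<union> B3) \<le> card C3 + card B3"
    by (rule card_Un_le)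
  ultimately have "card (C3 \<union> B3) \<le> card C + 3 * card V2"
    using card_image_le[OF finX, of f_edge] card_image_le[OF S(2), of g_edge]
      card_image_le[OF S(2), of h_edge] X2 S(1) by linarith
  also have "\<dots> \<le> card C + 3 * (2 * r * card C + 1)"
    by (intro add_left_mono mult_le_mono2 card_V2)
  finally show "card (C3 \<union> B3) \<le> card C + 3 * (2 * r * card C + 1)" .
qed

end

section \<open>Polynomial-time tree functions\<close>

lemma poly_mono_nat: "x \<le> y \<Longrightarrow> poly p x \<le> poly p y" for p :: "nat poly"
  by (induction p) (auto intro: add_mono mult_mono)

text \<open>Storing a tree costs at least its size. Thus running time bounds output size, which
  makes polynomial bounds compose.\<close>

lemma exec_size:
  "exec c s t s' \<Longrightarrow> s' i = s i \<or> size (s' i) \<le> t"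
  by (induction rule: exec.induct) auto

text \<open>
  The working registers are those from \<open>b\<close> on, whatever they contain initially. Since \<open>b\<close> is
  arbitrary, programs compose without any renaming of registers.
\<close>

definition ptime :: "(tree \<Rightarrow> tree) \<Rightarrow> bool" where
  "ptime f \<longleftrightarrow> (\<exists>p :: nat poly. \<forall>b. \<exists>c. \<forall>s. \<exists>t s'.
     exec c s t s' \<and> t \<le> poly p (size (s b)) \<and> s' b = f (s b) \<and> (\<forall>i<b. s' i = s i))"

lemma ptimeI:
  fixes p :: "nat poly"
  assumes "\<And>b s. \<exists>t s'. exec (c b) s t s' \<and> t \<le> poly p (size (s b)) \<and> s' b = f (s b) \<and>
    (\<forall>i<b. s' i = s i)"
  shows "ptime f"
  unfolding ptime_def using assms by blast

lemma ptimeE: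
  assumes "ptime f"
  obtains p :: "nat poly" and c where
    "\<And>b s. \<exists>t s'. exec (c b) s t s' \<and> t \<le> poly p (size (s b)) \<and> s' b = f (s b) \<and>
      (\<forall>i<b. s' i = s i)"
proof -
  from assms obtain p :: "nat poly" where "\<forall>b. \<exists>c. \<forall>s. \<exists>t s'.
     exec c s t s' \<and> t \<le> poly p (size (s b)) \<and> s' b = f (s b) \<and> (\<forall>i<b. s' i = s i)"
    unfolding ptime_def by blast
  then show thesis
    using that by (auto dest!: choice)
qed

lemma ptime_size:
  assumes "ptime f"
  obtains p :: "nat poly" where "\<And>w. size (f w) \<le> poly p (size w)"
proof -
  obtain p :: "nat poly" and c where
    p: "\<And>b s. \<exists>t s'. exec (c b) s t s' \<and> t \<le> poly p (size (s b)) \<and> s' b = f (s b) \<and>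
      (\<forall>i<b. s' i = s i)"
    by (rule ptimeE[OF assms]) blast
  have "size (f w) \<le> poly (p + [:0, 1:]) (size w)" for w
  proof -
    obtain t s' where "exec (c 0) (\<lambda>_. w) t s'" "t \<le> poly p (size w)" "s' 0 = f w"
      using p[of 0 "\<lambda>_. w"] by auto
    from this exec_size[OF this(1), of 0] show ?thesis
      by auto
  qed
  then show ?thesis
    by (rule that)
qed

lemma ptime_computes_in:
  assumes "ptime f"
  shows "\<exists>c (p :: nat poly). \<forall>w. \<exists>t. computes_in c w t (f w) \<and> t \<le> poly p (size w)"
proof -
  obtain p :: "nat poly" and c where
    p: "\<And>b s. \<exists>t s'. exec (c b) s t s' \<and> t \<le> poly p (size (s b)) \<and> s' b = f (s b) \<and>
      (\<forall>i<b. s' i = s i)"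
    by (rule ptimeE[OF assms]) blast
  have "\<exists>t. computes_in (c 0) w t (f w) \<and> t \<le> poly p (size w)" for w
    using p[of 0 "(\<lambda>_. Leaf)(0 := w)"] by (auto simp: computes_in_def)
  then show ?thesis
    by blast
qed

section \<open>Composition and branching of programs\<close>

lemma ptime_expr:
  assumes "\<And>b s. eval_expr (e b) s = f (s b)" and "\<And>w. size (f w) \<le> poly p (size w)"
  shows "ptime f"
proof (rule ptimeI[where p = "1 + p" and c = "\<lambda>b. Assign b (e b)"])
  fix b :: nat and s :: state
  show "\<exists>t s'. exec (Assign b (e b)) s t s' \<and> t \<le> poly (1 + p) (size (s b)) \<and>
      s' b = f (s b) \<and> (\<forall>i<b. s' i = s i)"
    by (intro exI conjI, rule exec.Assign) (use assms in auto)
qed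

lemma ptime_id: "ptime (\<lambda>w. w)"
  by (rule ptime_expr[where e = Copy and p = "[:0, 1:]"]) auto

lemma ptime_leaf: "ptime (\<lambda>w. Leaf)"
  by (rule ptime_expr[where e = "\<lambda>_. Const_Leaf" and p = 0]) auto

lemma size_left: "size (left w) \<le> size w" and size_right: "size (right w) \<le> size w"
  by (cases w; simp)+

lemma ptime_comp:
  assumes "ptime f" "ptime g"
  shows "ptime (\<lambda>w. f (g w))"
proof -
  obtain p :: "nat poly" and c where
    p: "\<And>b s. \<exists>t s'. exec (c b) s t s' \<and> t \<le> poly p (size (s b)) \<and> s' b = f (s b) \<and>
      (\<forall>i<b. s' i = s i)"
    by (rule ptimeE[OF assms(1)]) blast
  obtain q :: "nat poly" and d where
    q: "\<And>b s. \<exists>t s'. exec (d b) s t s' \<and> t \<le> poly q (size (s b)) \<and> s' b = g (s b) \<and>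
      (\<forall>i<b. s' i = s i)"
    by (rule ptimeE[OF assms(2)]) blast
  obtain m :: "nat poly" where m: "\<And>w. size (g w) \<le> poly m (size w)"
    by (rule ptime_size[OF assms(2)]) blast
  show ?thesis
  proof (rule ptimeI[where p = "q + pcompose p m" and c = "\<lambda>b. Seq (d b) (c b)"])
    fix b :: nat and s :: state
    obtain t s' where 1: "exec (d b) s t s'" "t \<le> poly q (size (s b))" "s' b = g (s b)"
      "\<forall>i<b. s' i = s i"
      using q by blast
    obtain u s'' where 2: "exec (c b) s' u s''" "u \<le> poly p (size (s' b))" "s'' b = f (s' b)"
      "\<forall>i<b. s'' i = s' i"
      using p by blast
    have u: "u \<le> poly p (poly m (size (s b)))"
      using 2(2) poly_mono_nat[OF m, of p "s b"] 1(3) by simp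
    show "\<exists>t s'. exec (Seq (d b) (c b)) s t s' \<and>
        t \<le> poly (q + pcompose p m) (size (s b)) \<and> s' b = f (g (s b)) \<and> (\<forall>i<b. s' i = s i)"
      by (intro exI conjI, rule exec.Seq[OF 1(1) 2(1)]) (use 1 2 u in \<open>auto simp: poly_pcompose\<close>)
  qed
qed

lemma ptime_left: "ptime f \<Longrightarrow> ptime (\<lambda>w. left (f w))"
  by (rule ptime_comp, rule ptime_expr[where e = Left and p = "[:0, 1:]"]) (auto simp: size_left)

lemma ptime_right: "ptime f \<Longrightarrow> ptime (\<lambda>w. right (f w))"
  by (rule ptime_comp, rule ptime_expr[where e = Right and p = "[:0, 1:]"]) (auto simp: size_right)

lemma ptime_binary:
  assumes "ptime f" "ptime g"
    and e: "\<And>x y s. eval_expr (e x y) s = h (s x) (s y)"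
    and h: "\<And>a b. size (h a b) \<le> size a + size b + 1"
  shows "ptime (\<lambda>w. h (f w) (g w))"
proof -
  obtain p :: "nat poly" and c where
    p: "\<And>b s. \<exists>t s'. exec (c b) s t s' \<and> t \<le> poly p (size (s b)) \<and> s' b = f (s b) \<and>
      (\<forall>i<b. s' i = s i)"
    by (rule ptimeE[OF assms(1)]) blast
  obtain q :: "nat poly" and d where
    q: "\<And>b s. \<exists>t s'. exec (d b) s t s' \<and> t \<le> poly q (size (s b)) \<and> s' b = g (s b) \<and>
      (\<forall>i<b. s' i = s i)"
    by (rule ptimeE[OF assms(2)]) blast
  obtain m :: "nat poly" where m: "\<And>w. size (f w) \<le> poly m (size w)"
    by (rule ptime_size[OF assms(1)]) blast
  obtain n :: "nat poly" where n: "\<And>w. size (g w) \<le> poly n (size w)"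
    by (rule ptime_size[OF assms(2)]) blast
  show ?thesis
  \<comment> \<open>Register \<open>b\<close> keeps the input while \<open>b+1\<close> and
    \<open>b+2\<close> receive the two arguments. The last summand of the bound consists of two
    copies of the input and the final assignment, whose result exceeds the arguments in size by at
    most 1.\<close>
  proof (rule ptimeI[where p = "p + q + m + n + [:4, 2:]" and
        c = "\<lambda>b. Seq (Assign (b+1) (Copy b)) (Seq (c (b+1)) (Seq (Assign (b+2) (Copy b))
              (Seq (d (b+2)) (Assign b (e (b+1) (b+2))))))"])
    fix b :: nat and s :: state
    define s1 where "s1 = s(b+1 := s b)"
    have 1: "exec (Assign (b+1) (Copy b)) s (1 + size (s b)) s1"
      using exec.Assign[of "b+1" "Copy b" s] by (simp add: s1_def)
    obtain t2 s2 where 2: "exec (c (b+1)) s1 t2 s2" "t2 \<le> poly p (size (s b))" "s2 (b+1) = f (s b)"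
      "\<forall>i<b+1. s2 i = s1 i"
      using p[of "b+1" s1] by (auto simp: s1_def)
    define s3 where "s3 = s2(b+2 := s b)"
    have 3: "exec (Assign (b+2) (Copy b)) s2 (1 + size (s b)) s3"
      using exec.Assign[of "b+2" "Copy b" s2] 2(4) by (simp add: s3_def s1_def)
    obtain t4 s4 where 4: "exec (d (b+2)) s3 t4 s4" "t4 \<le> poly q (size (s b))" "s4 (b+2) = g (s b)"
      "\<forall>i<b+2. s4 i = s3 i"
      using q[of "b+2" s3] by (auto simp: s3_def)
    have s4: "s4 (b+1) = f (s b)" "\<forall>i<b. s4 i = s i"
      using 4(4) 2(3,4) by (auto simp: s3_def s1_def)
    define s5 where "s5 = s4(b := h (f (s b)) (g (s b)))"
    have 5: "exec (Assign b (e (b+1) (b+2))) s4 (1 + size (h (f (s b)) (g (s b)))) s5"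
      using exec.Assign[of b "e (b+1) (b+2)" s4] 4(3) s4 by (simp add: s5_def e)
    show "\<exists>t s'. exec (Seq (Assign (b+1) (Copy b)) (Seq (c (b+1)) (Seq (Assign (b+2) (Copy b))
              (Seq (d (b+2)) (Assign b (e (b+1) (b+2))))))) s t s' \<and>
        t \<le> poly (p + q + m + n + [:4, 2:]) (size (s b)) \<and> s' b = h (f (s b)) (g (s b)) \<and>
        (\<forall>i<b. s' i = s i)"
    proof (intro exI conjI)
      show "exec (Seq (Assign (b+1) (Copy b)) (Seq (c (b+1)) (Seq (Assign (b+2) (Copy b))
              (Seq (d (b+2)) (Assign b (e (b+1) (b+2))))))) s
            ((1 + size (s b)) + (t2 + ((1 + size (s b)) + (t4 +
              (1 + size (h (f (s b)) (g (s b)))))))) s5"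
        using 1 2 3 4 5 by (intro exec.Seq)
      show "(1 + size (s b)) + (t2 + ((1 + size (s b)) + (t4 +
              (1 + size (h (f (s b)) (g (s b))))))) \<le> poly (p + q + m + n + [:4, 2:]) (size (s b))"
        using 2(2) 4(2) m[of "s b"] n[of "s b"] h[of "f (s b)" "g (s b)"] by simp
      show "s5 b = h (f (s b)) (g (s b))" "\<forall>i<b. s5 i = s i"
        using s4 by (auto simp: s5_def)
    qed
  qed
qed

lemma ptime_Node: "ptime f \<Longrightarrow> ptime g \<Longrightarrow> ptime (\<lambda>w. Node (f w) (g w))"
  by (rule ptime_binary[where e = Pair]) auto

lemma ptime_const: "ptime (\<lambda>w. a)"
  by (induction a) (auto intro: ptime_leaf ptime_Node)

definition of_bool_tree :: "bool \<Rightarrow> tree" where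
  "of_bool_tree P = (if P then Node Leaf Leaf else Leaf)"

text \<open>A decision returns the truth value that \<open>Equal\<close> produces, so it can be
  tested by \<open>If\<close> directly.\<close>

definition pdec :: "(tree \<Rightarrow> bool) \<Rightarrow> bool" where
  "pdec P \<longleftrightarrow> ptime (\<lambda>w. of_bool_tree (P w))"

lemma pdec_eq: "ptime f \<Longrightarrow> ptime g \<Longrightarrow> pdec (\<lambda>w. f w = g w)"
  unfolding pdec_def
  by (rule ptime_binary[where e = Equal and h = "\<lambda>a b. of_bool_tree (a = b)"])
    (auto simp: of_bool_tree_def)

lemma ptime_if:
  assumes "pdec P" "ptime f" "ptime g"
  shows "ptime (\<lambda>w. if P w then f w else g w)"
proof -
  obtain p :: "nat poly" and c where
    p: "\<And>b s. \<exists>t s'. exec (c b) s t s' \<and> t \<le> poly p (size (s b)) \<and> s' b = f (s b) \<and>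
      (\<forall>i<b. s' i = s i)"
    by (rule ptimeE[OF assms(2)]) blast
  obtain q :: "nat poly" and d where
    q: "\<And>b s. \<exists>t s'. exec (d b) s t s' \<and> t \<le> poly q (size (s b)) \<and> s' b = g (s b) \<and>
      (\<forall>i<b. s' i = s i)"
    by (rule ptimeE[OF assms(3)]) blast
  obtain m :: "nat poly" and e where
    m: "\<And>b s. \<exists>t s'. exec (e b) s t s' \<and> t \<le> poly m (size (s b)) \<and>
      s' b = of_bool_tree (P (s b)) \<and> (\<forall>i<b. s' i = s i)"
    by (rule ptimeE[OF assms(1)[unfolded pdec_def]]) blast
  show ?thesis
  proof (rule ptimeI[where p = "p + q + m + [:2, 1:]" and
        c = "\<lambda>b. Seq (Assign (b+1) (Copy b)) (Seq (e (b+1)) (If (b+1) (c b) (d b)))"])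
    fix b :: nat and s :: state
    define s1 where "s1 = s(b+1 := s b)"
    have 1: "exec (Assign (b+1) (Copy b)) s (1 + size (s b)) s1"
      using exec.Assign[of "b+1" "Copy b" s] by (simp add: s1_def)
    obtain t2 s2 where 2: "exec (e (b+1)) s1 t2 s2" "t2 \<le> poly m (size (s b))"
      "s2 (b+1) = of_bool_tree (P (s b))" "\<forall>i<b+1. s2 i = s1 i"
      using m[of "b+1" s1] by (auto simp: s1_def)
    have s2: "s2 b = s b" "\<forall>i<b. s2 i = s i"
      using 2(4) by (auto simp: s1_def)
    obtain t3 s3 where 3: "exec (If (b+1) (c b) (d b)) s2 (1 + t3) s3"
      "t3 \<le> poly p (size (s b)) + poly q (size (s b))"
      "s3 b = (if P (s b) then f (s b) else g (s b))" "\<forall>i<b. s3 i = s i"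
    proof (cases "P (s b)")
      case True
      obtain t s' where "exec (c b) s2 t s'" "t \<le> poly p (size (s b))" "s' b = f (s b)"
        "\<forall>i<b. s' i = s2 i"
        using p[of b s2] s2 by auto
      with True s2 2(3) show ?thesis
        by (intro that[of t s'] exec.If_true) (auto simp: of_bool_tree_def)
    next
      case False
      obtain t s' where "exec (d b) s2 t s'" "t \<le> poly q (size (s b))" "s' b = g (s b)"
        "\<forall>i<b. s' i = s2 i"
        using q[of b s2] s2 by auto
      with False s2 2(3) show ?thesis
        by (intro that[of t s'] exec.If_false) (auto simp: of_bool_tree_def)
    qed
    show "\<exists>t s'. exec (Seq (Assign (b+1) (Copy b)) (Seq (e (b+1)) (If (b+1) (c b) (d b)))) s t s' \<and>
        t \<le> poly (p + q + m + [:2, 1:]) (size (s b)) \<and>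
        s' b = (if P (s b) then f (s b) else g (s b)) \<and> (\<forall>i<b. s' i = s i)"
    proof (intro exI conjI)
      show "exec (Seq (Assign (b+1) (Copy b)) (Seq (e (b+1)) (If (b+1) (c b) (d b)))) s
          ((1 + size (s b)) + (t2 + (1 + t3))) s3"
        using 1 2 3 by (intro exec.Seq)
    qed (use 2(2) 3 in auto)
  qed
qed

lemma pdec_const: "pdec (\<lambda>w. P)"
  unfolding pdec_def by (rule ptime_const)

lemma pdec_if:
  assumes "pdec P" "pdec Q" "pdec R"
  shows "pdec (\<lambda>w. if P w then Q w else R w)"
  using ptime_if[OF assms(1) assms(2,3)[unfolded pdec_def]] unfolding pdec_def
  by (simp add: if_distrib)

lemma pdec_not: "pdec P \<Longrightarrow> pdec (\<lambda>w. \<not> P w)"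
  by (rule back_subst[of pdec, OF pdec_if[of P "\<lambda>_. False" "\<lambda>_. True"]]) (auto simp: pdec_const)

lemma pdec_conj: "pdec P \<Longrightarrow> pdec Q \<Longrightarrow> pdec (\<lambda>w. P w \<and> Q w)"
  by (rule back_subst[of pdec, OF pdec_if[of P Q "\<lambda>_. False"]]) (auto simp: pdec_const)

lemma pdec_disj: "pdec P \<Longrightarrow> pdec Q \<Longrightarrow> pdec (\<lambda>w. P w \<or> Q w)"
  by (rule back_subst[of pdec, OF pdec_if[of P "\<lambda>_. True" Q]]) (auto simp: pdec_const)

lemma pdec_imp: "pdec P \<Longrightarrow> pdec Q \<Longrightarrow> pdec (\<lambda>w. P w \<longrightarrow> Q w)"
  by (rule back_subst[of pdec, OF pdec_if[of P Q "\<lambda>_. True"]]) (auto simp: pdec_const)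

lemma pdec_iff: "pdec P \<Longrightarrow> pdec Q \<Longrightarrow> pdec (\<lambda>w. P w \<longleftrightarrow> Q w)"
  by (rule back_subst[of pdec, OF pdec_if[of P Q "\<lambda>w. \<not> Q w"]]) (auto simp: pdec_const pdec_not)

section \<open>Lists as trees and loops over them\<close>

fun list_of_tree :: "tree \<Rightarrow> tree list" where
  "list_of_tree Leaf = []"
| "list_of_tree (Node x t) = x # list_of_tree t"

lemma list_of_tree_of_list [simp]: "list_of_tree (tree_of_list xs) = xs"
  by (induction xs) auto

lemma tree_of_list_of_tree [simp]: "tree_of_list (list_of_tree t) = t"
  by (induction t) auto

lemma tree_of_list_eq_iff [simp]: "tree_of_list xs = tree_of_list ys \<longleftrightarrow> xs = ys"
  by (metis list_of_tree_of_list)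

lemma size_tree_of_list: "size (tree_of_list xs) = sum_list (map size xs) + length xs"
  by (induction xs) auto

lemma size_tree_of_list_append:
  "size (tree_of_list (xs @ ys)) = size (tree_of_list xs) + size (tree_of_list ys)"
  by (simp add: size_tree_of_list)

lemma size_tree_of_list_rev [simp]: "size (tree_of_list (rev xs)) = size (tree_of_list xs)"
  by (simp add: size_tree_of_list sum_list_rev flip: rev_map)

lemma size_tree_of_list_filter: "size (tree_of_list (filter P xs)) \<le> size (tree_of_list xs)"
  by (induction xs) auto

lemma length_le_size: "length xs \<le> size (tree_of_list xs)"
  by (induction xs) auto

lemma size_tree_of_list_take: "size (tree_of_list (take n xs)) \<le> size (tree_of_list xs)"
  by (metis append_take_drop_id le_add1 size_tree_of_list_append)

lemma size_mem_tree_of_list: "x \<in> set xs \<Longrightarrow> size x \<le> size (tree_of_list xs)"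
  by (induction xs) auto

text \<open>
  The bound on the accumulator cannot be dropped: iterating the doubling of a tree takes
  exponential time.
\<close>

lemma ptime_foldl:
  assumes F: "ptime (\<lambda>z. F (left z) (left (right z)) (right (right z)))"
    and a: "ptime a" and l: "ptime l"
    and m: "\<And>w n. size (foldl (F w) (a w) (take n (list_of_tree (l w)))) \<le> poly m (size w)"
  shows "ptime (\<lambda>w. foldl (F w) (a w) (list_of_tree (l w)))"
proof -
  obtain p :: "nat poly" and c where
    p: "\<And>b s. \<exists>t s'. exec (c b) s t s' \<and> t \<le> poly p (size (s b)) \<and>
      s' b = F (left (s b)) (left (right (s b))) (right (right (s b))) \<and> (\<forall>i<b. s' i = s i)"
    by (rule ptimeE[OF F]) blast
  obtain q :: "nat poly" and d where
    q: "\<And>b s. \<exists>t s'. exec (d b) s t s' \<and> t \<le> poly q (size (s b)) \<and> s' b = l (s b) \<and>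
      (\<forall>i<b. s' i = s i)"
    by (rule ptimeE[OF l]) blast
  obtain o' :: "nat poly" and e where
    o': "\<And>b s. \<exists>t s'. exec (e b) s t s' \<and> t \<le> poly o' (size (s b)) \<and> s' b = a (s b) \<and>
      (\<forall>i<b. s' i = s i)"
    by (rule ptimeE[OF a]) blast
  obtain n :: "nat poly" where n: "\<And>w. size (l w) \<le> poly n (size w)"
    by (rule ptime_size[OF l]) blast
  \<comment> \<open>Register \<open>b\<close> holds the input, \<open>b+1\<close> the rest of the
    list and \<open>b+2\<close> the accumulator; the triple on which \<open>c\<close> runs is
    assembled in \<open>b+3\<close>.\<close>
  define body where "body b = Seq (Assign (b+3) (Left (b+1))) (Seq (Assign (b+3) (Pair (b+2) (b+3)))
      (Seq (Assign (b+3) (Pair b (b+3))) (Seq (c (b+3)) (Seq (Assign (b+2) (Copy (b+3)))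
      (Assign (b+1) (Right (b+1)))))))" for b
  \<comment> \<open>Bounds the time of one pass if all trees involved have size at most
    \<open>M\<close>; the triple then has size at most \<open>3 * M + 2\<close>.\<close>
  define K where "K M = 10 + 10 * M + poly p (3 * M + 2)" for M
  have body: "\<exists>t s'. exec (body b) s t s' \<and> t \<le> K M \<and> s' b = s b \<and> s' (b+1) = tree_of_list xs \<and>
      s' (b+2) = F (s b) (s (b+2)) x \<and> (\<forall>i<b. s' i = s i)"
    if "s (b+1) = tree_of_list (x # xs)" "size (s b) \<le> M" "size (s (b+2)) \<le> M"
      "size (tree_of_list (x # xs)) \<le> M" "size (F (s b) (s (b+2)) x) \<le> M" for b :: nat and s :: state and x xs M
  proof -
    define s1 where "s1 = s(b+3 := x)"
    have 1: "exec (Assign (b+3) (Left (b+1))) s (1 + size x) s1"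
      using exec.Assign[of "b+3" "Left (b+1)" s] that(1) by (simp add: s1_def)
    define y where "y = Node (s (b+2)) x"
    define s2 where "s2 = s1(b+3 := y)"
    have 2: "exec (Assign (b+3) (Pair (b+2) (b+3))) s1 (1 + size y) s2"
      using exec.Assign[of "b+3" "Pair (b+2) (b+3)" s1] by (simp add: s1_def s2_def y_def)
    define z where "z = Node (s b) y"
    define s3 where "s3 = s2(b+3 := z)"
    have 3: "exec (Assign (b+3) (Pair b (b+3))) s2 (1 + size z) s3"
      using exec.Assign[of "b+3" "Pair b (b+3)" s2] by (simp add: s1_def s2_def s3_def z_def)
    obtain t4 s4 where 4: "exec (c (b+3)) s3 t4 s4" "t4 \<le> poly p (size z)"
      "s4 (b+3) = F (s b) (s (b+2)) x" "\<forall>i<b+3. s4 i = s3 i"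
      using p[of "b+3" s3] by (auto simp: s3_def z_def y_def)
    have s4: "s4 (b+1) = tree_of_list (x # xs)" "s4 b = s b" "\<forall>i<b. s4 i = s i"
      using 4(4) that(1) by (auto simp: s1_def s2_def s3_def)
    define s5 where "s5 = s4(b+2 := F (s b) (s (b+2)) x)"
    have 5: "exec (Assign (b+2) (Copy (b+3))) s4 (1 + size (F (s b) (s (b+2)) x)) s5"
      using exec.Assign[of "b+2" "Copy (b+3)" s4] 4(3) by (simp add: s5_def)
    define s6 where "s6 = s5(b+1 := tree_of_list xs)"
    have 6: "exec (Assign (b+1) (Right (b+1))) s5 (1 + size (tree_of_list xs)) s6"
      using exec.Assign[of "b+1" "Right (b+1)" s5] s4 by (simp add: s5_def s6_def)
    have "size z \<le> 3 * M + 2"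
      using that by (simp add: z_def y_def)
    then have "t4 \<le> poly p (3 * M + 2)"
      using 4(2) poly_mono_nat order_trans by blast
    then have time: "1 + size x + (1 + size y + (1 + size z + (t4 + (1 + size (F (s b) (s (b+2)) x) +
        (1 + size (tree_of_list xs)))))) \<le> K M"
      using that by (simp add: K_def z_def y_def)
    have ex: "exec (body b) s (1 + size x + (1 + size y + (1 + size z + (t4 +
        (1 + size (F (s b) (s (b+2)) x) + (1 + size (tree_of_list xs))))))) s6"
      unfolding body_def using 1 2 3 4 5 6 by (intro exec.Seq)
    show ?thesis
      by (intro exI conjI, rule ex) (use time s4 in \<open>auto simp: s5_def s6_def\<close>)
  qed
  have loop: "\<exists>t s'. exec (While (b+1) (body b)) s t s' \<and> t \<le> length xs * (1 + K M) + 1 \<and>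
      s' (b+2) = foldl (F (s b)) (s (b+2)) xs \<and> (\<forall>i<b. s' i = s i)"
    if "s (b+1) = tree_of_list xs" "size (s b) \<le> M" "size (tree_of_list xs) \<le> M"
      "\<And>n. size (foldl (F (s b)) (s (b+2)) (take n xs)) \<le> M" for b :: nat and s :: state and xs M
    using that
  proof (induction xs arbitrary: s)
    case Nil
    then have "exec (While (b+1) (body b)) s 1 s"
      by (intro exec.While_false) auto
    then show ?case
      by force
  next
    case (Cons x xs)
    have "size (s (b+2)) \<le> M"
      using Cons.prems(4)[of 0] by simp
    moreover have "size (F (s b) (s (b+2)) x) \<le> M"
      using Cons.prems(4)[of 1] by simp
    ultimately obtain t1 s1 where 1: "exec (body b) s t1 s1" "t1 \<le> K M" "s1 b = s b"
      "s1 (b+1) = tree_of_list xs" "s1 (b+2) = F (s b) (s (b+2)) x" "\<forall>i<b. s1 i = s i"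
      using body[of s b x xs M] Cons.prems(1-3) by auto
    have "size (foldl (F (s1 b)) (s1 (b+2)) (take n xs)) \<le> M" for n
      using Cons.prems(4)[of "Suc n"] 1 by simp
    then obtain t2 s2 where 2: "exec (While (b+1) (body b)) s1 t2 s2"
      "t2 \<le> length xs * (1 + K M) + 1" "s2 (b+2) = foldl (F (s1 b)) (s1 (b+2)) xs"
      "\<forall>i<b. s2 i = s1 i"
      using Cons.IH[of s1] 1 Cons.prems by auto
    have ex: "exec (While (b+1) (body b)) s (1 + t1 + t2) s2"
      using 1 2 Cons.prems(1) by (intro exec.While_true) auto
    show ?case
      by (intro exI conjI, rule ex) (use 1 2 in auto)
  qed
  define M where "M = m + n + [:0, 1:]"
  show ?thesis
  proof (rule ptimeI[where
        p = "q + o' + M * (11 + 10 * M + pcompose p (3 * M + 2)) + M + [:4, 2:]" and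
        c = "\<lambda>b. Seq (Assign (b+1) (Copy b)) (Seq (d (b+1)) (Seq (Assign (b+2) (Copy b))
              (Seq (e (b+2)) (Seq (While (b+1) (body b)) (Assign b (Copy (b+2)))))))"])
    fix b :: nat and s :: state
    define N where "N = poly M (size (s b))"
    define xs where "xs = list_of_tree (l (s b))"
    define r where "r = foldl (F (s b)) (a (s b)) xs"
    define s1 where "s1 = s(b+1 := s b)"
    have 1: "exec (Assign (b+1) (Copy b)) s (1 + size (s b)) s1"
      using exec.Assign[of "b+1" "Copy b" s] by (simp add: s1_def)
    obtain t2 s2 where 2: "exec (d (b+1)) s1 t2 s2" "t2 \<le> poly q (size (s b))"
      "s2 (b+1) = l (s b)" "\<forall>i<b+1. s2 i = s1 i"
      using q[of "b+1" s1] by (auto simp: s1_def)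
    define s3 where "s3 = s2(b+2 := s b)"
    have 3: "exec (Assign (b+2) (Copy b)) s2 (1 + size (s b)) s3"
      using exec.Assign[of "b+2" "Copy b" s2] 2(4) by (simp add: s3_def s1_def)
    obtain t4 s4 where 4: "exec (e (b+2)) s3 t4 s4" "t4 \<le> poly o' (size (s b))"
      "s4 (b+2) = a (s b)" "\<forall>i<b+2. s4 i = s3 i"
      using o'[of "b+2" s3] by (auto simp: s3_def)
    have s4: "s4 (b+1) = tree_of_list xs" "s4 b = s b" "\<forall>i<b. s4 i = s i"
      using 4(4) 2(3,4) by (auto simp: s3_def s1_def xs_def)
    have fold_le: "size (foldl (F (s b)) (a (s b)) (take i xs)) \<le> N" for i
      using m[of "s b" i] by (simp add: xs_def N_def M_def)
    have xs_le: "size (tree_of_list xs) \<le> N"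
      using n[of "s b"] by (simp add: xs_def N_def M_def)
    have "size (s b) \<le> N"
      by (simp add: N_def M_def)
    then obtain t5 s5 where 5: "exec (While (b+1) (body b)) s4 t5 s5"
      "t5 \<le> length xs * (1 + K N) + 1" "s5 (b+2) = r" "\<forall>i<b. s5 i = s i"
      using loop[of s4 b xs N] s4 4(3) fold_le xs_le by (auto simp: r_def)
    have "length xs * (1 + K N) \<le> N * (1 + K N)"
      using length_le_size[of xs] xs_le by (intro mult_right_mono) auto
    with 5(2) have t5: "t5 \<le> N * (1 + K N) + 1"
      by simp
    have r: "size r \<le> N"
      using fold_le[of "length xs"] by (simp add: r_def)
    have 6: "exec (Assign b (Copy (b+2))) s5 (1 + size r) (s5(b := r))"
      using exec.Assign[of b "Copy (b+2)" s5] 5(3) by simp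
    have pN: "poly (q + o' + M * (11 + 10 * M + pcompose p (3 * M + 2)) + M + [:4, 2:]) (size (s b))
      = poly q (size (s b)) + poly o' (size (s b)) + N * (1 + K N) + N + (4 + 2 * size (s b))"
      by (simp add: K_def N_def poly_pcompose algebra_simps)
    show "\<exists>t s'. exec (Seq (Assign (b+1) (Copy b)) (Seq (d (b+1)) (Seq (Assign (b+2) (Copy b))
              (Seq (e (b+2)) (Seq (While (b+1) (body b)) (Assign b (Copy (b+2)))))))) s t s' \<and>
        t \<le> poly (q + o' + M * (11 + 10 * M + pcompose p (3 * M + 2)) + M + [:4, 2:]) (size (s b)) \<and>
        s' b = foldl (F (s b)) (a (s b)) (list_of_tree (l (s b))) \<and> (\<forall>i<b. s' i = s i)"
    proof (intro exI conjI)
      show "exec (Seq (Assign (b+1) (Copy b)) (Seq (d (b+1)) (Seq (Assign (b+2) (Copy b))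
              (Seq (e (b+2)) (Seq (While (b+1) (body b)) (Assign b (Copy (b+2)))))))) s
            ((1 + size (s b)) + (t2 + ((1 + size (s b)) + (t4 + (t5 + (1 + size r)))))) (s5(b := r))"
        using 1 2 3 4 5 6 by (intro exec.Seq)
      show "(1 + size (s b)) + (t2 + ((1 + size (s b)) + (t4 + (t5 + (1 + size r))))) \<le>
        poly (q + o' + M * (11 + 10 * M + pcompose p (3 * M + 2)) + M + [:4, 2:]) (size (s b))"
        unfolding pN using 2(2) 4(2) t5 r by simp
    qed (use 5(4) in \<open>auto simp: r_def xs_def\<close>)
  qed
qed

lemma pdec_comp: "pdec P \<Longrightarrow> ptime g \<Longrightarrow> pdec (\<lambda>w. P (g w))"
  unfolding pdec_def by (rule ptime_comp)

lemma size_tree_of_list_map_le: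
  "(\<And>x. x \<in> set xs \<Longrightarrow> size (f x) \<le> M) \<Longrightarrow> size (tree_of_list (map f xs)) \<le> length xs * (M + 1)"
proof (induction xs)
  case (Cons x xs)
  then have "size (f x) \<le> M" "size (tree_of_list (map f xs)) \<le> length xs * (M + 1)"
    by auto
  then show ?case
    by simp
qed simp

text \<open>Loops that collect results by \<open>Node\<close> produce them in reverse order; this
  restores the order in filtering and mapping.\<close>

lemma ptime_rev:
  assumes "ptime l"
  shows "ptime (\<lambda>w. tree_of_list (rev (list_of_tree (l w))))"
proof -
  have fold: "foldl (\<lambda>acc x. Node x acc) (tree_of_list ys) xs = tree_of_list (rev xs @ ys)" for xs ys
    by (induction xs arbitrary: ys) (auto simp flip: tree_of_list.simps)
  obtain m :: "nat poly" where m: "\<And>w. size (l w) \<le> poly m (size w)"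
    by (rule ptime_size[OF assms]) blast
  have "ptime (\<lambda>w. foldl (\<lambda>acc x. Node x acc) Leaf (list_of_tree (l w)))"
  proof (rule ptime_foldl[where m = m])
    show "size (foldl (\<lambda>acc x. Node x acc) Leaf (take n (list_of_tree (l w)))) \<le> poly m (size w)"
      for w n
      using fold[of "[]"] size_tree_of_list_take[of n "list_of_tree (l w)"] m[of w] by simp
  qed (intro ptime_Node ptime_left ptime_right ptime_id ptime_leaf assms)+
  then show ?thesis
    using fold[of "[]"] by simp
qed

lemma ptime_filter:
  assumes l: "ptime l" and P: "pdec (\<lambda>z. P (left z) (right z))"
  shows "ptime (\<lambda>w. tree_of_list (filter (P w) (list_of_tree (l w))))"
proof -
  let ?F = "\<lambda>w acc x. if P w x then Node x acc else acc"
  have fold: "foldl (?F w) (tree_of_list ys) xs = tree_of_list (rev (filter (P w) xs) @ ys)"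
    for w xs ys
    by (induction xs arbitrary: ys) (auto simp flip: tree_of_list.simps)
  obtain m :: "nat poly" where m: "\<And>w. size (l w) \<le> poly m (size w)"
    by (rule ptime_size[OF l]) blast
  have "ptime (\<lambda>w. foldl (?F w) Leaf (list_of_tree (l w)))"
  proof (rule ptime_foldl[where m = m])
    have "pdec (\<lambda>z. P (left z) (right (right z)))"
      using pdec_comp[OF P, of "\<lambda>z. Node (left z) (right (right z))"]
      by (simp add: ptime_Node ptime_left ptime_right ptime_id)
    then show "ptime (\<lambda>z. ?F (left z) (left (right z)) (right (right z)))"
      by (intro ptime_if ptime_Node ptime_left ptime_right ptime_id)
    show "size (foldl (?F w) Leaf (take n (list_of_tree (l w)))) \<le> poly m (size w)" for w n
      using fold[of _ "[]"] size_tree_of_list_take[of n "list_of_tree (l w)"] m[of w]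
        size_tree_of_list_filter[of "P w" "take n (list_of_tree (l w))"] by simp
  qed (intro ptime_leaf l)+
  from ptime_rev[OF this] show ?thesis
    using fold[of _ "[]"] by simp
qed

lemma ptime_map:
  assumes l: "ptime l" and f: "ptime (\<lambda>z. f (left z) (right z))"
  shows "ptime (\<lambda>w. tree_of_list (map (f w) (list_of_tree (l w))))"
proof -
  let ?F = "\<lambda>w acc x. Node (f w x) acc"
  have fold: "foldl (?F w) (tree_of_list ys) xs = tree_of_list (rev (map (f w) xs) @ ys)"
    for w xs ys
    by (induction xs arbitrary: ys) (auto simp flip: tree_of_list.simps)
  obtain m :: "nat poly" where m: "\<And>w. size (l w) \<le> poly m (size w)"
    by (rule ptime_size[OF l]) blast
  obtain q :: "nat poly" where q: "\<And>z. size (f (left z) (right z)) \<le> poly q (size z)"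
    by (rule ptime_size[OF f]) blast
  have "ptime (\<lambda>w. foldl (?F w) Leaf (list_of_tree (l w)))"
  proof (rule ptime_foldl[where m = "m * (pcompose q ([:1, 1:] + m) + 1)"])
    have "ptime (\<lambda>z. f (left z) (right (right z)))"
      using ptime_comp[OF f, of "\<lambda>z. Node (left z) (right (right z))"]
      by (simp add: ptime_Node ptime_left ptime_right ptime_id)
    then show "ptime (\<lambda>z. ?F (left z) (left (right z)) (right (right z)))"
      by (intro ptime_Node ptime_left ptime_right ptime_id)
    show "size (foldl (?F w) Leaf (take n (list_of_tree (l w)))) \<le>
        poly (m * (pcompose q ([:1, 1:] + m) + 1)) (size w)" for w n
    proof -
      have "size (f w x) \<le> poly q (1 + size w + poly m (size w))"
        if "x \<in> set (take n (list_of_tree (l w)))" for x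
      proof -
        have "size x \<le> poly m (size w)"
          using size_mem_tree_of_list[OF in_set_takeD[OF that]] m[of w] by simp
        then have "poly q (size (Node w x)) \<le> poly q (1 + size w + poly m (size w))"
          by (intro poly_mono_nat) simp
        with q[of "Node w x"] show ?thesis
          by simp
      qed
      then have "size (tree_of_list (map (f w) (take n (list_of_tree (l w))))) \<le>
          length (take n (list_of_tree (l w))) * (poly q (1 + size w + poly m (size w)) + 1)"
        by (rule size_tree_of_list_map_le)
      also have "\<dots> \<le> poly m (size w) * (poly q (1 + size w + poly m (size w)) + 1)"
        using length_le_size[of "list_of_tree (l w)"] m[of w] by (intro mult_right_mono) auto
      finally show ?thesis
        using fold[of w "[]"] by (simp add: poly_pcompose)
    qed
  qed (intro ptime_leaf l)+
  from ptime_rev[OF this] show ?thesis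
    using fold[of _ "[]"] by simp
qed

lemma ptime_append:
  assumes "ptime l" "ptime l'"
  shows "ptime (\<lambda>w. tree_of_list (list_of_tree (l w) @ list_of_tree (l' w)))"
proof -
  have fold: "foldl (\<lambda>acc x. Node x acc) (tree_of_list ys) xs = tree_of_list (rev xs @ ys)" for xs ys
    by (induction xs arbitrary: ys) (auto simp flip: tree_of_list.simps)
  obtain m :: "nat poly" where m: "\<And>w. size (l w) \<le> poly m (size w)"
    by (rule ptime_size[OF assms(1)]) blast
  obtain m' :: "nat poly" where m': "\<And>w. size (l' w) \<le> poly m' (size w)"
    by (rule ptime_size[OF assms(2)]) blast
  define rl where "rl w = tree_of_list (rev (list_of_tree (l w)))" for w
  have "ptime (\<lambda>w. foldl (\<lambda>acc x. Node x acc) (l' w) (list_of_tree (rl w)))"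
  proof (rule ptime_foldl[where m = "m + m'"])
    show "size (foldl (\<lambda>acc x. Node x acc) (l' w) (take n (list_of_tree (rl w)))) \<le>
        poly (m + m') (size w)" for w n
      using fold[of "list_of_tree (l' w)" "take n (list_of_tree (rl w))"] m'[of w] m[of w]
        size_tree_of_list_take[of n "rev (list_of_tree (l w))"]
      by (simp add: size_tree_of_list_append rl_def)
    show "ptime rl"
      unfolding rl_def by (rule ptime_rev[OF assms(1)])
  qed (intro ptime_Node ptime_left ptime_right ptime_id assms)+
  then show ?thesis
    using fold[of "list_of_tree (l' w)" for w] by (simp add: rl_def)
qed

text \<open>Subtraction of unary numbers, given as lengths of lists. It serves both to compare
  cardinalities and to compute the new parameter.\<close>

lemma ptime_drop:
  assumes "ptime l" "ptime l'"
  shows "ptime (\<lambda>w. tree_of_list (drop (length (list_of_tree (l' w))) (list_of_tree (l w))))"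
proof -
  have right: "right (tree_of_list ys) = tree_of_list (tl ys)" for ys
    by (cases ys) auto
  have fold: "foldl (\<lambda>acc x. right acc) (tree_of_list ys) xs = tree_of_list (drop (length xs) ys)"
    for xs ys :: "tree list"
    by (induction xs arbitrary: ys) (auto simp: right drop_Suc)
  obtain m :: "nat poly" where m: "\<And>w. size (l w) \<le> poly m (size w)"
    by (rule ptime_size[OF assms(1)]) blast
  have drop: "size (tree_of_list (drop n ys)) \<le> size (tree_of_list ys)" for n ys
    using size_tree_of_list_append[of "take n ys" "drop n ys"] by simp
  have "ptime (\<lambda>w. foldl (\<lambda>acc x. right acc) (l w) (list_of_tree (l' w)))"
  proof (rule ptime_foldl[where m = m])
    show "size (foldl (\<lambda>acc x. right acc) (l w) (take n (list_of_tree (l' w)))) \<le>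
        poly m (size w)" for w n
      using fold[of "list_of_tree (l w)" "take n (list_of_tree (l' w))"] m[of w]
        drop[of "length (take n (list_of_tree (l' w)))" "list_of_tree (l w)"]
      by (simp del: length_take)
  qed (intro ptime_left ptime_right ptime_id assms)+
  then show ?thesis
    using fold[of "list_of_tree (l w)" for w] by simp
qed

text \<open>A bounded quantifier is a filter followed by a test for emptiness. Hence first-order
  conditions on the input are decidable in polynomial time by their mere form.\<close>

lemma pdec_bex:
  assumes l: "ptime l" and P: "pdec (\<lambda>z. P (left z) (right z))"
  shows "pdec (\<lambda>w. \<exists>x\<in>set (list_of_tree (l w)). P w x)"
proof -
  have "pdec (\<lambda>w. \<not> tree_of_list (filter (P w) (list_of_tree (l w))) = tree_of_list [])"
    by (intro pdec_not pdec_eq ptime_filter ptime_const assms)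
  then show ?thesis
    unfolding tree_of_list_eq_iff by (simp add: filter_empty_conv)
qed

lemma pdec_ball:
  assumes "ptime l" "pdec (\<lambda>z. P (left z) (right z))"
  shows "pdec (\<lambda>w. \<forall>x\<in>set (list_of_tree (l w)). P w x)"
  using pdec_not[OF pdec_bex[OF assms(1) pdec_not[OF assms(2)]]] by simp

lemma pdec_mem:
  assumes "ptime f" "ptime l"
  shows "pdec (\<lambda>w. f w \<in> set (list_of_tree (l w)))"
proof -
  have "pdec (\<lambda>w. \<exists>x\<in>set (list_of_tree (l w)). f w = x)"
    by (intro pdec_bex pdec_eq ptime_comp[OF assms(1)] assms(2) ptime_left ptime_right ptime_id)
  then show ?thesis
    by simp
qed

text \<open>The common pattern of the selections in the algorithm: discarded edges, representatives,
  new candidates and removal of duplicates.\<close>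

fun greedy :: "(tree list \<Rightarrow> tree \<Rightarrow> bool) \<Rightarrow> tree list \<Rightarrow> tree list \<Rightarrow> tree list" where
  "greedy P acc [] = acc"
| "greedy P acc (x # xs) = greedy P (if P acc x then x # acc else acc) xs"

lemma ptime_greedy:
  assumes l: "ptime l"
    and P: "pdec (\<lambda>z. P (left z) (list_of_tree (left (right z))) (right (right z)))"
  shows "ptime (\<lambda>w. tree_of_list (greedy (P w) [] (list_of_tree (l w))))"
proof -
  let ?F = "\<lambda>w acc x. if P w (list_of_tree acc) x then Node x acc else acc"
  have fold: "foldl (?F w) (tree_of_list ys) xs = tree_of_list (greedy (P w) ys xs)" for w xs ys
    by (induction xs arbitrary: ys) (auto simp flip: tree_of_list.simps)
  have size: "size (tree_of_list (greedy Q ys xs)) \<le> size (tree_of_list ys) + size (tree_of_list xs)"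
    for Q ys xs
  proof (induction xs arbitrary: ys)
    case (Cons x xs)
    show ?case
      using Cons[of ys] Cons[of "x # ys"] by simp
  qed simp
  obtain m :: "nat poly" where m: "\<And>w. size (l w) \<le> poly m (size w)"
    by (rule ptime_size[OF l]) blast
  have "ptime (\<lambda>w. foldl (?F w) Leaf (list_of_tree (l w)))"
  proof (rule ptime_foldl[where m = m])
    show "ptime (\<lambda>z. ?F (left z) (left (right z)) (right (right z)))"
      by (intro ptime_if ptime_Node ptime_left ptime_right ptime_id P)
    show "size (foldl (?F w) Leaf (take n (list_of_tree (l w)))) \<le> poly m (size w)" for w n
      using fold[of w "[]"] size_tree_of_list_take[of n "list_of_tree (l w)"] m[of w]
        size[of "P w" "[]" "take n (list_of_tree (l w))"] by simp
  qed (intro ptime_leaf l)+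
  then show ?thesis
    using fold[of _ "[]"] by simp
qed

section \<open>The kernelization algorithm\<close>

abbreviation elems :: "tree \<Rightarrow> tree set" where
  "elems t \<equiv> set (list_of_tree t)"

lemma pdec_elems_eq:
  assumes "ptime s" "ptime t"
  shows "pdec (\<lambda>w. elems (s w) = elems (t w))"
proof -
  have "pdec (\<lambda>w. (\<forall>x\<in>elems (s w). x \<in> elems (t w)) \<and> (\<forall>x\<in>elems (t w). x \<in> elems (s w)))"
    by (intro pdec_conj pdec_ball pdec_mem ptime_right ptime_left ptime_id assms[THEN ptime_comp])
  then show ?thesis
    by (rule back_subst[of pdec]) blast
qed

lemma pdec_length_le:
  assumes "ptime s" "ptime t"
  shows "pdec (\<lambda>w. length (list_of_tree (s w)) \<le> length (list_of_tree (t w)))"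
proof -
  have "pdec (\<lambda>w. tree_of_list (drop (length (list_of_tree (t w))) (list_of_tree (s w))) =
      tree_of_list [])"
    by (intro pdec_eq ptime_drop ptime_const assms)
  then show ?thesis
    unfolding tree_of_list_eq_iff by simp
qed

lemma ptime_tag: "ptime f \<Longrightarrow> ptime (\<lambda>w. tag n (f w))"
  unfolding tag_def by (intro ptime_Node ptime_const)

text \<open>Syntax-directed rules. Inside quantifiers, filters, maps and greedy loops the input is a
  tree such as \<open>Node w x\<close>, so that assumptions on the parameters enter as
  \<open>assms[THEN ptime_comp]\<close>, composed with a projection.\<close>

lemmas ptime_rules = ptime_id ptime_const ptime_Node ptime_left ptime_right ptime_if ptime_tag
  pdec_const pdec_eq pdec_elems_eq pdec_length_le pdec_not pdec_conj pdec_disj pdec_imp pdec_iff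
  pdec_if pdec_bex pdec_ball pdec_mem ptime_filter ptime_map ptime_append ptime_drop ptime_greedy

definition dedupe :: "tree \<Rightarrow> tree" where
  "dedupe t = tree_of_list (greedy (\<lambda>acc x. x \<notin> set acc) [] (list_of_tree t))"

lemma ptime_dedupe: "ptime t \<Longrightarrow> ptime (\<lambda>w. dedupe (t w))"
  unfolding dedupe_def by (intro ptime_rules)

definition append_tree :: "tree \<Rightarrow> tree \<Rightarrow> tree" where
  "append_tree s t = tree_of_list (list_of_tree s @ list_of_tree t)"

lemma ptime_append_tree: "ptime s \<Longrightarrow> ptime t \<Longrightarrow> ptime (\<lambda>w. append_tree (s w) (t w))"
  unfolding append_tree_def by (rule ptime_append)

definition covers :: "tree \<Rightarrow> tree \<Rightarrow> bool" where
  "covers v e \<longleftrightarrow> (\<forall>x\<in>elems v. \<forall>y\<in>elems v.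
     (\<forall>f\<in>elems e. x \<in> elems f \<longleftrightarrow> y \<in> elems f) \<longrightarrow> x = y)"

lemma pdec_covers:
  assumes "ptime v" "ptime e"
  shows "pdec (\<lambda>w. covers (v w) (e w))"
  unfolding covers_def by (intro ptime_rules assms[THEN ptime_comp])

definition without :: "tree \<Rightarrow> tree \<Rightarrow> tree" where
  "without e d = tree_of_list (filter (\<lambda>f. f \<notin> elems d) (list_of_tree e))"

lemma ptime_without:
  assumes "ptime e" "ptime d"
  shows "ptime (\<lambda>w. without (e w) (d w))"
  unfolding without_def by (intro ptime_rules assms[THEN ptime_comp])

text \<open>The same edge may be listed in \<open>e\<close> and in \<open>b\<close> with its
  vertices in different orders, so trees cannot be compared here. Within \<open>e\<close> alone,
  different trees are different edges.\<close>

definition among :: "tree \<Rightarrow> tree \<Rightarrow> bool" where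
  "among c b \<longleftrightarrow> (\<exists>f\<in>elems b. elems c = elems f)"

lemma pdec_among:
  assumes "ptime c" "ptime b"
  shows "pdec (\<lambda>w. among (c w) (b w))"
  unfolding among_def by (intro ptime_rules assms[THEN ptime_comp])

definition candidates :: "tree \<Rightarrow> tree \<Rightarrow> tree \<Rightarrow> tree" where
  "candidates v e b = tree_of_list
     (filter (\<lambda>c. \<not> among c b \<and> covers v (without e (Node c Leaf))) (list_of_tree e))"

lemma ptime_candidates:
  assumes "ptime v" "ptime e" "ptime b"
  shows "ptime (\<lambda>w. candidates (v w) (e w) (b w))"
  unfolding candidates_def
  by (intro ptime_rules pdec_among pdec_covers ptime_without assms[THEN ptime_comp])

definition discardable :: "tree \<Rightarrow> tree \<Rightarrow> tree \<Rightarrow> tree" where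
  "discardable v e b = tree_of_list (greedy
     (\<lambda>R c. c \<notin> set R \<and> \<not> among c b \<and> covers v (without e (Node c (tree_of_list R))))
     [] (list_of_tree e))"

lemma ptime_discardable:
  assumes "ptime v" "ptime e" "ptime b"
  shows "ptime (\<lambda>w. discardable (v w) (e w) (b w))"
  unfolding discardable_def
  by (rule ptime_greedy, use assms(2) in simp, unfold tree_of_list_of_tree)
    (intro ptime_rules pdec_among pdec_covers ptime_without assms[THEN ptime_comp])

definition is_private :: "tree \<Rightarrow> tree \<Rightarrow> bool" where
  "is_private e c \<longleftrightarrow> (\<exists>x\<in>elems c. \<forall>f\<in>elems e. x \<in> elems f \<longrightarrow> f = c)"

lemma pdec_is_private:
  assumes "ptime e" "ptime c"
  shows "pdec (\<lambda>w. is_private (e w) (c w))"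
  unfolding is_private_def by (intro ptime_rules assms[THEN ptime_comp])

definition obstructed :: "tree \<Rightarrow> tree \<Rightarrow> tree \<Rightarrow> tree \<Rightarrow> bool" where
  "obstructed v e X c \<longleftrightarrow> (\<exists>x\<in>elems c. \<exists>y\<in>elems v. y \<notin> elems c \<and>
     (\<exists>f\<in>elems e. f \<noteq> c \<and> x \<in> elems f) \<and>
     (\<forall>f\<in>elems e. (x \<in> elems f \<longleftrightarrow> y \<in> elems f) \<or> f = c \<or> f \<in> elems X))"

lemma pdec_obstructed:
  assumes "ptime v" "ptime e" "ptime X" "ptime c"
  shows "pdec (\<lambda>w. obstructed (v w) (e w) (X w) (c w))"
  unfolding obstructed_def by (intro ptime_rules assms[THEN ptime_comp])

definition not_private :: "tree \<Rightarrow> tree \<Rightarrow> tree" where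
  "not_private e C = tree_of_list (filter (\<lambda>c. \<not> is_private e c) (list_of_tree C))"

lemma ptime_not_private:
  assumes "ptime e" "ptime C"
  shows "ptime (\<lambda>w. not_private (e w) (C w))"
  unfolding not_private_def by (intro ptime_rules pdec_is_private assms[THEN ptime_comp])

definition free_private :: "tree \<Rightarrow> tree \<Rightarrow> tree \<Rightarrow> tree" where
  "free_private v e C = tree_of_list
     (filter (\<lambda>d. is_private e d \<and> \<not> obstructed v e (not_private e C) d) (list_of_tree C))"

lemma ptime_free_private:
  assumes "ptime v" "ptime e" "ptime C"
  shows "ptime (\<lambda>w. free_private (v w) (e w) (C w))"
  unfolding free_private_def
  by (intro ptime_rules pdec_is_private pdec_obstructed ptime_not_private assms[THEN ptime_comp])

section \<open>Programs for the compressed instance\<close>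

definition same_in :: "tree \<Rightarrow> tree \<Rightarrow> tree \<Rightarrow> bool" where
  "same_in b x y \<longleftrightarrow> (\<forall>f\<in>elems b. x \<in> elems f \<longleftrightarrow> y \<in> elems f)"

definition uncovered_in :: "tree \<Rightarrow> tree \<Rightarrow> bool" where
  "uncovered_in b x \<longleftrightarrow> (\<forall>f\<in>elems b. x \<notin> elems f)"

lemma pdec_same_in:
  assumes "ptime b" "ptime x" "ptime y"
  shows "pdec (\<lambda>w. same_in (b w) (x w) (y w))"
  unfolding same_in_def by (intro ptime_rules assms[THEN ptime_comp])

lemma pdec_uncovered_in:
  assumes "ptime b" "ptime x"
  shows "pdec (\<lambda>w. uncovered_in (b w) (x w))"
  unfolding uncovered_in_def by (intro ptime_rules assms[THEN ptime_comp])

definition relevant :: "tree \<Rightarrow> tree \<Rightarrow> tree" where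
  "relevant v b = tree_of_list
     (filter (\<lambda>x. uncovered_in b x \<or> (\<exists>y\<in>elems v. y \<noteq> x \<and> same_in b x y)) (list_of_tree v))"

lemma ptime_relevant:
  assumes "ptime v" "ptime b"
  shows "ptime (\<lambda>w. relevant (v w) (b w))"
  unfolding relevant_def
  by (intro ptime_rules pdec_same_in pdec_uncovered_in assms[THEN ptime_comp])

definition representatives :: "tree \<Rightarrow> tree \<Rightarrow> tree" where
  "representatives b v2 = tree_of_list (greedy
     (\<lambda>X y. \<not> uncovered_in b y \<and> \<not> (\<exists>x\<in>set X. same_in b x y)) [] (list_of_tree v2))"

lemma ptime_representatives:
  assumes "ptime b" "ptime v2"
  shows "ptime (\<lambda>w. representatives (b w) (v2 w))"
  unfolding representatives_def
  by (intro ptime_rules pdec_same_in pdec_uncovered_in assms[THEN ptime_comp])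

definition small_class :: "nat \<Rightarrow> tree \<Rightarrow> tree \<Rightarrow> tree \<Rightarrow> bool" where
  "small_class r b v2 x \<longleftrightarrow> length (filter (same_in b x) (list_of_tree v2)) < r"

lemma pdec_small_class:
  assumes "ptime b" "ptime v2" "ptime x"
  shows "pdec (\<lambda>w. small_class r (b w) (v2 w) (x w))"
proof -
  have "pdec (\<lambda>w. \<not> length (list_of_tree (tree_of_list (replicate r Leaf))) \<le>
      length (list_of_tree (tree_of_list (filter (same_in (b w) (x w)) (list_of_tree (v2 w))))))"
    by (intro ptime_rules pdec_same_in assms[THEN ptime_comp])
  then show ?thesis
    by (simp add: small_class_def not_le)
qed

definition small_reps :: "nat \<Rightarrow> tree \<Rightarrow> tree \<Rightarrow> tree" where
  "small_reps r b v2 = tree_of_list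
     (filter (small_class r b v2) (list_of_tree (representatives b v2)))"

lemma ptime_small_reps:
  assumes "ptime b" "ptime v2"
  shows "ptime (\<lambda>w. small_reps r (b w) (v2 w))"
  unfolding small_reps_def
  by (intro ptime_rules ptime_representatives pdec_small_class assms[THEN ptime_comp])

definition tag_all :: "nat \<Rightarrow> tree \<Rightarrow> tree" where
  "tag_all n t = tree_of_list (map (tag n) (list_of_tree t))"

lemma ptime_tag_all: "ptime t \<Longrightarrow> ptime (\<lambda>w. tag_all n (t w))"
  unfolding tag_all_def by (intro ptime_rules)

definition new_vertices :: "nat \<Rightarrow> tree \<Rightarrow> tree \<Rightarrow> tree" where
  "new_vertices r b v2 = dedupe (append_tree (tag_all 0 v2)
     (append_tree (tag_all 1 (small_reps r b v2)) (append_tree (tag_all 2 (small_reps r b v2))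
     (append_tree (tag_all 3 (small_reps r b v2)) (tag_all 4 (small_reps r b v2))))))"

lemma ptime_new_vertices:
  assumes "ptime b" "ptime v2"
  shows "ptime (\<lambda>w. new_vertices r (b w) (v2 w))"
  unfolding new_vertices_def
  by (intro ptime_dedupe ptime_append_tree ptime_tag_all ptime_small_reps assms)

text \<open>
  All edges of the new instance are sublists of the list \<open>v3\<close> of new vertices, and hence equal as
  trees if they are equal as sets.
\<close>

definition new_f :: "tree \<Rightarrow> tree \<Rightarrow> tree \<Rightarrow> tree" where
  "new_f v3 b x = tree_of_list
     (filter (\<lambda>z. left z = Leaf \<and> same_in b x (right z) \<or> z = tag 1 x) (list_of_tree v3))"

definition new_g :: "tree \<Rightarrow> tree \<Rightarrow> tree" where
  "new_g v3 x = tree_of_list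
     (filter (\<lambda>z. z = tag 1 x \<or> z = tag 2 x \<or> z = tag 3 x) (list_of_tree v3))"

definition new_h :: "tree \<Rightarrow> tree \<Rightarrow> tree" where
  "new_h v3 x = tree_of_list (filter (\<lambda>z. z = tag 3 x \<or> z = tag 4 x) (list_of_tree v3))"

definition new_trace :: "tree \<Rightarrow> tree \<Rightarrow> tree" where
  "new_trace v3 c = tree_of_list
     (filter (\<lambda>z. left z = Leaf \<and> right z \<in> elems c) (list_of_tree v3))"

lemma ptime_new_edge:
  assumes "ptime v3" "ptime b" "ptime x"
  shows "ptime (\<lambda>w. new_f (v3 w) (b w) (x w))" "ptime (\<lambda>w. new_g (v3 w) (x w))"
    "ptime (\<lambda>w. new_h (v3 w) (x w))" "ptime (\<lambda>w. new_trace (v3 w) (x w))"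
  unfolding new_f_def new_g_def new_h_def new_trace_def
  by (intro ptime_rules pdec_same_in assms[THEN ptime_comp])+

definition new_required :: "tree \<Rightarrow> tree \<Rightarrow> tree \<Rightarrow> tree \<Rightarrow> tree" where
  "new_required v3 b X Xs = dedupe (append_tree
     (tree_of_list (map (new_f v3 b) (list_of_tree X)))
     (append_tree (tree_of_list (map (new_g v3) (list_of_tree Xs)))
       (tree_of_list (map (new_h v3) (list_of_tree Xs)))))"

lemma ptime_new_required:
  assumes "ptime v3" "ptime b" "ptime X" "ptime Xs"
  shows "ptime (\<lambda>w. new_required (v3 w) (b w) (X w) (Xs w))"
  unfolding new_required_def
  by (intro ptime_dedupe ptime_append_tree ptime_new_edge(2,3)[OF _ ptime_const]
      ptime_new_edge(1) ptime_rules assms[THEN ptime_comp])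

definition new_candidates :: "tree \<Rightarrow> tree \<Rightarrow> tree \<Rightarrow> tree" where
  "new_candidates v3 b3 C = tree_of_list (greedy (\<lambda>acc c. c \<notin> set acc \<and> c \<notin> elems b3) []
     (list_of_tree (tree_of_list (map (new_trace v3) (list_of_tree C)))))"

lemma ptime_new_candidates:
  assumes "ptime v3" "ptime b3" "ptime C"
  shows "ptime (\<lambda>w. new_candidates (v3 w) (b3 w) (C w))"
  unfolding new_candidates_def
  by (intro ptime_new_edge(4)[OF _ ptime_const] ptime_rules assms[THEN ptime_comp])

text \<open>Appending \<open>c3\<close> to \<open>k\<close> and dropping the length of
  \<open>C\<close> is the unary form of the parameter in \<open>yes3\<close>; the
  \<open>Leaf\<close> before it is the sign of a nonnegative number.\<close>

definition compress_with :: "tree \<Rightarrow> tree \<Rightarrow> tree \<Rightarrow> tree \<Rightarrow> tree" where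
  "compress_with k C v3 b3 = (let c3 = new_candidates v3 b3 C in
     Node v3 (Node (append_tree c3 b3) (Node b3 (Node Leaf
       (tree_of_list (drop (length (list_of_tree C)) (list_of_tree (append_tree c3 k))))))))"

lemma ptime_compress_with:
  assumes "ptime k" "ptime C" "ptime v3" "ptime b3"
  shows "ptime (\<lambda>w. compress_with (k w) (C w) (v3 w) (b3 w))"
  unfolding compress_with_def Let_def
  by (intro ptime_Node ptime_append_tree ptime_const ptime_drop ptime_new_candidates assms)

definition compress :: "nat \<Rightarrow> tree \<Rightarrow> tree \<Rightarrow> tree \<Rightarrow> tree \<Rightarrow> tree" where
  "compress r v e C k = (let b = without e C; v2 = relevant v b; v3 = new_vertices r b v2 in
     compress_with k C v3 (new_required v3 b (representatives b v2) (small_reps r b v2)))"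

lemma ptime_compress:
  assumes "ptime v" "ptime e" "ptime C" "ptime k"
  shows "ptime (\<lambda>w. compress r (v w) (e w) (C w) (k w))"
  unfolding compress_def Let_def
  by (intro ptime_compress_with ptime_new_required ptime_new_vertices ptime_relevant ptime_without
      ptime_representatives ptime_small_reps assms)

text \<open>The empty hypergraph has the empty solution only, so it is a yes-instance for
  \<open>k = 0\<close> and a no-instance for \<open>k = 1\<close>.\<close>

definition trivial :: "int \<Rightarrow> tree" where
  "trivial k = Node Leaf (Node Leaf (Node Leaf (code_int k)))"

text \<open>A single discard suffices, since all remaining candidates are then of the first kind;
  \<open>right k\<close> is the unary predecessor.\<close>

definition reduce :: "nat \<Rightarrow> tree \<Rightarrow> tree \<Rightarrow> tree \<Rightarrow> tree \<Rightarrow> tree" where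
  "reduce r v e b k = (let d = free_private v e (candidates v e b) in
     if d = Leaf then compress r v e (candidates v e b) k
     else let e' = without e (Node (left d) Leaf)
       in compress r v e' (candidates v e' b) (right k))"

lemma ptime_reduce:
  assumes "ptime v" "ptime e" "ptime b" "ptime k"
  shows "ptime (\<lambda>w. reduce r (v w) (e w) (b w) (k w))"
  unfolding reduce_def Let_def
  by (intro ptime_if pdec_eq ptime_compress ptime_candidates ptime_free_private ptime_without
      ptime_Node ptime_left ptime_right ptime_const assms)

text \<open>A nonempty \<open>s\<close> marks a negative parameter. In the last branch
  \<open>R\<close> is nonempty and shorter than \<open>k\<close>, so that \<open>k\<close> is at
  least 2 and the factor \<open>k - 1\<close> in the bounds is positive.\<close>

definition subset_kernel :: "nat \<Rightarrow> tree \<Rightarrow> tree" where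
  "subset_kernel r w = (let v = left w; e = left (right w); b = left (right (right w));
       s = left (right (right (right w))); k = right (right (right (right w)));
       R = discardable v e b
     in if s \<noteq> Leaf \<or> length (list_of_tree k) \<le> length (list_of_tree R) then trivial 0
       else if R = Leaf then trivial 1
       else reduce r v e b k)"

lemma ptime_subset_kernel: "ptime (subset_kernel r)"
  unfolding subset_kernel_def Let_def
  by (intro ptime_if pdec_disj pdec_not pdec_eq pdec_length_le ptime_reduce ptime_discardable
      ptime_left ptime_right ptime_const ptime_id)

definition full_kernel :: "nat \<Rightarrow> tree \<Rightarrow> tree" where
  "full_kernel r w =
     (let w' = subset_kernel r (Node (left w) (Node (left (right w)) (Node Leaf (right (right w)))))
      in Node (left w') (Node (left (right w')) (right (right (right w')))))"

lemma ptime_full_kernel: "ptime (full_kernel r)"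
  unfolding full_kernel_def Let_def
  by (intro ptime_comp[OF ptime_subset_kernel] ptime_Node ptime_left ptime_right ptime_const ptime_id)

section \<open>Correctness of the algorithm\<close>

lemma set_greedy: "set (greedy P acc xs) \<subseteq> set acc \<union> set xs"
proof (induction xs arbitrary: acc)
  case (Cons x xs)
  show ?case
    using Cons[of acc] Cons[of "x # acc"] by auto
qed simp

lemma subset_greedy: "set acc \<subseteq> set (greedy P acc xs)"
proof (induction xs arbitrary: acc)
  case (Cons x xs)
  show ?case
    using Cons[of acc] Cons[of "x # acc"] by auto
qed simp

lemma greedy_invariant:
  "Q acc \<Longrightarrow> (\<And>R x. Q R \<Longrightarrow> P R x \<Longrightarrow> Q (x # R)) \<Longrightarrow> Q (greedy P acc xs)"
  by (induction xs arbitrary: acc) auto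

text \<open>If the condition only becomes harder as the selection grows, a rejected element stays
  rejected; therefore one pass is enough for maximality.\<close>

lemma greedy_maximal:
  assumes "\<And>R R' x. set R \<subseteq> set R' \<Longrightarrow> P R' x \<Longrightarrow> P R x"
  shows "x \<in> set xs \<Longrightarrow> x \<in> set (greedy P acc xs) \<or> \<not> P (greedy P acc xs) x"
proof (induction xs arbitrary: acc)
  case (Cons y ys)
  let ?acc = "if P acc y then y # acc else acc"
  have "y \<in> set (greedy P ?acc ys) \<or> \<not> P (greedy P ?acc ys) y"
    using subset_greedy[of ?acc P ys] assms[of acc "greedy P ?acc ys" y] by (auto split: if_splits)
  with Cons show ?case
    by auto
qed simp

lemma elems_dedupe: "elems (dedupe t) = elems t" and distinct_dedupe: "distinct (list_of_tree (dedupe t))"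
proof -
  let ?P = "\<lambda>acc x. x \<notin> set acc"
  have "x \<in> set (greedy ?P [] (list_of_tree t))" if "x \<in> elems t" for x
    using greedy_maximal[of ?P x "list_of_tree t" "[]"] that by blast
  then show "elems (dedupe t) = elems t"
    using set_greedy[of ?P "[]" "list_of_tree t"] by (auto simp: dedupe_def)
  show "distinct (list_of_tree (dedupe t))"
    unfolding dedupe_def list_of_tree_of_list by (rule greedy_invariant) auto
qed

section \<open>Decoding of instances\<close>

lemma codes_vertices_iff: "codes_vertices t V \<longleftrightarrow> distinct (list_of_tree t) \<and> elems t = V"
proof
  assume "codes_vertices t V"
  then show "distinct (list_of_tree t) \<and> elems t = V"
    by (auto simp: codes_vertices_def codes_set_def list.rel_eq)
next
  assume "distinct (list_of_tree t) \<and> elems t = V"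
  then show "codes_vertices t V"
    unfolding codes_vertices_def codes_set_def
    by (intro exI[of _ "list_of_tree t"]) (auto simp: list.rel_eq)
qed

text \<open>Different trees in the list never denote the same edge. This injectivity is what allows
  the program to count and remove edges by comparing trees.\<close>

lemma codes_edges_iff:
  "codes_edges t E \<longleftrightarrow> distinct (list_of_tree t) \<and> inj_on elems (elems t) \<and> elems ` elems t = E \<and>
    (\<forall>f\<in>elems t. distinct (list_of_tree f))"
proof -
  have *: "codes_set (=) = (\<lambda>f e. distinct (list_of_tree f) \<and> elems f = e)"
    using codes_vertices_iff unfolding codes_vertices_def by blast
  have rel: "list_all2 (\<lambda>f e. distinct (list_of_tree f) \<and> elems f = e) ts es \<longleftrightarrow>
      es = map elems ts \<and> (\<forall>f\<in>set ts. distinct (list_of_tree f))" for ts es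
    by (induction ts arbitrary: es) (auto simp: list_all2_Cons1)
  have "codes_edges t E \<longleftrightarrow> (\<exists>ts es. t = tree_of_list ts \<and>
      (es = map elems ts \<and> (\<forall>f\<in>set ts. distinct (list_of_tree f))) \<and> distinct es \<and> set es = E)"
    unfolding codes_edges_def * by (simp only: codes_set_def rel)
  also have "\<dots> \<longleftrightarrow> (\<exists>ts. t = tree_of_list ts \<and> (\<forall>f\<in>set ts. distinct (list_of_tree f)) \<and>
      distinct (map elems ts) \<and> elems ` set ts = E)"
    by auto
  also have "\<dots> \<longleftrightarrow> (\<forall>f\<in>elems t. distinct (list_of_tree f)) \<and>
      distinct (map elems (list_of_tree t)) \<and> elems ` elems t = E"
    by (metis list_of_tree_of_list tree_of_list_of_tree)
  finally show ?thesis
    unfolding distinct_map by blast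
qed

lemma codes_edgesD:
  assumes "codes_edges t E"
  shows "distinct (list_of_tree t)" "inj_on elems (elems t)" "elems ` elems t = E"
  using assms by (auto simp: codes_edges_iff)

lemma covers_iff: "covers v e \<longleftrightarrow> test_cover (elems v) (elems ` elems e)"
  by (simp add: covers_def test_cover_iff)

lemma among_iff: "among c b \<longleftrightarrow> elems c \<in> elems ` elems b"
  by (auto simp: among_def)

lemma elems_without: "elems (without e d) = elems e - elems d"
  by (auto simp: without_def)

lemma codes_without:
  assumes "codes_edges e E" "elems d \<subseteq> elems e"
  shows "codes_edges (without e d) (E - elems ` elems d)"
proof -
  have "elems ` (elems e - elems d) = E - elems ` elems d"
    using inj_on_image_set_diff[of elems "elems e" "elems e" "elems d"] assms
    by (auto simp: codes_edges_iff)
  then show ?thesis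
    using assms(1) unfolding codes_edges_iff elems_without
    by (auto simp: without_def intro: inj_on_subset)
qed

lemma candidates_subset: "elems (candidates v e b) \<subseteq> elems e"
  by (auto simp: candidates_def)

lemma codes_subset:
  assumes "codes_edges e E" "elems c \<subseteq> elems e" "distinct (list_of_tree c)"
  shows "codes_edges c (elems ` elems c)" "card (elems ` elems c) = length (list_of_tree c)"
proof -
  have "inj_on elems (elems c)"
    using assms inj_on_subset by (auto simp: codes_edges_iff)
  then show "codes_edges c (elems ` elems c)" "card (elems ` elems c) = length (list_of_tree c)"
    using assms by (auto simp: codes_edges_iff card_image distinct_card)
qed

lemma codes_candidates:
  assumes e: "codes_edges e E" and b: "codes_edges b B"
  shows "codes_edges (candidates v e b) (redundant (elems v) E B)"
    "distinct (list_of_tree (candidates v e b))"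
proof -
  have "elems ` elems (without e (Node c Leaf)) = E - {elems c}" if "c \<in> elems e" for c
    using codes_without[OF e, of "Node c Leaf"] that by (simp add: codes_edges_iff)
  then have "elems ` elems (candidates v e b) = redundant (elems v) E B"
    using e b by (force simp: candidates_def redundant_def covers_iff among_iff codes_edges_iff)
  moreover show dist: "distinct (list_of_tree (candidates v e b))"
    using e by (simp add: candidates_def codes_edges_iff)
  ultimately show "codes_edges (candidates v e b) (redundant (elems v) E B)"
    using codes_subset(1)[OF e candidates_subset dist] by simp
qed

lemma discardable:
  assumes e: "codes_edges e E" and b: "codes_edges b B" and tc: "test_cover (elems v) E"
  obtains R where "R \<subseteq> E - B" "card R = length (list_of_tree (discardable v e b))"
    "test_cover (elems v) (E - R)"
    "\<And>c. c \<in> E - B - R \<Longrightarrow> \<not> test_cover (elems v) (E - R - {c})"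
proof -
  let ?P = "\<lambda>R c. c \<notin> set R \<and> \<not> among c b \<and> covers v (without e (Node c (tree_of_list R)))"
  define d where "d = discardable v e b"
  define Q where "Q R \<longleftrightarrow> distinct R \<and> (\<forall>c\<in>set R. \<not> among c b) \<and> covers v (without e (tree_of_list R))"
    for R
  have "Q (list_of_tree d)"
    unfolding d_def discardable_def list_of_tree_of_list
    by (rule greedy_invariant) (use tc e in \<open>auto simp: Q_def covers_iff elems_without codes_edges_iff\<close>)
  have sub: "elems d \<subseteq> elems e"
    using set_greedy[of ?P "[]" "list_of_tree e"] by (simp add: d_def discardable_def)
  define R where "R = elems ` elems d"
  have diff: "elems ` elems (without e s) = E - elems ` elems s" if "elems s \<subseteq> elems e" for s
    using codes_without[OF e that] by (simp add: codes_edges_iff)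
  have "R \<subseteq> E - B"
    using \<open>Q (list_of_tree d)\<close> sub codes_edgesD(3)[OF e] codes_edgesD(3)[OF b]
    by (auto simp: Q_def R_def among_iff)
  moreover have "card R = length (list_of_tree d)"
    using codes_subset(2)[OF e sub] \<open>Q (list_of_tree d)\<close> by (simp add: Q_def R_def)
  moreover have "test_cover (elems v) (E - R)"
    using \<open>Q (list_of_tree d)\<close> diff[OF sub] by (simp add: Q_def R_def covers_iff)
  moreover have "\<not> test_cover (elems v) (E - R - {c})" if c: "c \<in> E - B - R" for c
  proof -
    obtain f where f: "f \<in> elems e" "c = elems f"
      using c codes_edgesD(3)[OF e] by auto
    have "f \<notin> elems d" "\<not> among f b"
      using c f codes_edgesD(3)[OF b] by (auto simp: R_def among_iff)
    moreover have "covers v (without e (Node c (tree_of_list R)))"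
      if "set R \<subseteq> set R'" "covers v (without e (Node c (tree_of_list R')))" for R R' c
      using that unfolding covers_def elems_without by fastforce
    then have "f \<in> elems d \<or> \<not> ?P (list_of_tree d) f"
      unfolding d_def discardable_def list_of_tree_of_list
      by (intro greedy_maximal) (use f in auto)
    ultimately have "\<not> covers v (without e (Node f d))"
      by simp
    moreover have "elems ` elems (without e (Node f d)) = E - R - {c}"
      using diff[of "Node f d"] sub f by (auto simp: R_def)
    ultimately show ?thesis
      by (simp add: covers_iff)
  qed
  ultimately show ?thesis
    using that d_def by blast
qed

lemma is_private_iff:
  assumes e: "codes_edges e E" and c: "c \<in> elems e"
  shows "is_private e c \<longleftrightarrow> has_private E (elems c)"
proof -
  have "elems f = elems c \<longleftrightarrow> f = c" if "f \<in> elems e" for f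
    using inj_on_eq_iff[OF codes_edgesD(2)[OF e]] that c by blast
  then show ?thesis
    unfolding is_private_def has_private_def codes_edgesD(3)[OF e, symmetric] by simp
qed

lemma obstructed_iff:
  assumes e: "codes_edges e E" and c: "c \<in> elems e" and X: "elems X \<subseteq> elems e"
  shows "obstructed v e X c \<longleftrightarrow> blocked (elems v) E (elems ` elems X) (elems c)"
proof -
  have "elems f = elems c \<longleftrightarrow> f = c" if "f \<in> elems e" for f
    using inj_on_eq_iff[OF codes_edgesD(2)[OF e]] that c by blast
  moreover have "elems f \<in> elems ` elems X \<longleftrightarrow> f \<in> elems X" if "f \<in> elems e" for f
    using inj_on_image_mem_iff[OF codes_edgesD(2)[OF e] that X] .
  moreover have "(p \<longleftrightarrow> q) \<or> s \<longleftrightarrow> (p \<noteq> q \<longrightarrow> s)" for p q s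
    by blast
  ultimately show ?thesis
    unfolding obstructed_def blocked_def codes_edgesD(3)[OF e, symmetric]
    by (simp del: not_iff cong: conj_cong ball_cong bex_cong)
qed

lemma not_private:
  assumes e: "codes_edges e E" and c: "codes_edges c C" "elems c \<subseteq> elems e"
  shows "elems ` elems (not_private e c) = {d \<in> C. \<not> has_private E d}"
    "elems (not_private e c) \<subseteq> elems c"
proof -
  show "elems (not_private e c) \<subseteq> elems c"
    by (auto simp: not_private_def)
  have "elems ` {d \<in> elems c. \<not> has_private E (elems d)} = {d \<in> C. \<not> has_private E d}"
    using codes_edgesD(3)[OF c(1)] by auto
  moreover have "elems (not_private e c) = {d \<in> elems c. \<not> has_private E (elems d)}"
    using is_private_iff[OF e] c(2) by (auto simp: not_private_def)
  ultimately show "elems ` elems (not_private e c) = {d \<in> C. \<not> has_private E d}"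
    by simp
qed

lemma free_private:
  assumes e: "codes_edges e E" and c: "codes_edges c C" "elems c \<subseteq> elems e"
  shows "elems ` elems (free_private v e c) =
    {d \<in> C. has_private E d \<and> \<not> blocked (elems v) E {d \<in> C. \<not> has_private E d} d}"
    "elems (free_private v e c) \<subseteq> elems c"
proof -
  let ?P = "\<lambda>d. has_private E d \<and> \<not> blocked (elems v) E {d \<in> C. \<not> has_private E d} d"
  show "elems (free_private v e c) \<subseteq> elems c"
    by (auto simp: free_private_def)
  have "elems (free_private v e c) = {d \<in> elems c. ?P (elems d)}"
    using is_private_iff[OF e] obstructed_iff[OF e _ order_trans[OF not_private(2)[OF e c] c(2)]]
      not_private(1)[OF e c] c(2) unfolding free_private_def by auto
  then show "elems ` elems (free_private v e c) = {d \<in> C. ?P d}"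
    using codes_edgesD(3)[OF c(1)] by auto
qed

section \<open>Correctness of the compression\<close>

lemma left_tag [simp]: "left (tag n x) = Leaf \<longleftrightarrow> n = 0" and right_tag [simp]: "right (tag n x) = x"
  by (cases n; simp add: tag_def)+

lemma elems_append_tree [simp]: "elems (append_tree s t) = elems s \<union> elems t"
  by (simp add: append_tree_def)

lemma elems_tag_all [simp]: "elems (tag_all n t) = tag n ` elems t"
  by (simp add: tag_all_def)

definition sublist_tree :: "tree \<Rightarrow> tree \<Rightarrow> bool" where
  "sublist_tree v t \<longleftrightarrow> (\<exists>P. t = tree_of_list (filter P (list_of_tree v)))"

lemma inj_on_sublist_tree: "inj_on elems {t. sublist_tree v t}"
proof (rule inj_onI)
  have "t = tree_of_list (filter (\<lambda>z. z \<in> elems t) (list_of_tree v))" if "sublist_tree v t" for t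
    using that unfolding sublist_tree_def by (auto intro!: filter_cong)
  then show "s = t" if "s \<in> {t. sublist_tree v t}" "t \<in> {t. sublist_tree v t}" "elems s = elems t"
    for s t
    using that by (metis mem_Collect_eq)
qed

lemma compress_correct:
  fixes r :: nat
  assumes v: "distinct (list_of_tree v)" "elems v = V" and e: "codes_edges e E"
    and inst: "E \<subseteq> Pow V" "\<And>e. e \<in> E \<Longrightarrow> card e \<le> r" "test_cover V E"
    and c: "codes_edges c C" "elems c \<subseteq> elems e"
  obtains V' E' B' k' where
    "codes_subset_test_r_cover (compress r v e c (tree_of_list (replicate k Leaf))) (V', E', B', k')"
    "subset_test_r_cover_instance r (V', E', B', k')"
    "subset_test_r_cover_yes (V', E', B', k') \<longleftrightarrow>
      (\<exists>K\<subseteq>C. test_cover V ((E - C) \<union> K) \<and> card K + k \<le> card C)"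
    "card V' \<le> 5 * (2 * r * card C + 1)" "card E' \<le> card C + 3 * (2 * r * card C + 1)"
    "(\<forall>b\<in>E - C. \<not> test_cover V (E - {b})) \<longrightarrow>
      (test_r_cover_yes (V', E', k') \<longleftrightarrow> subset_test_r_cover_yes (V', E', B', k'))"
proof -
  define b where "b = without e c"
  define v2 where "v2 = relevant v b"
  define X where "X = elems (representatives b v2)"
  have CE: "C \<subseteq> E"
    using c codes_edgesD(3)[OF c(1)] codes_edgesD(3)[OF e] by blast
  have "codes_edges b (E - C)"
    using codes_without[OF e c(2)] codes_edgesD(3)[OF c(1)] by (simp add: b_def)
  then have EC: "E - C = elems ` elems b"
    by (simp add: codes_edges_iff)
  have same_eq: "same_in b x y = (\<forall>f\<in>E - C. x \<in> f \<longleftrightarrow> y \<in> f)"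
    and unc_eq: "uncovered_in b x = (\<forall>f\<in>E - C. x \<notin> f)" for x y
    by (simp_all add: same_in_def uncovered_in_def EC)
  let ?P = "\<lambda>X y. \<not> uncovered_in b y \<and> \<not> (\<exists>x\<in>set X. same_in b x y)"
  have refl: "same_in b x x" for x
    by (simp add: same_in_def)
  have sym: "same_in b x y \<Longrightarrow> same_in b y x" for x y
    by (simp add: same_in_def)
  have X_eq: "X = set (greedy ?P [] (list_of_tree v2))"
    by (simp add: X_def representatives_def)
  have v2_eq: "elems v2 = {x \<in> V. uncovered_in b x \<or> (\<exists>y\<in>V. y \<noteq> x \<and> same_in b x y)}"
    by (auto simp: v2_def relevant_def v(2))
  \<comment> \<open>The defined notions of the locale are instantiated with the predicates of the
    program, so that its facts speak about the program directly. The goals stated with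
    \<open>PROP\<close> are the defining equations.\<close>
  interpret compression r V E C X "same_in b" "uncovered_in b" "elems v2"
    "\<lambda>x. {y \<in> elems v2. same_in b x y}" "small_class r b v2"
  proof (unfold_locales, goal_cases)
    case 6
    have "set (greedy ?P [] (list_of_tree v2)) \<subseteq> {x. \<not> uncovered_in b x}"
      by (rule greedy_invariant) auto
    then show ?case
      using set_greedy[of ?P "[]" "list_of_tree v2"]
      unfolding same_eq[symmetric] unc_eq[symmetric] v2_eq[symmetric] by (auto simp: X_eq)
  next
    case (7 x y)
    have "\<forall>x\<in>set (greedy ?P [] (list_of_tree v2)). \<forall>y\<in>set (greedy ?P [] (list_of_tree v2)).
        same_in b x y \<longrightarrow> x = y"
      by (rule greedy_invariant) (auto dest: sym)
    with 7 show ?case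
      unfolding same_eq[symmetric] by (auto simp: X_eq)
  next
    case (8 y)
    then have y: "y \<in> elems v2" "\<not> uncovered_in b y"
      unfolding same_eq[symmetric] unc_eq[symmetric] v2_eq[symmetric] by auto
    then have "y \<in> X \<or> \<not> ?P (greedy ?P [] (list_of_tree v2)) y"
      unfolding X_eq by (intro greedy_maximal) auto
    with y refl show ?case
      unfolding same_eq[symmetric] by (auto simp: X_eq)
  next
    case (9 x y)
    show "PROP ?case"
      by (rule eq_reflection) (rule same_eq)
  next
    case (10 x)
    show "PROP ?case"
      by (rule eq_reflection) (rule unc_eq)
  next
    case 11
    show "PROP ?case"
      by (rule eq_reflection) (rule v2_eq)
  next
    case (13 x)
    have "distinct (filter (same_in b x) (list_of_tree v2))"
      using v(1) by (simp add: v2_def relevant_def)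
    from distinct_card[OF this] show "PROP ?case"
      by (intro eq_reflection) (simp add: small_class_def)
  qed (use v inst CE in auto)
  define v3 where "v3 = new_vertices r b v2"
  define xs where "xs = small_reps r b v2"
  define b3 where "b3 = new_required v3 b (representatives b v2) xs"
  define c3 where "c3 = new_candidates v3 b3 c"
  define k3 where "k3 = k + card C3 - card C"
  have xs: "elems xs = {x \<in> X. small_class r b v2 x}"
    by (simp add: xs_def small_reps_def X_def)
  have "{1..4} = {1, 2, 3, 4::nat}"
    by auto
  then have "V3 = tag 0 ` elems v2 \<union> (\<Union>n\<in>{1, 2, 3, 4}. tag n ` elems xs)"
    unfolding V3_def xs by (simp only:)
  then have v3: "elems v3 = V3" "distinct (list_of_tree v3)"
    unfolding v3_def new_vertices_def xs_def[symmetric] elems_dedupe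
    by (auto simp: distinct_dedupe)
  have V3_tag: "\<exists>n x. z = tag n x" if "z \<in> V3" for z
    using that by (auto simp: V3_def)
  have eqI: "A = B" if "A \<subseteq> V3" "B \<subseteq> V3" "\<And>n x. tag n x \<in> V3 \<Longrightarrow> tag n x \<in> A \<longleftrightarrow> tag n x \<in> B" for A B
    using that V3_tag by blast
  have f: "elems (new_f v3 b x) = f_edge x" if x: "x \<in> X" for x
  proof (rule eqI)
    show "f_edge x \<subseteq> V3"
      using edges3[of "f_edge x"] x by (auto simp: B3_def)
    show "tag n y \<in> elems (new_f v3 b x) \<longleftrightarrow> tag n y \<in> f_edge x" if "tag n y \<in> V3" for n y
      using that by (auto simp: new_f_def v3)
  qed (auto simp: new_f_def v3)
  have g: "elems (new_g v3 x) = g_edge x" and h: "elems (new_h v3 x) = h_edge x"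
    if "x \<in> elems xs" for x
    using that unfolding new_g_def new_h_def g_edge_def h_edge_def xs by (auto simp: v3)
  have trace: "elems (new_trace v3 d) = trace (elems d)" if d: "d \<in> elems c" for d
  proof (rule eqI)
    have "elems d \<in> C"
      using d codes_edgesD(3)[OF c(1)] by blast
    then show "trace (elems d) \<subseteq> V3"
      by (auto simp: trace_def V3_def)
    show "tag n y \<in> elems (new_trace v3 d) \<longleftrightarrow> tag n y \<in> trace (elems d)" if "tag n y \<in> V3" for n y
      using that by (auto simp: new_trace_def v3)
  qed (auto simp: new_trace_def v3)
  define T where "T = new_trace v3 ` elems c"
  have b3: "elems b3 = new_f v3 b ` X \<union> (new_g v3 ` elems xs \<union> new_h v3 ` elems xs)"
    by (simp add: b3_def new_required_def elems_dedupe X_def)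
  have B3: "elems ` elems b3 = B3"
    unfolding b3 B3_def image_Un image_image xs[symmetric] Un_assoc
    by (intro arg_cong2[of _ _ _ _ "(\<union>)"] image_cong HOL.refl f g h)
  have "elems ` T = trace ` elems ` elems c"
    unfolding T_def image_image by (intro image_cong HOL.refl trace)
  then have T: "elems ` T = trace ` C"
    using codes_edgesD(3)[OF c(1)] by simp
  have sub: "sublist_tree v3 t" if "t \<in> elems b3 \<union> T" for t
    using that unfolding b3 T_def sublist_tree_def new_f_def new_g_def new_h_def new_trace_def by blast
  \<comment> \<open>Needed for \<open>C3\<close>: the program takes the difference of sets of trees,
    and without injectivity a tree outside \<open>elems b3\<close> might still denote an edge of
    \<open>B3\<close>.\<close>
  have inj: "inj_on elems (elems b3 \<union> T)"
    by (rule inj_on_subset[OF inj_on_sublist_tree[of v3]]) (use sub in blast)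
  let ?Q = "\<lambda>acc t. t \<notin> set acc \<and> t \<notin> elems b3"
  have c3_eq: "c3 = tree_of_list (greedy ?Q [] (map (new_trace v3) (list_of_tree c)))"
    by (simp add: c3_def new_candidates_def)
  have "distinct (list_of_tree c3) \<and> elems c3 \<subseteq> - elems b3"
    unfolding c3_eq list_of_tree_of_list by (rule greedy_invariant) auto
  moreover have "elems c3 \<subseteq> T"
    using set_greedy[of ?Q "[]" "map (new_trace v3) (list_of_tree c)"] by (auto simp: c3_eq T_def)
  moreover have "t \<in> elems c3 \<or> \<not> ?Q (list_of_tree c3) t" if "t \<in> T" for t
    unfolding c3_eq list_of_tree_of_list
    by (rule greedy_maximal) (use that in \<open>auto simp: T_def\<close>)
  ultimately have c3: "distinct (list_of_tree c3)" "elems c3 = T - elems b3"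
    by auto
  have C3: "elems ` elems c3 = C3"
    unfolding c3(2) C3_def T[symmetric] B3[symmetric]
    by (rule inj_on_image_set_diff[OF inj]) auto
  have dist: "distinct (list_of_tree t)" if "t \<in> elems b3 \<union> T" for t
    using sub[OF that] v3(2) by (auto simp: sublist_tree_def)
  have b3_dist: "distinct (list_of_tree b3)"
    by (simp add: b3_def new_required_def distinct_dedupe)
  have codes_b3: "codes_edges b3 B3"
    unfolding codes_edges_iff using b3_dist B3 dist inj_on_subset[OF inj, of "elems b3"] by auto
  have codes_e3: "codes_edges (append_tree c3 b3) (C3 \<union> B3)"
    unfolding codes_edges_iff
  proof (intro conjI)
    show "distinct (list_of_tree (append_tree c3 b3))"
      using c3 b3_dist by (auto simp: append_tree_def)
    show "inj_on elems (elems (append_tree c3 b3))"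
      by (rule inj_on_subset[OF inj]) (use c3 in auto)
    show "elems ` elems (append_tree c3 b3) = C3 \<union> B3"
      by (simp only: elems_append_tree image_Un B3 C3)
    show "\<forall>f\<in>elems (append_tree c3 b3). distinct (list_of_tree f)"
      using c3 dist by auto
  qed
  have len_c: "length (list_of_tree c) = card C"
    using codes_subset(2)[OF c(1) subset_refl codes_edgesD(1)[OF c(1)]] codes_edgesD(3)[OF c(1)]
    by simp
  have "inj_on elems (elems c3)"
    by (rule inj_on_subset[OF inj]) (use c3 in auto)
  then have len_c3: "length (list_of_tree c3) = card C3"
    using card_image[of elems "elems c3"] distinct_card[OF c3(1)] C3 by simp
  have "card C3 \<le> card C"
    using card_mono[of "trace ` C" C3] card_image_le[OF finC, of trace] finC by (force simp: C3_def)
  then have "drop (length (list_of_tree c))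
      (list_of_tree (append_tree c3 (tree_of_list (replicate k Leaf)))) = replicate k3 Leaf"
    by (simp add: append_tree_def len_c len_c3 k3_def)
  then have compress: "compress r v e c (tree_of_list (replicate k Leaf)) =
      Node v3 (Node (append_tree c3 b3) (Node b3 (code_int (int k3))))"
    unfolding compress_def Let_def b_def[symmetric] v2_def[symmetric] v3_def[symmetric]
      xs_def[symmetric] b3_def[symmetric] compress_with_def c3_def[symmetric]
    by (simp add: code_int_def)
  show thesis
  proof (rule that[of V3 "C3 \<union> B3" B3 "int k3"])
    show "codes_subset_test_r_cover (compress r v e c (tree_of_list (replicate k Leaf)))
        (V3, C3 \<union> B3, B3, int k3)"
      unfolding compress using v3 codes_e3 codes_b3 by (simp add: codes_vertices_iff)
    show "subset_test_r_cover_instance r (V3, C3 \<union> B3, B3, int k3)"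
      using instance3 by simp
    show "subset_test_r_cover_yes (V3, C3 \<union> B3, B3, int k3) \<longleftrightarrow>
        (\<exists>K\<subseteq>C. test_cover V ((E - C) \<union> K) \<and> card K + k \<le> card C)"
      unfolding k3_def by (rule yes3)
    have "test_r_cover_yes (V3, C3 \<union> B3, int k3) \<longleftrightarrow>
        subset_test_r_cover_yes (V3, C3 \<union> B3, B3, int k3)"
      if "\<And>b. b \<in> E - C \<Longrightarrow> \<not> test_cover V (E - {b})"
      using required3[OF that] by auto
    then show "(\<forall>b\<in>E - C. \<not> test_cover V (E - {b})) \<longrightarrow>
        (test_r_cover_yes (V3, C3 \<union> B3, int k3) \<longleftrightarrow>
         subset_test_r_cover_yes (V3, C3 \<union> B3, B3, int k3))"
      by blast
  qed (rule card3)+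
qed

text \<open>For \<open>r\<close> at least 2 the factor \<open>(2 * r + 1) * r + 1\<close> is at most
  \<open>3 * r ^ 2\<close>, so \<open>r * c\<close> is at most 9 y with y = r^5 (k - 1). As y is at
  least 1, the vertex bound 5 (2 * 9 y + 1) is at most 95 y, and the edge bound is smaller. The
  remaining factor \<open>k ^ 5 * r ^ 11\<close> is at least 2^16.\<close>

lemma size_bounds:
  fixes r k c :: nat
  assumes r: "2 \<le> r" and k: "2 \<le> k" and c: "c \<le> ((2 * r + 1) * r + 1) * (((2 * r + 1) * r + 1) * (k - 1))"
  shows "5 * (2 * r * c + 1) \<le> (k - 1) * k ^ 5 * r ^ 16"
    "c + 3 * (2 * r * c + 1) \<le> (k - 1) * k ^ 5 * r ^ 16"
proof -
  have "2 * r \<le> r * r"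
    using r by (intro mult_right_mono) auto
  moreover have "(2 * r + 1) * r + 1 = 2 * (r * r) + r + 1"
    by (simp add: algebra_simps)
  ultimately have a: "(2 * r + 1) * r + 1 \<le> 3 * r ^ 2"
    using r unfolding power2_eq_square by linarith
  have "c \<le> (3 * r ^ 2) * ((3 * r ^ 2) * (k - 1))"
    using c by (rule order_trans) (intro mult_mono a order_refl zero_le)
  then have "r * c \<le> r * ((3 * r ^ 2) * ((3 * r ^ 2) * (k - 1)))"
    by (rule mult_le_mono2)
  also have "r * ((3 * r ^ 2) * ((3 * r ^ 2) * j)) = 9 * (r ^ 5 * j)" for j
    by (simp add: power_numeral_reduce)
  finally have rc: "r * c \<le> 9 * (r ^ 5 * (k - 1))" .
  define y where "y = r ^ 5 * (k - 1)"
  have y: "1 \<le> y"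
    using r k by (simp add: y_def Suc_le_eq)
  have "2 ^ 5 * 2 ^ 11 \<le> k ^ 5 * r ^ 11"
    using r k by (intro mult_mono power_mono) auto
  then have "95 \<le> k ^ 5 * r ^ 11"
    by simp
  then have "95 * y \<le> (k ^ 5 * r ^ 11) * y"
    by (rule mult_right_mono) simp
  also have "\<dots> = (k - 1) * k ^ 5 * (r ^ 11 * r ^ 5)"
    by (simp only: y_def mult_ac)
  also have "r ^ 11 * r ^ 5 = r ^ 16"
    by (simp flip: power_add)
  finally have bound: "95 * y \<le> (k - 1) * k ^ 5 * r ^ 16" .
  define q where "q = r * c"
  have "c \<le> q" "q \<le> 9 * y"
    using r rc by (simp_all add: q_def y_def)
  then have "c + 3 * (2 * q + 1) \<le> 95 * y" "5 * (2 * q + 1) \<le> 95 * y"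
    using y by simp_all
  then have "c + 3 * (2 * r * c + 1) \<le> 95 * y" "5 * (2 * r * c + 1) \<le> 95 * y"
    unfolding q_def by (simp_all only: mult.assoc)
  then show "5 * (2 * r * c + 1) \<le> (k - 1) * k ^ 5 * r ^ 16"
    "c + 3 * (2 * r * c + 1) \<le> (k - 1) * k ^ 5 * r ^ 16"
    using bound order_trans by blast+
qed

section \<open>Correctness of the kernelizations\<close>

lemma reduce_correct:
  fixes r k :: nat
  assumes r: "2 \<le> r" and v: "distinct (list_of_tree v)" "elems v = V"
    and e: "codes_edges e E" and b: "codes_edges b B"
    and inst: "E \<subseteq> Pow V" "\<And>e. e \<in> E \<Longrightarrow> card e \<le> r" "test_cover V E" "B \<subseteq> E"
    and R: "R \<subseteq> E - B" "test_cover V (E - R)" "0 < card R" "card R < k"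
      "\<And>c. c \<in> E - B - R \<Longrightarrow> \<not> test_cover V (E - R - {c})"
  obtains V' E' B' k' where
    "codes_subset_test_r_cover (reduce r v e b (tree_of_list (replicate k Leaf))) (V', E', B', k')"
    "subset_test_r_cover_instance r (V', E', B', k')"
    "subset_test_r_cover_yes (V', E', B', k') \<longleftrightarrow> subset_test_r_cover_yes (V, E, B, int k)"
    "card V' \<le> (k - 1) * k ^ 5 * r ^ 16" "card E' \<le> (k - 1) * k ^ 5 * r ^ 16"
    "B = {} \<longrightarrow> (test_r_cover_yes (V', E', k') \<longleftrightarrow> subset_test_r_cover_yes (V', E', B', k'))"
proof -
  note result = that
  have V: "finite V"
    using v by auto
  have finE: "finite E"
    using V inst(1) by (auto intro: finite_subset)
  let ?a = "(2 * r + 1) * r + 1"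
  \<comment> \<open>Shared by both branches: \<open>e1\<close> is either \<open>e\<close> itself or
    \<open>e\<close> without the discarded edge, with \<open>k1\<close> equal to \<open>k\<close> or
    its predecessor.\<close>
  have step: thesis
    if e1: "codes_edges e1 E1" and E1: "E1 \<subseteq> E" "test_cover V E1" "B \<subseteq> E1"
      and reduce: "reduce r v e b (tree_of_list (replicate k Leaf)) =
        compress r v e1 (candidates v e1 b) (tree_of_list (replicate k1 Leaf))"
      and yes: "subset_test_r_cover_yes (V, E1, B, int k1) \<longleftrightarrow> subset_test_r_cover_yes (V, E, B, int k)"
      and card: "card (redundant V E1 B) \<le> ?a * (?a * (k - 1))"
    for e1 E1 k1
  proof -
    let ?C = "redundant V E1 B"
    have cand: "codes_edges (candidates v e1 b) ?C"
      using codes_candidates(1)[OF e1 b, of v] v(2) by simp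
    have k: "2 \<le> k"
      using R(3,4) by simp
    have fin1: "finite E1"
      using finE E1(1) by (rule rev_finite_subset)
    have inst1: "E1 \<subseteq> Pow V" "\<And>e. e \<in> E1 \<Longrightarrow> card e \<le> r"
      using inst E1(1) by blast+
    obtain V' E' B' k' where new:
      "codes_subset_test_r_cover
        (compress r v e1 (candidates v e1 b) (tree_of_list (replicate k1 Leaf))) (V', E', B', k')"
      "subset_test_r_cover_instance r (V', E', B', k')"
      "subset_test_r_cover_yes (V', E', B', k') \<longleftrightarrow>
        (\<exists>K\<subseteq>?C. test_cover V ((E1 - ?C) \<union> K) \<and> card K + k1 \<le> card ?C)"
      "card V' \<le> 5 * (2 * r * card ?C + 1)" "card E' \<le> card ?C + 3 * (2 * r * card ?C + 1)"
      "(\<forall>b\<in>E1 - ?C. \<not> test_cover V (E1 - {b})) \<longrightarrow>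
        (test_r_cover_yes (V', E', k') \<longleftrightarrow> subset_test_r_cover_yes (V', E', B', k'))"
      by (rule compress_correct[OF v e1 inst1 E1(2) cand candidates_subset, of k1]) blast
    show thesis
    proof (rule result)
      show "codes_subset_test_r_cover (reduce r v e b (tree_of_list (replicate k Leaf))) (V', E', B', k')"
        unfolding reduce by (rule new(1))
      show "subset_test_r_cover_yes (V', E', B', k') \<longleftrightarrow> subset_test_r_cover_yes (V, E, B, int k)"
        unfolding new(3) yes[symmetric] by (rule subset_yes_iff_keep[OF fin1 E1(3) refl, symmetric])
      show "card V' \<le> (k - 1) * k ^ 5 * r ^ 16" "card E' \<le> (k - 1) * k ^ 5 * r ^ 16"
        using new(4,5) size_bounds[OF r k card] order_trans by blast+
      have "\<forall>b\<in>E1 - ?C. \<not> test_cover V (E1 - {b})" if "B = {}"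
        using that by (simp add: redundant_def)
      with new(6) show "B = {} \<longrightarrow>
          (test_r_cover_yes (V', E', k') \<longleftrightarrow> subset_test_r_cover_yes (V', E', B', k'))"
        by blast
    qed (rule new(2))
  qed
  let ?C = "redundant V E B"
  let ?C' = "{c \<in> ?C. \<not> has_private E c}"
  have cand: "codes_edges (candidates v e b) ?C"
    using codes_candidates(1)[OF e b, of v] v(2) by simp
  have "card ?C' \<le> ?a * card R"
    by (rule card_redundant_not_private[OF V inst(1,2) R(1,2,5)])
  also have "\<dots> \<le> ?a * (k - 1)"
    using R(4) by (intro mult_le_mono2) simp
  finally have C': "card ?C' \<le> ?a * (k - 1)" .
  define d where "d = free_private v e (candidates v e b)"
  have d: "elems ` elems d = {d \<in> ?C. has_private E d \<and> \<not> blocked V E ?C' d}" "elems d \<subseteq> elems e"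
    using free_private[OF e cand candidates_subset, of v] candidates_subset[of v e b] v(2)
    by (auto simp: d_def)
  show thesis
  proof (cases d)
    case Leaf
    then have "blocked V E ?C' c" if "c \<in> ?C" "has_private E c" for c
      using d(1) that by auto
    then have "card ?C \<le> ?a * (?a * (k - 1))"
      by (intro card_redundant_unblocked[OF V inst(1,2) _ C'])
    then show thesis
      using e inst(3,4) Leaf by (intro step[of e E k]) (auto simp: reduce_def d_def)
  next
    case (Node d0 ds)
    let ?d = "elems d0"
    have "?d \<in> elems ` elems d"
      using Node by simp
    then have d0: "?d \<in> ?C" "has_private E ?d" "\<not> blocked V E ?C' ?d"
      unfolding d(1) by auto
    then have dE: "?d \<in> E" "?d \<notin> B" "test_cover V (E - {?d})"
      by (auto simp: redundant_def)
    obtain k1 where k1: "k = Suc k1"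
      using R(4) by (cases k) auto
    have UE: "\<Union>E \<subseteq> V"
      using inst(1) by blast
    have "d0 \<in> elems e"
      using d(2) Node by simp
    then have e1: "codes_edges (without e (Node d0 Leaf)) (E - {?d})"
      using codes_without[OF e, of "Node d0 Leaf"] by simp
    \<comment> \<open>After the discard only candidates without private vertex survive, so the bound
      for the first kind alone applies.\<close>
    have "card (redundant V (E - {?d}) B) \<le> card ?C'"
      using redundant_discard[OF UE dE(1) d0(2)] finE
      by (intro card_mono) (auto simp: redundant_def)
    also have "\<dots> \<le> ?a * (?a * (k - 1))"
      using C' by (rule order_trans) simp
    finally have card: "card (redundant V (E - {?d}) B) \<le> ?a * (?a * (k - 1))" .
    show thesis
    proof (rule step[OF e1 _ dE(3) _ _ _ card, of k1])
      show "reduce r v e b (tree_of_list (replicate k Leaf)) =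
          compress r v (without e (Node d0 Leaf)) (candidates v (without e (Node d0 Leaf)) b)
            (tree_of_list (replicate k1 Leaf))"
        using Node unfolding reduce_def Let_def d_def[symmetric] k1 by simp
      show "subset_test_r_cover_yes (V, E - {?d}, B, int k1) \<longleftrightarrow>
          subset_test_r_cover_yes (V, E, B, int k)"
        unfolding k1 by (rule subset_yes_discard_unblocked[OF UE finE inst(4) d0, symmetric])
    qed (use inst(4) dE in auto)
  qed
qed

lemma codes_trivial: "codes_subset_test_r_cover (trivial k) ({}, {}, {}, k)"
  by (simp add: trivial_def codes_vertices_iff codes_edges_iff)

text \<open>The parameter may be any integer, and even the empty output must respect the bounds. For
  \<open>k\<close> at most 0 both \<open>k - 1\<close> and \<open>k ^ 5\<close> are
  nonpositive.\<close>

lemma bound_nonneg: "0 \<le> (k - 1) * k ^ 5 * int r ^ 16"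
proof (cases "1 \<le> k")
  case False
  then have "k ^ 5 \<le> 0"
    by (cases "k = 0") (auto simp: power_le_zero_eq)
  with False show ?thesis
    by (intro mult_nonneg_nonneg mult_nonpos_nonpos) auto
qed simp

text \<open>For negative \<open>k = - j\<close> the product is (1 + j) j^5 r^16, which outweighs the
  summand - j.\<close>

lemma bound_add_nonneg:
  assumes "2 \<le> r"
  shows "0 \<le> (k - 1) * k ^ 5 * int r ^ 16 + k"
proof (cases "0 \<le> k")
  case False
  define j where "j = - k"
  have j: "1 \<le> j"
    using False by (simp add: j_def)
  have "1 * j \<le> (1 + j) * j"
    using j by (intro mult_right_mono) auto
  also have "\<dots> \<le> (1 + j) * j * j ^ 4"
    using j mult_left_mono[of 1 "j ^ 4" "(1 + j) * j"] by (simp add: one_le_power)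
  also have "\<dots> \<le> (1 + j) * j * j ^ 4 * int r ^ 16"
    using j assms mult_left_mono[of 1 "int r ^ 16" "(1 + j) * j * j ^ 4"] by (simp add: one_le_power)
  also have "\<dots> = (k - 1) * k ^ 5 * int r ^ 16"
    by (simp add: j_def power_numeral_reduce algebra_simps)
  finally show ?thesis
    by (simp add: j_def)
qed (use bound_nonneg[of k r] in simp)

lemma subset_kernel_correct:
  fixes r :: nat
  assumes r: "2 \<le> r" and inst: "subset_test_r_cover_instance r (V, E, B, k)"
    and codes: "codes_subset_test_r_cover w (V, E, B, k)"
  obtains V' E' B' k' where
    "codes_subset_test_r_cover (subset_kernel r w) (V', E', B', k')"
    "subset_test_r_cover_instance r (V', E', B', k')"
    "subset_test_r_cover_yes (V', E', B', k') \<longleftrightarrow> subset_test_r_cover_yes (V, E, B, k)"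
    "int (card V') \<le> (k - 1) * k ^ 5 * int r ^ 16 + 1"
    "int (card E') \<le> (k - 1) * k ^ 5 * int r ^ 16 + k"
    "B = {} \<longrightarrow> (test_r_cover_yes (V', E', k') \<longleftrightarrow> subset_test_r_cover_yes (V', E', B', k'))"
proof -
  note result = that
  obtain v e b where w: "w = Node v (Node e (Node b (code_int k)))"
    and v: "distinct (list_of_tree v)" "elems v = V"
    and e: "codes_edges e E" and b: "codes_edges b B"
    using codes by (auto simp: codes_vertices_iff)
  have VE: "finite V" "E \<subseteq> Pow V" "\<And>e. e \<in> E \<Longrightarrow> card e \<le> r" "test_cover V E" "B \<subseteq> E"
    using inst by auto
  have finE: "finite E"
    using VE(1,2) by (auto intro: finite_subset)
  define l where "l = length (list_of_tree (discardable v e b))"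
  obtain R where R: "R \<subseteq> E - B" "card R = l" "test_cover V (E - R)"
    "\<And>c. c \<in> E - B - R \<Longrightarrow> \<not> test_cover V (E - R - {c})"
    using discardable[OF e b, of v] v(2) VE(4) by (auto simp: l_def)
  have empty: "discardable v e b = Leaf \<longleftrightarrow> l = 0"
    by (cases "discardable v e b") (auto simp: l_def)
  have kernel: "subset_kernel r w = (if k < 0 \<or> nat \<bar>k\<bar> \<le> l then trivial 0
      else if l = 0 then trivial 1 else reduce r v e b (tree_of_list (replicate (nat \<bar>k\<bar>) Leaf)))"
    by (auto simp: subset_kernel_def w code_int_def empty Let_def simp flip: l_def)
  note yes = subset_yes_iff_discard[OF finE VE(5), of V k]
  have triv: thesis if "subset_kernel r w = trivial j"
    "subset_test_r_cover_yes (V, E, B, k) \<longleftrightarrow> j = 0" "j = 0 \<or> j = 1" for j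
  proof (rule result)
    show "codes_subset_test_r_cover (subset_kernel r w) ({}, {}, {}, j)"
      unfolding that(1) by (rule codes_trivial)
    show "subset_test_r_cover_yes ({}, {}, {}, j) \<longleftrightarrow> subset_test_r_cover_yes (V, E, B, k)"
      unfolding that(2) using that(3) by (auto simp: test_cover_def)
    show "int (card ({} :: tree set)) \<le> (k - 1) * k ^ 5 * int r ^ 16 + 1"
      "int (card ({} :: tree set set)) \<le> (k - 1) * k ^ 5 * int r ^ 16 + k"
      using bound_nonneg[of k r] bound_add_nonneg[OF r, of k] by simp_all
  qed (simp_all add: test_cover_def)
  consider "k < 0 \<or> nat \<bar>k\<bar> \<le> l" | "0 \<le> k" "l < nat k" "l = 0" | "0 \<le> k" "l < nat k" "0 < l"
    by linarith
  then show thesis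
  proof cases
    case 1
    then have "k \<le> int (card R)"
      using R(2) by auto
    then have "subset_test_r_cover_yes (V, E, B, k)"
      unfolding yes using R(1,3) by blast
    then show thesis
      using 1 by (intro triv[of 0]) (simp_all add: kernel)
  next
    case 2
    \<comment> \<open>The greedy set is empty, so no unforced edge can be discarded even alone; as
      \<open>k\<close> is at least 1 here, the answer is no.\<close>
    have "R = {}"
      using R(1,2) 2(3) finE finite_subset by fastforce
    have "\<not> subset_test_r_cover_yes (V, E, B, k)"
      unfolding yes
    proof
      assume "\<exists>R\<subseteq>E - B. test_cover V (E - R) \<and> k \<le> int (card R)"
      then obtain S where S: "S \<subseteq> E - B" "test_cover V (E - S)" "k \<le> int (card S)"
        by blast
      then have "S \<noteq> {}"
        using 2 by auto
      then obtain c where c: "c \<in> S"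
        by blast
      have "test_cover V (E - {c})"
        using S(2) by (rule test_cover_mono) (use c in blast)
      then show False
        using R(4)[of c] \<open>R = {}\<close> c S(1) by auto
    qed
    then show thesis
      using 2 by (intro triv[of 1]) (simp_all add: kernel)
  next
    case 3
    define n where "n = nat k"
    have k: "k = int n" "1 \<le> n"
      using 3 by (auto simp: n_def)
    have R': "0 < card R" "card R < n"
      using 3 R(2) by (auto simp: n_def)
    have kernel': "subset_kernel r w = reduce r v e b (tree_of_list (replicate n Leaf))"
      using 3 by (simp add: kernel n_def)
    have bound: "int ((n - 1) * n ^ 5 * r ^ 16) = (k - 1) * k ^ 5 * int r ^ 16"
      using k by (simp add: of_nat_diff)
    obtain V' E' B' k' where new:
      "codes_subset_test_r_cover (reduce r v e b (tree_of_list (replicate n Leaf))) (V', E', B', k')"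
      "subset_test_r_cover_instance r (V', E', B', k')"
      "subset_test_r_cover_yes (V', E', B', k') \<longleftrightarrow> subset_test_r_cover_yes (V, E, B, int n)"
      "card V' \<le> (n - 1) * n ^ 5 * r ^ 16" "card E' \<le> (n - 1) * n ^ 5 * r ^ 16"
      "B = {} \<longrightarrow> (test_r_cover_yes (V', E', k') \<longleftrightarrow> subset_test_r_cover_yes (V', E', B', k'))"
      by (rule reduce_correct[OF r v e b VE(2-5) R(1,3) R' R(4)]) blast
    show thesis
    proof (rule result)
      show "codes_subset_test_r_cover (subset_kernel r w) (V', E', B', k')"
        unfolding kernel' by (rule new(1))
      show "subset_test_r_cover_yes (V', E', B', k') \<longleftrightarrow> subset_test_r_cover_yes (V, E, B, k)"
        unfolding k(1) by (rule new(3))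
      have "int (card V') \<le> (k - 1) * k ^ 5 * int r ^ 16"
        "int (card E') \<le> (k - 1) * k ^ 5 * int r ^ 16"
        unfolding bound[symmetric] using new(4,5) by (simp_all only: of_nat_le_iff)
      then show "int (card V') \<le> (k - 1) * k ^ 5 * int r ^ 16 + 1"
        "int (card E') \<le> (k - 1) * k ^ 5 * int r ^ 16 + k"
        using k(1) by simp_all
    qed (rule new(2) new(6))+
  qed
qed

lemma full_kernel_correct:
  fixes r :: nat
  assumes r: "2 \<le> r" and inst: "test_r_cover_instance r (V, E, k)"
    and codes: "codes_test_r_cover w (V, E, k)"
  obtains V' E' k' where
    "codes_test_r_cover (full_kernel r w) (V', E', k')" "test_r_cover_instance r (V', E', k')"
    "test_r_cover_yes (V', E', k') \<longleftrightarrow> test_r_cover_yes (V, E, k)"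
    "int (card V') \<le> (k - 1) * k ^ 5 * int r ^ 16 + 1"
    "int (card E') \<le> (k - 1) * k ^ 5 * int r ^ 16 + k"
proof -
  define w1 where "w1 = Node (left w) (Node (left (right w)) (Node Leaf (right (right w))))"
  have "codes_subset_test_r_cover w1 (V, E, {}, k)"
    using codes by (auto simp: w1_def codes_edges_iff)
  moreover have "subset_test_r_cover_instance r (V, E, {}, k)"
    using inst by simp
  ultimately obtain V' E' B' k' where new:
    "codes_subset_test_r_cover (subset_kernel r w1) (V', E', B', k')"
    "subset_test_r_cover_instance r (V', E', B', k')"
    "subset_test_r_cover_yes (V', E', B', k') \<longleftrightarrow> subset_test_r_cover_yes (V, E, {}, k)"
    "int (card V') \<le> (k - 1) * k ^ 5 * int r ^ 16 + 1"
    "int (card E') \<le> (k - 1) * k ^ 5 * int r ^ 16 + k"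
    "test_r_cover_yes (V', E', k') \<longleftrightarrow> subset_test_r_cover_yes (V', E', B', k')"
    using subset_kernel_correct[OF r, of V E "{}" k w1] by metis
  have kernel: "full_kernel r w = Node (left (subset_kernel r w1))
      (Node (left (right (subset_kernel r w1))) (right (right (right (subset_kernel r w1)))))"
    by (simp add: full_kernel_def w1_def Let_def)
  show thesis
  proof (rule that)
    show "codes_test_r_cover (full_kernel r w) (V', E', k')"
      unfolding kernel using new(1) by auto
    show "test_r_cover_instance r (V', E', k')"
      using new(2) by simp
    show "test_r_cover_yes (V', E', k') \<longleftrightarrow> test_r_cover_yes (V, E, k)"
      using new(3,6) by simp
  qed (rule new(4,5))+
qed

theorem theorem16:
  fixes r :: nat
  assumes "r \<ge> 2"
  shows "admits_kernel (Subset_Test_r_Cover r)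
           (\<lambda>k. (k - 1) * k ^ 5 * int r ^ 16 + 1)
           (\<lambda>k. (k - 1) * k ^ 5 * int r ^ 16 + k) \<and>
         admits_kernel (Test_r_Cover r)
           (\<lambda>k. 5 * (k - 1) * k ^ 5 * int r ^ 16 + 4 * k + 1)
           (\<lambda>k. 3 * (k - 1) * k ^ 5 * int r ^ 16 + 3 * k)"
proof
  obtain c and p :: "nat poly" where cp:
    "\<And>w. \<exists>t. computes_in c w t (subset_kernel r w) \<and> t \<le> poly p (size w)"
    using ptime_computes_in[OF ptime_subset_kernel] by blast
  show "admits_kernel (Subset_Test_r_Cover r)
      (\<lambda>k. (k - 1) * k ^ 5 * int r ^ 16 + 1) (\<lambda>k. (k - 1) * k ^ 5 * int r ^ 16 + k)"
    unfolding admits_kernel_def Subset_Test_r_Cover_def parameterized_problem.simps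
  proof (rule exI[of _ c], rule exI[of _ p], intro allI impI, elim conjE)
    fix w :: tree and I :: "tree set \<times> tree set set \<times> tree set set \<times> int"
    assume inst: "subset_test_r_cover_instance r I" and codes: "codes_subset_test_r_cover w I"
    obtain V E B k where I: "I = (V, E, B, k)"
      by (cases I) auto
    obtain t where t: "computes_in c w t (subset_kernel r w)" "t \<le> poly p (size w)"
      using cp by blast
    obtain V' E' B' k' where new:
      "codes_subset_test_r_cover (subset_kernel r w) (V', E', B', k')"
      "subset_test_r_cover_instance r (V', E', B', k')"
      "subset_test_r_cover_yes (V', E', B', k') \<longleftrightarrow> subset_test_r_cover_yes (V, E, B, k)"
      "int (card V') \<le> (k - 1) * k ^ 5 * int r ^ 16 + 1"
      "int (card E') \<le> (k - 1) * k ^ 5 * int r ^ 16 + k"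
      using subset_kernel_correct[OF assms inst[unfolded I] codes[unfolded I]] by metis
    show "\<exists>t w' I'. computes_in c w t w' \<and> t \<le> poly p (size w) \<and>
        subset_test_r_cover_instance r I' \<and> codes_subset_test_r_cover w' I' \<and>
        (subset_test_r_cover_yes I' \<longleftrightarrow> subset_test_r_cover_yes I) \<and>
        int ((\<lambda>(V, E, B, k). card V) I') \<le>
          ((\<lambda>(V, E, B, k). k) I - 1) * ((\<lambda>(V, E, B, k). k) I) ^ 5 * int r ^ 16 + 1 \<and>
        int ((\<lambda>(V, E, B, k). card E) I') \<le>
          ((\<lambda>(V, E, B, k). k) I - 1) * ((\<lambda>(V, E, B, k). k) I) ^ 5 * int r ^ 16 +
            (\<lambda>(V, E, B, k). k) I"
      unfolding I prod.case
      by (rule exI[of _ t], rule exI[of _ "subset_kernel r w"], rule exI[of _ "(V', E', B', k')"])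
        (intro conjI; use t new in \<open>simp only: prod.case\<close>)
  qed
next
  obtain c and p :: "nat poly" where cp:
    "\<And>w. \<exists>t. computes_in c w t (full_kernel r w) \<and> t \<le> poly p (size w)"
    using ptime_computes_in[OF ptime_full_kernel] by blast
  show "admits_kernel (Test_r_Cover r) (\<lambda>k. 5 * (k - 1) * k ^ 5 * int r ^ 16 + 4 * k + 1)
      (\<lambda>k. 3 * (k - 1) * k ^ 5 * int r ^ 16 + 3 * k)"
    unfolding admits_kernel_def Test_r_Cover_def parameterized_problem.simps
  proof (rule exI[of _ c], rule exI[of _ p], intro allI impI, elim conjE)
    fix w :: tree and I :: "tree set \<times> tree set set \<times> int"
    assume inst: "test_r_cover_instance r I" and codes: "codes_test_r_cover w I"
    obtain V E k where I: "I = (V, E, k)"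
      by (cases I) auto
    obtain t where t: "computes_in c w t (full_kernel r w)" "t \<le> poly p (size w)"
      using cp by blast
    obtain V' E' k' where new:
      "codes_test_r_cover (full_kernel r w) (V', E', k')" "test_r_cover_instance r (V', E', k')"
      "test_r_cover_yes (V', E', k') \<longleftrightarrow> test_r_cover_yes (V, E, k)"
      "int (card V') \<le> (k - 1) * k ^ 5 * int r ^ 16 + 1"
      "int (card E') \<le> (k - 1) * k ^ 5 * int r ^ 16 + k"
      using full_kernel_correct[OF assms inst[unfolded I] codes[unfolded I]] by metis
    define x where "x = (k - 1) * k ^ 5 * int r ^ 16"
    \<comment> \<open>The bounds of the second problem exceed those of the first by 4 (x + k) for
      the vertices and by 2 (x + k) for the edges.\<close>
    have "0 \<le> x + k"
      using bound_add_nonneg[OF assms] by (simp add: x_def)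
    moreover have "5 * (k - 1) * k ^ 5 * int r ^ 16 = 5 * x"
      "3 * (k - 1) * k ^ 5 * int r ^ 16 = 3 * x"
      by (simp_all add: x_def)
    ultimately have bounds: "int (card V') \<le> 5 * (k - 1) * k ^ 5 * int r ^ 16 + 4 * k + 1"
      "int (card E') \<le> 3 * (k - 1) * k ^ 5 * int r ^ 16 + 3 * k"
      using new(4,5) unfolding x_def[symmetric] by simp_all
    show "\<exists>t w' I'. computes_in c w t w' \<and> t \<le> poly p (size w) \<and>
        test_r_cover_instance r I' \<and> codes_test_r_cover w' I' \<and>
        (test_r_cover_yes I' \<longleftrightarrow> test_r_cover_yes I) \<and>
        int ((\<lambda>(V, E, k). card V) I') \<le>
          5 * ((\<lambda>(V, E, k). k) I - 1) * ((\<lambda>(V, E, k). k) I) ^ 5 * int r ^ 16 +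
            4 * (\<lambda>(V, E, k). k) I + 1 \<and>
        int ((\<lambda>(V, E, k). card E) I') \<le>
          3 * ((\<lambda>(V, E, k). k) I - 1) * ((\<lambda>(V, E, k). k) I) ^ 5 * int r ^ 16 +
            3 * (\<lambda>(V, E, k). k) I"
      unfolding I prod.case
      by (rule exI[of _ t], rule exI[of _ "full_kernel r w"], rule exI[of _ "(V', E', k')"])
        (intro conjI; use t new bounds in \<open>simp only: prod.case\<close>)
  qed
qed

end
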